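(* Let $\mathcal C_1,\mathcal C_2$ be symmetric monoidal closed categories and let $f^*:\mathcal C_1\to\mathcal C_2$ be a symmetric monoidal functor having a right adjoint $f_*$, which itself has a right adjoint $f^!$. Assume that the projection morphism $\pi:f_*(-)\otimes *\to f_*(-\otimes f^*( * ))$ is an isomorphism. Let $K$ and $M$ be objects of $\mathcal C_1$. Then $\pi$ is a morphism of duality preserving functors from $$\{\mathrm{Id}\otimes\mathrm{Id},\tau_{K,M}\}\{f_*\times\mathrm{Id},\zeta_K\times\mathrm{id}\}$$ to $$\{f_*,\zeta_{K\otimes M}\}\,I_{\theta_{K,M}}\,\{\mathrm{Id}\otimes\mathrm{Id},\tau_{f^!K,f^*M}\}\{\mathrm{Id}\times f^*,\mathrm{id}\times\beta_M\},$$ both being duality preserving functors from $(\mathcal C_2\times\mathcal C_1,D_{f^!K}\times D_M,\varpi_{f^!K}\times\varpi_M)$ to $(\mathcal C_1,D_{K\otimes M},\varpi_{K\otimes M})$.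
   Context: Closed categories. A symmetric monoidal closed category $(\mathcal C,\otimes)$ (with symmetry $s$) has an internal Hom $[-,-]$ with adjunctions $(-\otimes X)\dashv[X,-]$ natural in $X$, with counit $\mathrm{ev}^l_{X,A}:[X,A]\otimes X\to A$ and unit $\mathrm{coev}^l_{X,A}:A\to[X,A\otimes X]$. Put $\mathrm{ev}^r_{A,K}=\mathrm{ev}^l_{A,K}\circ s$. Dualities. For an object $K$, $D_K=[-,K]:\mathcal C\to\mathcal C^o$, with opposite functor $D_K^o$, and $\varpi_K:\mathrm{Id}\to D_K^oD_K$ has component $\varpi_{K,A}:A\to[[A,K],K]$ corresponding to $\mathrm{ev}^r_{A,K}:A\otimes[A,K]\to K$ under $(-\otimes[A,K])\dashv[[A,K],-]$. A duality preserving functor $\{F,\phi\}:(\mathcal C_1,D_1,\varpi_1)\to(\mathcal C_2,D_2,\varpi_2)$ is a functor $F$ and a natural transformation $\phi:FD_1^o\to D_2^oF^o$ (components $\phi_A:FD_1A\to D_2FA$) with $\phi_{D_1A}\circ F(\varpi_{1,A})=D_2(\phi_A)\circ\varpi_{2,FA}$ for all $A$. Composition: $\{F',\phi'\}\{F,\phi\}=\{F'F,\phi'F^o\circ F'\phi\}$. A morphism $\{F,\phi\}\to\{F',\phi'\}$ is a natural transformation $\rho:F\to F'$ with $\phi_A=D_2(\rho_A)\circ\phi'_A\circ\rho_{D_1A}$ for all $A$. A morphism $\iota:K\to M$ induces the duality preserving functor $I_\iota=\{\mathrm{Id},\tilde\iota\}:(\mathcal C,D_K,\varpi_K)\to(\mathcal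 C,D_M,\varpi_M)$, where $\tilde\iota:[-,K]\to[-,M]$ is composition with $\iota$. Product. Let $\varrho:(A\otimes B)\otimes(C\otimes D)\to(A\otimes C)\otimes(B\otimes D)$ be the isomorphism exchanging the two middle factors, built from associativity and symmetry. $\tau_{K,M}:D_K(A)\otimes D_M(B)\to D_{K\otimes M}(A\otimes B)$ is the composition $[A,K]\otimes[B,M]\xrightarrow{\mathrm{coev}^l}[A\otimes B,([A,K]\otimes[B,M])\otimes(A\otimes B)]\xrightarrow{\varrho}[A\otimes B,([A,K]\otimes A)\otimes([B,M]\otimes B)]\xrightarrow{\mathrm{ev}^l\otimes\mathrm{ev}^l}[A\otimes B,K\otimes M]$. $\{\mathrm{Id}\otimes\mathrm{Id},\tau_{K,M}\}$ denotes the functor $\otimes$ with $\tau_{K,M}$; it is a duality preserving functor from $(\mathcal C\times\mathcal C,D_K\times D_M,\varpi_K\times\varpi_M)$ to $(\mathcal C,D_{K\otimes M},\varpi_{K\otimes M})$. Pull-back. A symmetric monoidal functor $f^*$ comes with a natural isomorphism $\alpha_{A,B}:f^*A\otimes f^*B\to f^*(A\otimes B)$ compatible with associativity and symmetry (and units, when considered). $\beta_{A,K}$: $f^*[A,K]\xrightarrow{\mathrm{coev}^l}[f^*A,f^*[A,K]\otimes f^*A]\xrightarrow{\alpha}[f^*A,f^*([A,K]\otimes A)]\xrightarrow{\mathrm{ev}^l}[f^*A,f^*K]$; $\{f^*,\beta_K\}$ is a duality preserving functor from $D_K$ to $D_{f^*K}$. Push-forward. Let $\eta^*_*,\epsilon^*_*$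 be unit and counit of $f^*\dashv f_*$ and $\eta^!_*,\epsilon^!_*$ those of $f_*\dashv f^!$. Let $\lambda_{A,B}$: $f_*A\otimes f_*B\xrightarrow{\eta^*_*}f_*f^*(f_*A\otimes f_*B)\xrightarrow{\alpha^{-1}}f_*(f^*f_*A\otimes f^*f_*B)\xrightarrow{\epsilon^*_*\otimes\epsilon^*_*}f_*(A\otimes B)$, $\mu_{A,B}$: $f_*[A,B]\xrightarrow{\mathrm{coev}^l}[f_*A,f_*[A,B]\otimes f_*A]\xrightarrow{\lambda}[f_*A,f_*([A,B]\otimes A)]\xrightarrow{\mathrm{ev}^l}[f_*A,f_*B]$, and $\zeta_{A,K}$: $f_*[A,f^!K]\xrightarrow{\mu}[f_*A,f_*f^!K]\xrightarrow{\epsilon^!_*}[f_*A,K]$. Then $\{f_*,\zeta_K\}$ is a duality preserving functor from $D_{f^!K}$ to $D_K$. Projection morphisms. $\pi_{A,B}$ ($A\in\mathcal C_2$, $B\in\mathcal C_1$) is the composition $f_*A\otimes B\xrightarrow{\eta^*_*}f_*f^*(f_*A\otimes B)\xrightarrow{\alpha^{-1}}f_*(f^*f_*A\otimes f^*B)\xrightarrow{\epsilon^*_*}f_*(A\otimes f^*B)$. When $\pi$ is an isomorphism, $\theta_{A,B}$ ($A,B\in\mathcal C_1$) is the composition $f^!A\otimes f^*B\xrightarrow{\eta^!_*}f^!f_*(f^!A\otimes f^*B)\xrightarrow{\pi^{-1}}f^!(f_*f^!A\otimes B)\xrightarrow{\epsilon^!_*}f^!(A\otimes B)$. *)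

theory Defs
  imports Main
begin

text \<open>The value of \<open>cmp\<close> on non-composable pairs is irrelevant. In \<open>g \<cdot> f\<close> the arrow \<open>f\<close> is applied first.\<close>

record ('o, 'a) category =
  obj :: "'o set"
  arr :: "'a set"
  src :: "'a \<Rightarrow> 'o"
  tgt :: "'a \<Rightarrow> 'o"
  ide :: "'o \<Rightarrow> 'a"
  cmp :: "'a \<Rightarrow> 'a \<Rightarrow> 'a"  (infixr \<open>\<cdot>\<index>\<close> 55)

definition hom :: "('o, 'a, 'z) category_scheme \<Rightarrow> 'o \<Rightarrow> 'o \<Rightarrow> 'a set" where
  "hom C A B = {f \<in> arr C. src C f = A \<and> tgt C f = B}"

locale category =
  fixes C :: "('o, 'a, 'z) category_scheme" (structure)
  assumes src_obj: "f \<in> arr C \<Longrightarrow> src C f \<in> obj C"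
    and tgt_obj: "f \<in> arr C \<Longrightarrow> tgt C f \<in> obj C"
    and ide_hom: "A \<in> obj C \<Longrightarrow> ide C A \<in> hom C A A"
    and cmp_hom: "f \<in> hom C A B \<Longrightarrow> g \<in> hom C B D \<Longrightarrow> g \<cdot> f \<in> hom C A D"
    and cmp_ide_right: "f \<in> hom C A B \<Longrightarrow> f \<cdot> ide C A = f"
    and cmp_ide_left: "f \<in> hom C A B \<Longrightarrow> ide C B \<cdot> f = f"
    and cmp_assoc: "f \<in> hom C A B \<Longrightarrow> g \<in> hom C B D \<Longrightarrow> h \<in> hom C D E \<Longrightarrow>
      (h \<cdot> g) \<cdot> f = h \<cdot> (g \<cdot> f)"

definition inverse_pair :: "('o, 'a, 'z) category_scheme \<Rightarrow> 'a \<Rightarrow> 'a \<Rightarrow> bool" where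
  "inverse_pair C f g \<longleftrightarrow> f \<in> arr C \<and> g \<in> hom C (tgt C f) (src C f) \<and>
     g \<cdot>\<^bsub>C\<^esub> f = ide C (src C f) \<and> f \<cdot>\<^bsub>C\<^esub> g = ide C (tgt C f)"

definition is_iso :: "('o, 'a, 'z) category_scheme \<Rightarrow> 'a \<Rightarrow> bool" where
  "is_iso C f \<longleftrightarrow> (\<exists>g. inverse_pair C f g)"

definition inv_arr :: "('o, 'a, 'z) category_scheme \<Rightarrow> 'a \<Rightarrow> 'a" where
  "inv_arr C f = (THE g. inverse_pair C f g)"

definition op_cat :: "('o, 'a, 'z) category_scheme \<Rightarrow> ('o, 'a) category" where
  "op_cat C = \<lparr>obj = obj C, arr = arr C, src = tgt C, tgt = src C, ide = ide C,
     cmp = (\<lambda>g f. f \<cdot>\<^bsub>C\<^esub> g)\<rparr>"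

definition prod_cat :: "('o, 'a, 'z) category_scheme \<Rightarrow> ('p, 'b, 'y) category_scheme \<Rightarrow>
    ('o \<times> 'p, 'a \<times> 'b) category"  (infixr \<open>\<times>\<^sub>C\<close> 70) where
  "C \<times>\<^sub>C D = \<lparr>obj = obj C \<times> obj D, arr = arr C \<times> arr D,
     src = map_prod (src C) (src D), tgt = map_prod (tgt C) (tgt D),
     ide = map_prod (ide C) (ide D),
     cmp = (\<lambda>(g, g') (f, f'). (g \<cdot>\<^bsub>C\<^esub> f, g' \<cdot>\<^bsub>D\<^esub> f'))\<rparr>"

record ('o, 'a, 'p, 'b) funct =
  fob :: "'o \<Rightarrow> 'p"
  far :: "'a \<Rightarrow> 'b"

locale is_functor = C: category C + D: category D
  for C :: "('o, 'a, 'z) category_scheme" and D :: "('p, 'b, 'y) category_scheme"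
    and F :: "('o, 'a, 'p, 'b, 'x) funct_scheme" +
  assumes fob_obj: "A \<in> obj C \<Longrightarrow> fob F A \<in> obj D"
    and far_hom: "f \<in> hom C A B \<Longrightarrow> far F f \<in> hom D (fob F A) (fob F B)"
    and far_ide: "A \<in> obj C \<Longrightarrow> far F (ide C A) = ide D (fob F A)"
    and far_cmp: "f \<in> hom C A B \<Longrightarrow> g \<in> hom C B E \<Longrightarrow>
      far F (g \<cdot>\<^bsub>C\<^esub> f) = far F g \<cdot>\<^bsub>D\<^esub> far F f"

definition id_fun :: "('o, 'a, 'o, 'a) funct" where
  "id_fun = \<lparr>fob = (\<lambda>A. A), far = (\<lambda>f. f)\<rparr>"

definition comp_fun :: "('p, 'b, 'q, 'c, 'y) funct_scheme \<Rightarrow> ('o, 'a, 'p, 'b, 'z) funct_scheme \<Rightarrow>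
    ('o, 'a, 'q, 'c) funct"  (infixr \<open>\<circ>\<^sub>F\<close> 65) where
  "G \<circ>\<^sub>F F = \<lparr>fob = fob G \<circ> fob F, far = far G \<circ> far F\<rparr>"

definition prod_fun :: "('o, 'a, 'p, 'b, 'z) funct_scheme \<Rightarrow> ('o1, 'a1, 'p1, 'b1, 'y) funct_scheme \<Rightarrow>
    ('o \<times> 'o1, 'a \<times> 'a1, 'p \<times> 'p1, 'b \<times> 'b1) funct"  (infixr \<open>\<times>\<^sub>F\<close> 70) where
  "F \<times>\<^sub>F G = \<lparr>fob = map_prod (fob F) (fob G), far = map_prod (far F) (far G)\<rparr>"

text \<open>Since \<^const>\<open>op_cat\<close> keeps objects and arrows, the opposite of a functor
  \<open>C \<rightarrow> D\<close> is given by the same two maps, now read as a functor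
  \<open>op_cat C \<rightarrow> op_cat D\<close>; no operation is introduced for it.\<close>

locale nat_trans = F: is_functor C D F + G: is_functor C D G
  for C :: "('o, 'a, 'z) category_scheme" and D :: "('p, 'b, 'y) category_scheme"
    and F :: "('o, 'a, 'p, 'b, 'x) funct_scheme" and G :: "('o, 'a, 'p, 'b, 'w) funct_scheme"
    and t :: "'o \<Rightarrow> 'b" +
  assumes component_hom: "A \<in> obj C \<Longrightarrow> t A \<in> hom D (fob F A) (fob G A)"
    and naturality: "f \<in> hom C A B \<Longrightarrow> t B \<cdot>\<^bsub>D\<^esub> far F f = far G f \<cdot>\<^bsub>D\<^esub> t A"

definition prod_trans :: "('o \<Rightarrow> 'a) \<Rightarrow> ('p \<Rightarrow> 'b) \<Rightarrow> 'o \<times> 'p \<Rightarrow> 'a \<times> 'b"  (infixr \<open>\<times>\<^sub>T\<close> 70) where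
  "t \<times>\<^sub>T u = map_prod t u"

locale nat_iso = nat_trans +
  assumes component_iso: "A \<in> obj C \<Longrightarrow> is_iso D (t A)"

locale adjunction =
  L: is_functor C D L + R: is_functor D C R +
  unit: nat_trans C C id_fun "R \<circ>\<^sub>F L" \<eta> + counit: nat_trans D D "L \<circ>\<^sub>F R" id_fun \<epsilon>
  for C :: "('o, 'a, 'z) category_scheme" and D :: "('p, 'b, 'y) category_scheme"
    and L :: "('o, 'a, 'p, 'b, 'x) funct_scheme" and R :: "('p, 'b, 'o, 'a, 'w) funct_scheme"
    and \<eta> :: "'o \<Rightarrow> 'a" and \<epsilon> :: "'p \<Rightarrow> 'b" +
  assumes triangle_left: "A \<in> obj C \<Longrightarrow> \<epsilon> (fob L A) \<cdot>\<^bsub>D\<^esub> far L (\<eta> A) = ide D (fob L A)"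
    and triangle_right: "B \<in> obj D \<Longrightarrow> far R (\<epsilon> B) \<cdot>\<^bsub>C\<^esub> \<eta> (fob R B) = ide C (fob R B)"

text \<open>The unit is optional: \<open>munit = None\<close> means that no unit is considered, in which case
  \<open>lunit\<close> and \<open>runit\<close> are ignored.

  Argument orders: \<open>ev X A : [X,A] \<otimes> X \<rightarrow> A\<close> and
  \<open>coev X A : A \<rightarrow> [X, A \<otimes> X]\<close>.\<close>

record ('o, 'a) smc_category = "('o, 'a) category" +
  tensor :: "('o \<times> 'o, 'a \<times> 'a, 'o, 'a) funct"
  assoc :: "'o \<Rightarrow> 'o \<Rightarrow> 'o \<Rightarrow> 'a"
  symm :: "'o \<Rightarrow> 'o \<Rightarrow> 'a"
  munit :: "'o option"
  lunit :: "'o \<Rightarrow> 'a"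
  runit :: "'o \<Rightarrow> 'a"
  ihom :: "('o \<times> 'o, 'a \<times> 'a, 'o, 'a) funct"
  ev :: "'o \<Rightarrow> 'o \<Rightarrow> 'a"
  coev :: "'o \<Rightarrow> 'o \<Rightarrow> 'a"

abbreviation tensor_obj  (\<open>(_ \<otimes>\<index> _)\<close> [71, 70] 70) where
  "A \<otimes>\<^bsub>C\<^esub> B \<equiv> fob (tensor C) (A, B)"

abbreviation tensor_arr  (\<open>(_ \<boxtimes>\<index> _)\<close> [71, 70] 70) where
  "f \<boxtimes>\<^bsub>C\<^esub> g \<equiv> far (tensor C) (f, g)"

abbreviation ihom_obj  (\<open>(\<lblot>_, _\<rblot>\<index>)\<close>) where
  "\<lblot>A, B\<rblot>\<^bsub>C\<^esub> \<equiv> fob (ihom C) (A, B)"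

text \<open>For \<open>f : A' \<rightarrow> A\<close> and \<open>g : B \<rightarrow> B'\<close> this is the arrow
  \<open>[A,B] \<rightarrow> [A',B']\<close>.\<close>

abbreviation ihom_arr  (\<open>(\<lbrace>_, _\<rbrace>\<index>)\<close>) where
  "\<lbrace>f, g\<rbrace>\<^bsub>C\<^esub> \<equiv> far (ihom C) (f, g)"

locale symmetric_monoidal = category C + tensor: is_functor "C \<times>\<^sub>C C" C "tensor C"
  for C :: "('o, 'a, 'z) smc_category_scheme" (structure) +
  assumes assoc_hom: "A \<in> obj C \<Longrightarrow> B \<in> obj C \<Longrightarrow> D \<in> obj C \<Longrightarrow>
      assoc C A B D \<in> hom C ((A \<otimes> B) \<otimes> D) (A \<otimes> (B \<otimes> D))"
    and assoc_iso: "A \<in> obj C \<Longrightarrow> B \<in> obj C \<Longrightarrow> D \<in> obj C \<Longrightarrow> is_iso C (assoc C A B D)"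
    and assoc_natural: "f \<in> hom C A A' \<Longrightarrow> g \<in> hom C B B' \<Longrightarrow> h \<in> hom C D D' \<Longrightarrow>
      assoc C A' B' D' \<cdot> ((f \<boxtimes> g) \<boxtimes> h) = (f \<boxtimes> (g \<boxtimes> h)) \<cdot> assoc C A B D"
    and symm_hom: "A \<in> obj C \<Longrightarrow> B \<in> obj C \<Longrightarrow> symm C A B \<in> hom C (A \<otimes> B) (B \<otimes> A)"
    and symm_natural: "f \<in> hom C A A' \<Longrightarrow> g \<in> hom C B B' \<Longrightarrow>
      symm C A' B' \<cdot> (f \<boxtimes> g) = (g \<boxtimes> f) \<cdot> symm C A B"
    and symm_symm: "A \<in> obj C \<Longrightarrow> B \<in> obj C \<Longrightarrow> symm C B A \<cdot> symm C A B = ide C (A \<otimes> B)"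
    and pentagon: "A \<in> obj C \<Longrightarrow> B \<in> obj C \<Longrightarrow> D \<in> obj C \<Longrightarrow> E \<in> obj C \<Longrightarrow>
      (ide C A \<boxtimes> assoc C B D E) \<cdot> assoc C A (B \<otimes> D) E \<cdot> (assoc C A B D \<boxtimes> ide C E)
      = assoc C A B (D \<otimes> E) \<cdot> assoc C (A \<otimes> B) D E"
    and hexagon: "A \<in> obj C \<Longrightarrow> B \<in> obj C \<Longrightarrow> D \<in> obj C \<Longrightarrow>
      assoc C B D A \<cdot> symm C A (B \<otimes> D) \<cdot> assoc C A B D
      = (ide C B \<boxtimes> symm C A D) \<cdot> assoc C B A D \<cdot> (symm C A B \<boxtimes> ide C D)"
    and munit_obj: "munit C = Some I \<Longrightarrow> I \<in> obj C"
    and lunit_hom: "munit C = Some I \<Longrightarrow> A \<in> obj C \<Longrightarrow> lunit C A \<in> hom C (I \<otimes> A) A"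
    and lunit_iso: "munit C = Some I \<Longrightarrow> A \<in> obj C \<Longrightarrow> is_iso C (lunit C A)"
    and lunit_natural: "munit C = Some I \<Longrightarrow> f \<in> hom C A B \<Longrightarrow>
      lunit C B \<cdot> (ide C I \<boxtimes> f) = f \<cdot> lunit C A"
    and runit_hom: "munit C = Some I \<Longrightarrow> A \<in> obj C \<Longrightarrow> runit C A \<in> hom C (A \<otimes> I) A"
    and runit_iso: "munit C = Some I \<Longrightarrow> A \<in> obj C \<Longrightarrow> is_iso C (runit C A)"
    and runit_natural: "munit C = Some I \<Longrightarrow> f \<in> hom C A B \<Longrightarrow>
      runit C B \<cdot> (f \<boxtimes> ide C I) = f \<cdot> runit C A"
    and unit_triangle: "munit C = Some I \<Longrightarrow> A \<in> obj C \<Longrightarrow> B \<in> obj C \<Longrightarrow>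
      (ide C A \<boxtimes> lunit C B) \<cdot> assoc C A I B = runit C A \<boxtimes> ide C B"

definition tensor_with :: "('o, 'a, 'z) smc_category_scheme \<Rightarrow> 'o \<Rightarrow> ('o, 'a, 'o, 'a) funct" where
  "tensor_with C X = \<lparr>fob = (\<lambda>A. A \<otimes>\<^bsub>C\<^esub> X), far = (\<lambda>f. f \<boxtimes>\<^bsub>C\<^esub> ide C X)\<rparr>"

definition ihom_from :: "('o, 'a, 'z) smc_category_scheme \<Rightarrow> 'o \<Rightarrow> ('o, 'a, 'o, 'a) funct" where
  "ihom_from C X = \<lparr>fob = (\<lambda>A. \<lblot>X, A\<rblot>\<^bsub>C\<^esub>), far = (\<lambda>f. \<lbrace>ide C X, f\<rbrace>\<^bsub>C\<^esub>)\<rparr>"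

text \<open>The bijection \<open>Hom(A \<otimes> X, B) \<rightarrow> Hom(A, [X,B])\<close> of the adjunction.\<close>

definition adj_transpose :: "('o, 'a, 'z) smc_category_scheme \<Rightarrow> 'o \<Rightarrow> 'o \<Rightarrow> 'a \<Rightarrow> 'a" where
  "adj_transpose C A X g = \<lbrace>ide C X, g\<rbrace>\<^bsub>C\<^esub> \<cdot>\<^bsub>C\<^esub> coev C X A"

locale symmetric_monoidal_closed = symmetric_monoidal C +
    ihom: is_functor "op_cat C \<times>\<^sub>C C" C "ihom C"
  for C :: "('o, 'a, 'z) smc_category_scheme" (structure) +
  assumes closed_adjunction:
      "X \<in> obj C \<Longrightarrow> adjunction C C (tensor_with C X) (ihom_from C X) (coev C X) (ev C X)"
    and transpose_natural_param: "A \<in> obj C \<Longrightarrow> u \<in> hom C X Y \<Longrightarrow> g \<in> hom C (A \<otimes> Y) B \<Longrightarrow>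
      adj_transpose C A X (g \<cdot> (ide C A \<boxtimes> u)) = \<lbrace>u, ide C B\<rbrace> \<cdot> adj_transpose C A Y g"

definition evr :: "('o, 'a, 'z) smc_category_scheme \<Rightarrow> 'o \<Rightarrow> 'o \<Rightarrow> 'a" where
  "evr C A K = ev C A K \<cdot>\<^bsub>C\<^esub> symm C A \<lblot>A, K\<rblot>\<^bsub>C\<^esub>"

text \<open>The isomorphism exchanging the two middle factors,
  \<open>(A \<otimes> B) \<otimes> (D \<otimes> E) \<rightarrow> (A \<otimes> D) \<otimes> (B \<otimes> E)\<close>.\<close>

definition interchange :: "('o, 'a, 'z) smc_category_scheme \<Rightarrow> 'o \<Rightarrow> 'o \<Rightarrow> 'o \<Rightarrow> 'o \<Rightarrow> 'a" where
  "interchange C A B D E =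
     inv_arr C (assoc C A D (B \<otimes>\<^bsub>C\<^esub> E)) \<cdot>\<^bsub>C\<^esub>
     (ide C A \<boxtimes>\<^bsub>C\<^esub> assoc C D B E) \<cdot>\<^bsub>C\<^esub>
     (ide C A \<boxtimes>\<^bsub>C\<^esub> (symm C B D \<boxtimes>\<^bsub>C\<^esub> ide C E)) \<cdot>\<^bsub>C\<^esub>
     (ide C A \<boxtimes>\<^bsub>C\<^esub> inv_arr C (assoc C B D E)) \<cdot>\<^bsub>C\<^esub>
     assoc C A B (D \<otimes>\<^bsub>C\<^esub> E)"

text \<open>\<open>mult A B : F A \<otimes> F B \<rightarrow> F (A \<otimes> B)\<close>, and \<open>unit_cmp\<close> is the comparison
  from the unit to the image of the unit, constrained only when both categories have a unit.\<close>

record ('o, 'a, 'p, 'b) monoidal_funct = "('o, 'a, 'p, 'b) funct" +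
  mult :: "'o \<Rightarrow> 'o \<Rightarrow> 'b"
  unit_cmp :: "'b"

locale symmetric_monoidal_functor =
  C: symmetric_monoidal C + D: symmetric_monoidal D + is_functor C D F +
  mult: nat_iso "C \<times>\<^sub>C C" D "tensor D \<circ>\<^sub>F (F \<times>\<^sub>F F)" "F \<circ>\<^sub>F tensor C" "\<lambda>(A, B). mult F A B"
  for C :: "('o, 'a, 'z) smc_category_scheme" and D :: "('p, 'b, 'y) smc_category_scheme"
    and F :: "('o, 'a, 'p, 'b, 'x) monoidal_funct_scheme" +
  assumes mult_assoc: "A \<in> obj C \<Longrightarrow> B \<in> obj C \<Longrightarrow> E \<in> obj C \<Longrightarrow>
      far F (assoc C A B E) \<cdot>\<^bsub>D\<^esub> mult F (A \<otimes>\<^bsub>C\<^esub> B) E \<cdot>\<^bsub>D\<^esub> (mult F A B \<boxtimes>\<^bsub>D\<^esub> ide D (fob F E))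
      = mult F A (B \<otimes>\<^bsub>C\<^esub> E) \<cdot>\<^bsub>D\<^esub> (ide D (fob F A) \<boxtimes>\<^bsub>D\<^esub> mult F B E) \<cdot>\<^bsub>D\<^esub>
        assoc D (fob F A) (fob F B) (fob F E)"
    and mult_symm: "A \<in> obj C \<Longrightarrow> B \<in> obj C \<Longrightarrow>
      far F (symm C A B) \<cdot>\<^bsub>D\<^esub> mult F A B = mult F B A \<cdot>\<^bsub>D\<^esub> symm D (fob F A) (fob F B)"
    and unit_cmp_hom: "munit C = Some I \<Longrightarrow> munit D = Some J \<Longrightarrow> unit_cmp F \<in> hom D J (fob F I)"
    and unit_cmp_iso: "munit C = Some I \<Longrightarrow> munit D = Some J \<Longrightarrow> is_iso D (unit_cmp F)"
    and mult_lunit: "munit C = Some I \<Longrightarrow> munit D = Some J \<Longrightarrow> A \<in> obj C \<Longrightarrow>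
      far F (lunit C A) \<cdot>\<^bsub>D\<^esub> mult F I A \<cdot>\<^bsub>D\<^esub> (unit_cmp F \<boxtimes>\<^bsub>D\<^esub> ide D (fob F A))
      = lunit D (fob F A)"
    and mult_runit: "munit C = Some I \<Longrightarrow> munit D = Some J \<Longrightarrow> A \<in> obj C \<Longrightarrow>
      far F (runit C A) \<cdot>\<^bsub>D\<^esub> mult F A I \<cdot>\<^bsub>D\<^esub> (ide D (fob F A) \<boxtimes>\<^bsub>D\<^esub> unit_cmp F)
      = runit D (fob F A)"

text \<open>A category with duality is a triple \<open>(C, D, \<omega>)\<close>; a duality preserving functor is a
  pair \<open>(F, \<phi>)\<close>. The last condition in \<open>category_with_duality\<close> is the triangle
  identity making \<open>D\<close> adjoint to its opposite with unit (and counit) \<open>\<omega>\<close>.\<close>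

type_synonym ('o, 'a, 'z) dual_cat =
  "('o, 'a, 'z) category_scheme \<times> ('o, 'a, 'o, 'a) funct \<times> ('o \<Rightarrow> 'a)"

type_synonym ('o, 'a, 'p, 'b) dp_funct = "('o, 'a, 'p, 'b) funct \<times> ('o \<Rightarrow> 'b)"

definition category_with_duality :: "('o, 'a, 'z) dual_cat \<Rightarrow> bool" where
  "category_with_duality = (\<lambda>(C, D, \<omega>).
     is_functor C (op_cat C) D \<and> nat_trans C C id_fun (D \<circ>\<^sub>F D) \<omega> \<and>
     (\<forall>A\<in>obj C. far D (\<omega> A) \<cdot>\<^bsub>C\<^esub> \<omega> (fob D A) = ide C (fob D A)))"

definition duality_preserving ::
  "('o, 'a, 'z) dual_cat \<Rightarrow> ('p, 'b, 'y) dual_cat \<Rightarrow> ('o, 'a, 'p, 'b) dp_funct \<Rightarrow> bool" where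
  "duality_preserving = (\<lambda>(C\<^sub>1, D\<^sub>1, \<omega>\<^sub>1) (C\<^sub>2, D\<^sub>2, \<omega>\<^sub>2) (F, \<phi>).
     category_with_duality (C\<^sub>1, D\<^sub>1, \<omega>\<^sub>1) \<and> category_with_duality (C\<^sub>2, D\<^sub>2, \<omega>\<^sub>2) \<and>
     is_functor C\<^sub>1 C\<^sub>2 F \<and> nat_trans (op_cat C\<^sub>1) C\<^sub>2 (F \<circ>\<^sub>F D\<^sub>1) (D\<^sub>2 \<circ>\<^sub>F F) \<phi> \<and>
     (\<forall>A\<in>obj C\<^sub>1. \<phi> (fob D\<^sub>1 A) \<cdot>\<^bsub>C\<^sub>2\<^esub> far F (\<omega>\<^sub>1 A) = far D\<^sub>2 (\<phi> A) \<cdot>\<^bsub>C\<^sub>2\<^esub> \<omega>\<^sub>2 (fob F A)))"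

definition dp_morphism ::
  "('o, 'a, 'z) dual_cat \<Rightarrow> ('p, 'b, 'y) dual_cat \<Rightarrow>
   ('o, 'a, 'p, 'b) dp_funct \<Rightarrow> ('o, 'a, 'p, 'b) dp_funct \<Rightarrow> ('o \<Rightarrow> 'b) \<Rightarrow> bool" where
  "dp_morphism = (\<lambda>(C\<^sub>1, D\<^sub>1, \<omega>\<^sub>1) (C\<^sub>2, D\<^sub>2, \<omega>\<^sub>2) (F, \<phi>) (F', \<phi>') \<rho>.
     duality_preserving (C\<^sub>1, D\<^sub>1, \<omega>\<^sub>1) (C\<^sub>2, D\<^sub>2, \<omega>\<^sub>2) (F, \<phi>) \<and>
     duality_preserving (C\<^sub>1, D\<^sub>1, \<omega>\<^sub>1) (C\<^sub>2, D\<^sub>2, \<omega>\<^sub>2) (F', \<phi>') \<and>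
     nat_trans C\<^sub>1 C\<^sub>2 F F' \<rho> \<and>
     (\<forall>A\<in>obj C\<^sub>1. \<phi> A = far D\<^sub>2 (\<rho> A) \<cdot>\<^bsub>C\<^sub>2\<^esub> \<phi>' A \<cdot>\<^bsub>C\<^sub>2\<^esub> \<rho> (fob D\<^sub>1 A)))"

text \<open>In \<open>dp_comp E\<close> the category \<open>E\<close> is the codomain of the composite.\<close>

definition dp_comp :: "('q, 'c, 'z) category_scheme \<Rightarrow>
    ('p, 'b, 'q, 'c) dp_funct \<Rightarrow> ('o, 'a, 'p, 'b) dp_funct \<Rightarrow> ('o, 'a, 'q, 'c) dp_funct" where
  "dp_comp E = (\<lambda>(F', \<phi>') (F, \<phi>).
     (F' \<circ>\<^sub>F F, \<lambda>A. \<phi>' (fob F A) \<cdot>\<^bsub>E\<^esub> far F' (\<phi> A)))"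

definition dp_prod :: "('o, 'a, 'p, 'b) dp_funct \<Rightarrow> ('o1, 'a1, 'p1, 'b1) dp_funct \<Rightarrow>
    ('o \<times> 'o1, 'a \<times> 'a1, 'p \<times> 'p1, 'b \<times> 'b1) dp_funct"  (infixr \<open>\<times>\<^sub>D\<^sub>P\<close> 70) where
  "P \<times>\<^sub>D\<^sub>P Q = (fst P \<times>\<^sub>F fst Q, snd P \<times>\<^sub>T snd Q)"

definition dual_cat_prod :: "('o, 'a, 'z) dual_cat \<Rightarrow> ('p, 'b, 'y) dual_cat \<Rightarrow>
    ('o \<times> 'p, 'a \<times> 'b, unit) dual_cat"  (infixr \<open>\<times>\<^sub>D\<close> 70) where
  "dual_cat_prod = (\<lambda>(C\<^sub>1, D\<^sub>1, \<omega>\<^sub>1) (C\<^sub>2, D\<^sub>2, \<omega>\<^sub>2). (C\<^sub>1 \<times>\<^sub>C C\<^sub>2, D\<^sub>1 \<times>\<^sub>F D\<^sub>2, \<omega>\<^sub>1 \<times>\<^sub>T \<omega>\<^sub>2))"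

definition dual_fun :: "('o, 'a, 'z) smc_category_scheme \<Rightarrow> 'o \<Rightarrow> ('o, 'a, 'o, 'a) funct" where
  "dual_fun C K = \<lparr>fob = (\<lambda>A. \<lblot>A, K\<rblot>\<^bsub>C\<^esub>), far = (\<lambda>f. \<lbrace>f, ide C K\<rbrace>\<^bsub>C\<^esub>)\<rparr>"

definition bidual :: "('o, 'a, 'z) smc_category_scheme \<Rightarrow> 'o \<Rightarrow> 'o \<Rightarrow> 'a" where
  "bidual C K A = adj_transpose C A \<lblot>A, K\<rblot>\<^bsub>C\<^esub> (evr C A K)"

definition dual_cat_of where
  "dual_cat_of C K = (C, dual_fun C K, bidual C K)"

definition dp_id :: "('o, 'a, 'z) dual_cat \<Rightarrow> ('o, 'a, 'o, 'a) dp_funct" where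
  "dp_id = (\<lambda>(C, D, \<omega>). (id_fun, \<lambda>A. ide C (fob D A)))"

definition dp_change :: "('o, 'a, 'z) smc_category_scheme \<Rightarrow> 'a \<Rightarrow> ('o, 'a, 'o, 'a) dp_funct" where
  "dp_change C \<iota> = (id_fun, \<lambda>A. \<lbrace>ide C A, \<iota>\<rbrace>\<^bsub>C\<^esub>)"

definition tau :: "('o, 'a, 'z) smc_category_scheme \<Rightarrow> 'o \<Rightarrow> 'o \<Rightarrow> 'o \<Rightarrow> 'o \<Rightarrow> 'a" where
  "tau C K M A B =
     \<lbrace>ide C (A \<otimes>\<^bsub>C\<^esub> B), ev C A K \<boxtimes>\<^bsub>C\<^esub> ev C B M\<rbrace>\<^bsub>C\<^esub> \<cdot>\<^bsub>C\<^esub>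
     \<lbrace>ide C (A \<otimes>\<^bsub>C\<^esub> B), interchange C \<lblot>A, K\<rblot>\<^bsub>C\<^esub> \<lblot>B, M\<rblot>\<^bsub>C\<^esub> A B\<rbrace>\<^bsub>C\<^esub> \<cdot>\<^bsub>C\<^esub>
     coev C (A \<otimes>\<^bsub>C\<^esub> B) (\<lblot>A, K\<rblot>\<^bsub>C\<^esub> \<otimes>\<^bsub>C\<^esub> \<lblot>B, M\<rblot>\<^bsub>C\<^esub>)"

definition dp_tensor ::
  "('o, 'a, 'z) smc_category_scheme \<Rightarrow> 'o \<Rightarrow> 'o \<Rightarrow> ('o \<times> 'o, 'a \<times> 'a, 'o, 'a) dp_funct" where
  "dp_tensor C K M = (tensor C, \<lambda>(A, B). tau C K M A B)"

text \<open>Throughout, \<open>F\<close> stands for $f^*$ (with its monoidal structure), \<open>G\<close> for $f_*$ and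
  \<open>H\<close> for $f^!$; \<open>\<eta>\<close>, \<open>\<epsilon>\<close> are the unit and counit of the adjunction
  of $f^*$ and $f_*$, and \<open>\<eta>'\<close>, \<open>\<epsilon>'\<close> those of the adjunction of $f_*$ and $f^!$.
  The projection morphism $\pi_{A,B}$ is \<open>proj_mor \<dots> A B\<close>, and the fixed object \<open>K\<close> of
  $\beta_{A,K}$ and $\zeta_{A,K}$ is passed before \<open>A\<close>.\<close>

definition beta where
  "beta C\<^sub>1 C\<^sub>2 F K A =
     \<lbrace>ide C\<^sub>2 (fob F A), far F (ev C\<^sub>1 A K)\<rbrace>\<^bsub>C\<^sub>2\<^esub> \<cdot>\<^bsub>C\<^sub>2\<^esub>
     \<lbrace>ide C\<^sub>2 (fob F A), mult F \<lblot>A, K\<rblot>\<^bsub>C\<^sub>1\<^esub> A\<rbrace>\<^bsub>C\<^sub>2\<^esub> \<cdot>\<^bsub>C\<^sub>2\<^esub>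
     coev C\<^sub>2 (fob F A) (fob F \<lblot>A, K\<rblot>\<^bsub>C\<^sub>1\<^esub>)"

definition lam_mor where
  "lam_mor C\<^sub>1 C\<^sub>2 F G \<eta> \<epsilon> A B =
     far G (\<epsilon> A \<boxtimes>\<^bsub>C\<^sub>2\<^esub> \<epsilon> B) \<cdot>\<^bsub>C\<^sub>1\<^esub>
     far G (inv_arr C\<^sub>2 (mult F (fob G A) (fob G B))) \<cdot>\<^bsub>C\<^sub>1\<^esub>
     \<eta> (fob G A \<otimes>\<^bsub>C\<^sub>1\<^esub> fob G B)"

definition mu_mor where
  "mu_mor C\<^sub>1 C\<^sub>2 F G \<eta> \<epsilon> A B =
     \<lbrace>ide C\<^sub>1 (fob G A), far G (ev C\<^sub>2 A B)\<rbrace>\<^bsub>C\<^sub>1\<^esub> \<cdot>\<^bsub>C\<^sub>1\<^esub>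
     \<lbrace>ide C\<^sub>1 (fob G A), lam_mor C\<^sub>1 C\<^sub>2 F G \<eta> \<epsilon> \<lblot>A, B\<rblot>\<^bsub>C\<^sub>2\<^esub> A\<rbrace>\<^bsub>C\<^sub>1\<^esub> \<cdot>\<^bsub>C\<^sub>1\<^esub>
     coev C\<^sub>1 (fob G A) (fob G \<lblot>A, B\<rblot>\<^bsub>C\<^sub>2\<^esub>)"

definition zeta where
  "zeta C\<^sub>1 C\<^sub>2 F G H \<eta> \<epsilon> \<epsilon>' K A =
     \<lbrace>ide C\<^sub>1 (fob G A), \<epsilon>' K\<rbrace>\<^bsub>C\<^sub>1\<^esub> \<cdot>\<^bsub>C\<^sub>1\<^esub> mu_mor C\<^sub>1 C\<^sub>2 F G \<eta> \<epsilon> A (fob H K)"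

definition proj_mor where
  "proj_mor C\<^sub>1 C\<^sub>2 F G \<eta> \<epsilon> A B =
     far G (\<epsilon> A \<boxtimes>\<^bsub>C\<^sub>2\<^esub> ide C\<^sub>2 (fob F B)) \<cdot>\<^bsub>C\<^sub>1\<^esub>
     far G (inv_arr C\<^sub>2 (mult F (fob G A) B)) \<cdot>\<^bsub>C\<^sub>1\<^esub>
     \<eta> (fob G A \<otimes>\<^bsub>C\<^sub>1\<^esub> B)"

definition theta where
  "theta C\<^sub>1 C\<^sub>2 F G H \<eta> \<epsilon> \<eta>' \<epsilon>' A B =
     far H (\<epsilon>' A \<boxtimes>\<^bsub>C\<^sub>1\<^esub> ide C\<^sub>1 B) \<cdot>\<^bsub>C\<^sub>2\<^esub>
     far H (inv_arr C\<^sub>1 (proj_mor C\<^sub>1 C\<^sub>2 F G \<eta> \<epsilon> (fob H A) B)) \<cdot>\<^bsub>C\<^sub>2\<^esub>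
     \<eta>' (fob H A \<otimes>\<^bsub>C\<^sub>2\<^esub> fob F B)"

definition dp_pull where
  "dp_pull C\<^sub>1 C\<^sub>2 F K = (funct.truncate F, beta C\<^sub>1 C\<^sub>2 F K)"

definition dp_push where
  "dp_push C\<^sub>1 C\<^sub>2 F G H \<eta> \<epsilon> \<epsilon>' K = (G, zeta C\<^sub>1 C\<^sub>2 F G H \<eta> \<epsilon> \<epsilon>' K)"

end

theory Submission
  imports Defs
begin

text \<open>A duality preserving structure on a functor \<open>T\<close> with values in \<open>(C, [-, L])\<close> is, by
  adjunction, a dinatural and symmetric family of pairings \<open>T (D A) \<otimes> T A \<rightarrow> L\<close>. This makes
  \<open>\<tau>\<close>, \<open>\<beta>\<close>, \<open>\<zeta>\<close> and \<open>I\<^sub>\<iota>\<close> duality preserving, and both sides of the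
  claimed identity can be compared as pairings. Since \<open>\<theta>\<close> is adjoint to
  \<open>(\<epsilon>' \<otimes> 1) \<pi>\<^sup>-\<^sup>1\<close>, what remains is the compatibility of \<open>\<pi>\<close> and \<open>\<lambda>\<close> with the
  middle-four interchange; transposed along $f^* \dashv f_*$ it says that \<open>\<alpha>\<close> commutes with
  the interchange, a consequence of the coherence axioms for associativity and symmetry.\<close>

text \<open>Both squares required of a candidate \<open>\<phi>\<close> mix variances: naturality
  lives over the opposite category, and compatibility with biduality involves a double dual.
  Evaluation removes both. Naturality says that \<open>D f\<close> in the first slot of the pairing
  agrees with \<open>T f\<close> in the second. Compatibility says that the pairing of
  \<open>D A\<close>, restricted along the biduality map of \<open>A\<close>, is the pairing of
  \<open>A\<close> with its arguments swapped. So the symmetry has to be carried through every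
  construction, including \<lambda> and the interchange.

  A morphism of duality preserving functors includes the claim that both its ends preserve duality.
  Hence the building blocks, composition and products are treated before \<pi> is compared with the
  dualities.

  The interchange is handled through the simpler isomorphism A(BD) -> B(AD), for which pentagon and
  hexagon give a few closed rules. The inverse of \<pi> inside \<theta> is not computed: naturality
  of \<pi> in the two evaluations [A,HK] A -> HK and [B,M] B -> M brings \<pi> next to it, and they
  cancel.\<close>

lemma hom_iff: "f \<in> hom C A B \<longleftrightarrow> f \<in> arr C \<and> src C f = A \<and> tgt C f = B"
  by (simp add: hom_def)

lemma prod_cat_sel [simp]:
  "obj (C \<times>\<^sub>C D) = obj C \<times> obj D"
  "arr (C \<times>\<^sub>C D) = arr C \<times> arr D"
  "src (C \<times>\<^sub>C D) = map_prod (src C) (src D)"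
  "tgt (C \<times>\<^sub>C D) = map_prod (tgt C) (tgt D)"
  "ide (C \<times>\<^sub>C D) = map_prod (ide C) (ide D)"
  "(g, g') \<cdot>\<^bsub>C \<times>\<^sub>C D\<^esub> (f, f') = (g \<cdot>\<^bsub>C\<^esub> f, g' \<cdot>\<^bsub>D\<^esub> f')"
  by (simp_all add: prod_cat_def)

lemma op_cat_sel [simp]:
  "obj (op_cat C) = obj C"
  "arr (op_cat C) = arr C"
  "src (op_cat C) = tgt C"
  "tgt (op_cat C) = src C"
  "ide (op_cat C) = ide C"
  "g \<cdot>\<^bsub>op_cat C\<^esub> f = f \<cdot>\<^bsub>C\<^esub> g"
  by (simp_all add: op_cat_def)

lemma op_cat_prod: "op_cat (C \<times>\<^sub>C D) = op_cat C \<times>\<^sub>C op_cat D"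
  by (auto simp: op_cat_def prod_cat_def fun_eq_iff)

lemma funct_sel [simp]:
  "fob id_fun A = A"
  "far id_fun f = f"
  "fob (G \<circ>\<^sub>F F) A = fob G (fob F A)"
  "far (G \<circ>\<^sub>F F) f = far G (far F f)"
  "fob (F' \<times>\<^sub>F G') (X, Y) = (fob F' X, fob G' Y)"
  "far (F' \<times>\<^sub>F G') (h, k) = (far F' h, far G' k)"
  by (simp_all add: id_fun_def comp_fun_def prod_fun_def)

section \<open>Categories and functors\<close>

context category
begin

declare src_obj [simp] tgt_obj [simp]

lemma ide_sel [simp]:
  assumes "A \<in> obj C"
  shows "ide C A \<in> arr C" "src C (ide C A) = A" "tgt C (ide C A) = A"
  using ide_hom[OF assms] by (auto simp: hom_iff)

lemma cmp_sel [simp]: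
  assumes "f \<in> arr C" "g \<in> arr C" "src C g = tgt C f"
  shows "g \<cdot> f \<in> arr C" "src C (g \<cdot> f) = src C f" "tgt C (g \<cdot> f) = tgt C g"
  using cmp_hom[of f "src C f" "tgt C f" g "tgt C g"] assms by (auto simp: hom_iff)

lemma cmp_ide [simp]:
  "f \<in> arr C \<Longrightarrow> src C f = A \<Longrightarrow> f \<cdot> ide C A = f"
  "f \<in> arr C \<Longrightarrow> tgt C f = A \<Longrightarrow> ide C A \<cdot> f = f"
  using cmp_ide_right[of f A "tgt C f"] cmp_ide_left[of f "src C f" A] by (auto simp: hom_iff)

lemma comp_assoc [simp]:
  "f \<in> arr C \<Longrightarrow> g \<in> arr C \<Longrightarrow> h \<in> arr C \<Longrightarrow> src C g = tgt C f \<Longrightarrow> src C h = tgt C g \<Longrightarrow>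
    (h \<cdot> g) \<cdot> f = h \<cdot> g \<cdot> f"
  using cmp_assoc[of f "src C f" "tgt C f" g "tgt C g" h "tgt C h"] by (auto simp: hom_iff)

text \<open>\<open>comp_assoc\<close> keeps composites right-nested, so an equation for
  \<open>g \<cdot> f\<close> no longer matches once a tail \<open>k\<close> follows
  \<open>f\<close>. This form rewrites in front of such a tail.\<close>

lemma cmp_reassoc:
  assumes "g \<cdot> f = h" "f \<in> arr C" "g \<in> arr C" "k \<in> arr C" "src C g = tgt C f" "src C f = tgt C k"
  shows "g \<cdot> f \<cdot> k = h \<cdot> k"
  using assms by (metis comp_assoc)

text \<open>The same for commutative squares, where the replacement is itself a composite and has to
  end up right-nested. It is mostly applied to naturality squares.\<close>

lemma cmp_reassoc2:
  assumes "g \<cdot> f = h \<cdot> h'" "f \<in> arr C" "g \<in> arr C" "src C g = tgt C f"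
    "h' \<in> arr C" "h \<in> arr C" "src C h = tgt C h'" "k \<in> arr C" "src C f = tgt C k"
  shows "g \<cdot> f \<cdot> k = h \<cdot> h' \<cdot> k"
  using assms by (metis comp_assoc cmp_sel(2))

text \<open>Uniqueness is what gives the definite description in \<open>inv_arr\<close> its
  meaning.\<close>

lemma inverse_pair_unique:
  assumes "inverse_pair C f g" "inverse_pair C f h"
  shows "g = h"
proof -
  have "g = g \<cdot> (f \<cdot> h)" using assms by (auto simp: inverse_pair_def hom_iff)
  also have "\<dots> = (g \<cdot> f) \<cdot> h" using assms by (subst comp_assoc) (auto simp: inverse_pair_def hom_iff)
  also have "\<dots> = h" using assms by (auto simp: inverse_pair_def hom_iff)
  finally show ?thesis .
qed

lemma inverse_pair_inv_arr:
  assumes "is_iso C f"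
  shows "inverse_pair C f (inv_arr C f)"
proof -
  obtain g where "inverse_pair C f g" using assms by (auto simp: is_iso_def)
  then show ?thesis
    unfolding inv_arr_def by (rule theI) (metis \<open>inverse_pair C f g\<close> inverse_pair_unique)
qed

lemma inv_arr [simp]:
  assumes "is_iso C f"
  shows "inv_arr C f \<in> arr C" "src C (inv_arr C f) = tgt C f" "tgt C (inv_arr C f) = src C f"
    "inv_arr C f \<cdot> f = ide C (src C f)" "f \<cdot> inv_arr C f = ide C (tgt C f)"
  using inverse_pair_inv_arr[OF assms] by (auto simp: inverse_pair_def hom_iff)

lemma iso_arr: "is_iso C f \<Longrightarrow> f \<in> arr C"
  by (auto simp: is_iso_def inverse_pair_def)

lemma inv_arr_reassoc [simp]:
  assumes "is_iso C f" "k \<in> arr C"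
  shows "tgt C k = src C f \<Longrightarrow> inv_arr C f \<cdot> f \<cdot> k = k"
    "tgt C k = tgt C f \<Longrightarrow> f \<cdot> inv_arr C f \<cdot> k = k"
  using assms by (subst cmp_reassoc[OF inv_arr(4)] cmp_reassoc[OF inv_arr(5)]; simp add: iso_arr)+

lemma iso_cancel_left:
  assumes "is_iso C f" "f \<cdot> g = f \<cdot> h" "g \<in> arr C" "h \<in> arr C" "tgt C g = src C f" "tgt C h = src C f"
  shows "g = h"
  using assms inv_arr_reassoc(1) by metis

lemma iso_cancel_right:
  assumes "is_iso C f" "g \<cdot> f = h \<cdot> f" "g \<in> arr C" "h \<in> arr C" "src C g = tgt C f" "src C h = tgt C f"
  shows "g = h"
proof -
  have "(g \<cdot> f) \<cdot> inv_arr C f = (h \<cdot> f) \<cdot> inv_arr C f" using assms by simp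
  then show ?thesis using assms(1,3-) by (simp add: iso_arr)
qed

text \<open>Cancelling \<open>a\<close> on the right turns the square on \<open>a\<close> and
  \<open>b\<close> into one on their inverses. This yields naturality of inverse associators and of
  inverse \<open>mult\<close>, and the symmetry of inverse \<open>mult\<close>.\<close>

lemma iso_square:
  assumes "is_iso C a" "is_iso C b" "b \<cdot> f = g \<cdot> a" "f \<in> arr C" "g \<in> arr C"
    "src C f = src C a" "tgt C f = src C b" "src C g = tgt C a" "tgt C g = tgt C b"
  shows "inv_arr C b \<cdot> g = f \<cdot> inv_arr C a"
proof (rule iso_cancel_right[OF assms(1)])
  have "inv_arr C b \<cdot> g \<cdot> a = f" 
    using assms(1,2,4-) by (simp add: assms(3)[symmetric])
  then show "(inv_arr C b \<cdot> g) \<cdot> a = (f \<cdot> inv_arr C a) \<cdot> a"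
    using assms by (simp add: iso_arr)
qed (use assms in \<open>auto simp: iso_arr\<close>)

end

section \<open>Functors, natural transformations, opposites and products\<close>

lemma (in is_functor) far_sel [simp]:
  "A \<in> obj C \<Longrightarrow> fob F A \<in> obj D"
  "f \<in> arr C \<Longrightarrow> far F f \<in> arr D"
  "f \<in> arr C \<Longrightarrow> src D (far F f) = fob F (src C f)"
  "f \<in> arr C \<Longrightarrow> tgt D (far F f) = fob F (tgt C f)"
  "A \<in> obj C \<Longrightarrow> far F (ide C A) = ide D (fob F A)"
  using far_hom[of f "src C f" "tgt C f"] far_ide fob_obj by (auto simp: hom_iff)

lemma (in is_functor) far_comp:
  "f \<in> arr C \<Longrightarrow> g \<in> arr C \<Longrightarrow> src C g = tgt C f \<Longrightarrow>
    far F (g \<cdot>\<^bsub>C\<^esub> f) = far F g \<cdot>\<^bsub>D\<^esub> far F f"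
  using far_cmp[of f "src C f" "tgt C f" g "tgt C g"] by (auto simp: hom_iff)

lemma is_functorI:
  assumes "category C" "category D"
    and "\<And>A. A \<in> obj C \<Longrightarrow> fob F A \<in> obj D"
    and "\<And>f. f \<in> arr C \<Longrightarrow> far F f \<in> arr D \<and> src D (far F f) = fob F (src C f) \<and>
      tgt D (far F f) = fob F (tgt C f)"
    and "\<And>A. A \<in> obj C \<Longrightarrow> far F (ide C A) = ide D (fob F A)"
    and "\<And>f g. f \<in> arr C \<Longrightarrow> g \<in> arr C \<Longrightarrow> src C g = tgt C f \<Longrightarrow>
      far F (g \<cdot>\<^bsub>C\<^esub> f) = far F g \<cdot>\<^bsub>D\<^esub> far F f"
  shows "is_functor C D F"
  using assms by (auto simp: is_functor_def is_functor_axioms_def hom_iff)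

lemma nat_transI:
  assumes "is_functor C D F" "is_functor C D G"
    and "\<And>A. A \<in> obj C \<Longrightarrow> t A \<in> arr D \<and> src D (t A) = fob F A \<and> tgt D (t A) = fob G A"
    and "\<And>f. f \<in> arr C \<Longrightarrow> t (tgt C f) \<cdot>\<^bsub>D\<^esub> far F f = far G f \<cdot>\<^bsub>D\<^esub> t (src C f)"
  shows "nat_trans C D F G t"
  using assms by (auto simp: nat_trans_def nat_trans_axioms_def hom_iff)

lemma (in nat_trans) component_sel [simp]:
  "A \<in> obj C \<Longrightarrow> t A \<in> arr D"
  "A \<in> obj C \<Longrightarrow> src D (t A) = fob F A"
  "A \<in> obj C \<Longrightarrow> tgt D (t A) = fob G A"
  using component_hom[of A] by (auto simp: hom_iff)

lemma (in nat_trans) natural: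
  "f \<in> arr C \<Longrightarrow> t (tgt C f) \<cdot>\<^bsub>D\<^esub> far F f = far G f \<cdot>\<^bsub>D\<^esub> t (src C f)"
  using naturality[of f "src C f" "tgt C f"] by (auto simp: hom_iff)

lemma category_op: "category C \<Longrightarrow> category (op_cat C)"
proof -
  assume "category C"
  then interpret category C .
  show ?thesis by unfold_locales (auto simp: hom_iff)
qed

lemma category_prod:
  assumes "category C" "category D"
  shows "category (C \<times>\<^sub>C D)"
proof -
  interpret C: category C by fact
  interpret D: category D by fact
  show ?thesis by unfold_locales (auto simp: hom_iff)
qed

lemma is_functor_id: "category C \<Longrightarrow> is_functor C C id_fun"
  by (rule is_functorI) auto

lemma is_functor_comp:
  assumes "is_functor C D F" "is_functor D E G"
  shows "is_functor C E (G \<circ>\<^sub>F F)"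
proof -
  interpret F: is_functor C D F by fact
  interpret G: is_functor D E G by fact
  show ?thesis by (rule is_functorI) (auto simp: F.far_comp G.far_comp intro: F.C.category_axioms G.D.category_axioms)
qed

lemma is_functor_prod:
  assumes "is_functor C D F" "is_functor C' D' F'"
  shows "is_functor (C \<times>\<^sub>C C') (D \<times>\<^sub>C D') (F \<times>\<^sub>F F')"
proof -
  interpret F: is_functor C D F by fact
  interpret G: is_functor C' D' F' by fact
  show ?thesis 
    by (rule is_functorI) (auto simp: F.far_comp G.far_comp category_prod F.C.category_axioms
      F.D.category_axioms G.C.category_axioms G.D.category_axioms)
qed

text \<open>\<open>op_cat\<close> forgets extra record fields, so \<open>op_cat (op_cat D)\<close>
  cannot be identified with a closed category \<open>D\<close>. A contravariant functor is therefore
  reread directly as a functor on the opposite of its domain; the two maps stay the same.\<close>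

lemma is_functor_op_left:
  assumes "is_functor C (op_cat D) F" "category D"
  shows "is_functor (op_cat C) D F"
proof -
  interpret F: is_functor C "op_cat D" F by fact
  show ?thesis using F.far_sel F.far_comp
    by (intro is_functorI) (auto simp: assms category_op F.C.category_axioms)
qed

section \<open>The middle-four interchange\<close>

text \<open>Left commutation A(BD) -> B(AD). It is the core of the interchange: up to an associator
  on either side, the interchange is \<open>lcomm\<close> on the last three of the four factors, see
  \<open>interchange_eq\<close>.\<close>

definition lcomm :: "('o, 'a, 'z) smc_category_scheme \<Rightarrow> 'o \<Rightarrow> 'o \<Rightarrow> 'o \<Rightarrow> 'a" where
  "lcomm C A B D =
     assoc C B A D \<cdot>\<^bsub>C\<^esub> (symm C A B \<boxtimes>\<^bsub>C\<^esub> ide C D) \<cdot>\<^bsub>C\<^esub> inv_arr C (assoc C A B D)"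

context symmetric_monoidal
begin

lemma tensor_ide [simp]: "A \<in> obj C \<Longrightarrow> B \<in> obj C \<Longrightarrow> ide C A \<boxtimes> ide C B = ide C (A \<otimes> B)"
  using tensor.far_ide[of "(A, B)"] by simp

lemma tensor_comp:
  assumes "f \<in> arr C" "g \<in> arr C" "f' \<in> arr C" "g' \<in> arr C" "src C f' = tgt C f" "src C g' = tgt C g"
  shows "(f' \<boxtimes> g') \<cdot> (f \<boxtimes> g) = (f' \<cdot> f) \<boxtimes> (g' \<cdot> g)"
  using tensor.far_comp[of "(f, g)" "(f', g')"] assms by simp

lemma tensor_comp_reassoc:
  assumes "f \<in> arr C" "g \<in> arr C" "f' \<in> arr C" "g' \<in> arr C" "src C f' = tgt C f" "src C g' = tgt C g"
    "k \<in> arr C" "tgt C k = src C f \<otimes> src C g"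
  shows "(f' \<boxtimes> g') \<cdot> (f \<boxtimes> g) \<cdot> k = ((f' \<cdot> f) \<boxtimes> (g' \<cdot> g)) \<cdot> k"
  by (rule cmp_reassoc[OF tensor_comp]) (use assms in auto)

text \<open>Functoriality of the tensor product, oriented so that consecutive tensor products of
  arrows merge into one. Factors acting in different slots are commuted by merging them and
  splitting again.\<close>

lemmas fuse = tensor_comp tensor_comp_reassoc

lemma assoc_sel [simp]:
  assumes "A \<in> obj C" "B \<in> obj C" "D \<in> obj C"
  shows "assoc C A B D \<in> arr C" "src C (assoc C A B D) = (A \<otimes> B) \<otimes> D"
    "tgt C (assoc C A B D) = A \<otimes> (B \<otimes> D)" "is_iso C (assoc C A B D)"
  using assoc_hom[OF assms] assoc_iso[OF assms] by (auto simp: hom_iff)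

lemma symm_sel [simp]:
  assumes "A \<in> obj C" "B \<in> obj C"
  shows "symm C A B \<in> arr C" "src C (symm C A B) = A \<otimes> B" "tgt C (symm C A B) = B \<otimes> A"
    "symm C B A \<cdot> symm C A B = ide C (A \<otimes> B)"
  using symm_hom[OF assms] symm_symm[OF assms] by (auto simp: hom_iff)

lemma symm_symm_reassoc [simp]:
  "A \<in> obj C \<Longrightarrow> B \<in> obj C \<Longrightarrow> k \<in> arr C \<Longrightarrow> tgt C k = A \<otimes> B \<Longrightarrow> symm C B A \<cdot> symm C A B \<cdot> k = k"
  by (subst cmp_reassoc[OF symm_sel(4)]) auto

lemma assoc_nat:
  "f \<in> arr C \<Longrightarrow> g \<in> arr C \<Longrightarrow> h \<in> arr C \<Longrightarrow>
    assoc C (tgt C f) (tgt C g) (tgt C h) \<cdot> ((f \<boxtimes> g) \<boxtimes> h)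
    = (f \<boxtimes> (g \<boxtimes> h)) \<cdot> assoc C (src C f) (src C g) (src C h)"
  by (rule assoc_natural) (auto simp: hom_iff)

lemma inv_assoc_nat:
  "f \<in> arr C \<Longrightarrow> g \<in> arr C \<Longrightarrow> h \<in> arr C \<Longrightarrow>
    inv_arr C (assoc C (tgt C f) (tgt C g) (tgt C h)) \<cdot> (f \<boxtimes> (g \<boxtimes> h))
    = ((f \<boxtimes> g) \<boxtimes> h) \<cdot> inv_arr C (assoc C (src C f) (src C g) (src C h))"
  by (rule iso_square[OF _ _ assoc_nat]) auto

lemma symm_nat:
  "f \<in> arr C \<Longrightarrow> g \<in> arr C \<Longrightarrow>
    symm C (tgt C f) (tgt C g) \<cdot> (f \<boxtimes> g) = (g \<boxtimes> f) \<cdot> symm C (src C f) (src C g)"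
  by (rule symm_natural) (auto simp: hom_iff)

lemma is_iso_tensor [simp]:
  assumes "is_iso C f" "is_iso C g"
  shows "is_iso C (f \<boxtimes> g)"
  using assms unfolding is_iso_def[of C "f \<boxtimes> g"]
  by (intro exI[of _ "inv_arr C f \<boxtimes> inv_arr C g"])
    (auto simp: inverse_pair_def hom_iff fuse iso_arr)

lemma is_iso_ide [simp]: "A \<in> obj C \<Longrightarrow> is_iso C (ide C A)"
  unfolding is_iso_def by (intro exI[of _ "ide C A"]) (auto simp: inverse_pair_def hom_iff)

lemma lcomm_sel [simp]:
  assumes "A \<in> obj C" "B \<in> obj C" "D \<in> obj C"
  shows "lcomm C A B D \<in> arr C" "src C (lcomm C A B D) = A \<otimes> (B \<otimes> D)"
    "tgt C (lcomm C A B D) = B \<otimes> (A \<otimes> D)"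
  using assms by (auto simp: lcomm_def)

text \<open>The three arrows pass the inverse associator, then the symmetry, then the associator,
  each time by naturality.\<close>

lemma lcomm_nat:
  assumes [simp]: "f \<in> arr C" "g \<in> arr C" "h \<in> arr C"
  shows "lcomm C (tgt C f) (tgt C g) (tgt C h) \<cdot> (f \<boxtimes> (g \<boxtimes> h))
    = (g \<boxtimes> (f \<boxtimes> h)) \<cdot> lcomm C (src C f) (src C g) (src C h)" (is "?l = _")
proof -
  have "?l = assoc C (tgt C g) (tgt C f) (tgt C h) \<cdot> (symm C (tgt C f) (tgt C g) \<boxtimes> ide C (tgt C h)) \<cdot>
      ((f \<boxtimes> g) \<boxtimes> h) \<cdot> inv_arr C (assoc C (src C f) (src C g) (src C h))"
    by (simp add: lcomm_def inv_assoc_nat)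
  also have "\<dots> = assoc C (tgt C g) (tgt C f) (tgt C h) \<cdot> ((g \<boxtimes> f) \<boxtimes> h) \<cdot>
      (symm C (src C f) (src C g) \<boxtimes> ide C (src C h)) \<cdot> inv_arr C (assoc C (src C f) (src C g) (src C h))"
    by (simp add: fuse symm_nat)
  also have "\<dots> = (g \<boxtimes> (f \<boxtimes> h)) \<cdot> lcomm C (src C f) (src C g) (src C h)"
    by (subst cmp_reassoc2[OF assoc_nat]) (simp_all add: lcomm_def)
  finally show ?thesis .
qed

text \<open>The hexagon axiom with its associator \<open>assoc C A B D\<close> absorbed into
  \<open>lcomm\<close>, after cancelling that associator on the right.\<close>

lemma lcomm_hexagon:
  assumes [simp]: "A \<in> obj C" "B \<in> obj C" "D \<in> obj C"
  shows "assoc C B D A \<cdot> symm C A (B \<otimes> D) = (ide C B \<boxtimes> symm C A D) \<cdot> lcomm C A B D"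
  by (rule iso_cancel_right[where f = "assoc C A B D"]) (simp_all add: lcomm_def hexagon)

text \<open>The other hexagon, for a pair crossing a single object. It follows from
  \<open>lcomm_hexagon\<close> for D, A, B because the symmetry is an involution.\<close>

lemma lcomm_symm_left:
  assumes [simp]: "A \<in> obj C" "B \<in> obj C" "D \<in> obj C"
  shows "lcomm C D A B \<cdot> symm C (A \<otimes> B) D = (ide C A \<boxtimes> symm C B D) \<cdot> assoc C A B D"
proof -
  have "lcomm C D A B = (ide C A \<boxtimes> symm C B D) \<cdot> (ide C A \<boxtimes> symm C D B) \<cdot> lcomm C D A B"
    by (simp add: fuse)
  also have "\<dots> = (ide C A \<boxtimes> symm C B D) \<cdot> assoc C A B D \<cdot> symm C D (A \<otimes> B)"
    by (simp add: lcomm_hexagon)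
  finally show ?thesis by simp
qed

text \<open>Two pentagons, for D, A, E, X and for A, D, E, X, glued along naturality of the
  associator in \<open>symm C A D\<close>.\<close>

lemma lcomm_assoc_right:
  assumes [simp]: "A \<in> obj C" "D \<in> obj C" "E \<in> obj C" "X \<in> obj C"
  shows "(ide C D \<boxtimes> assoc C A E X) \<cdot> assoc C D (A \<otimes> E) X \<cdot> (lcomm C A D E \<boxtimes> ide C X)
    = lcomm C A D (E \<otimes> X) \<cdot> (ide C A \<boxtimes> assoc C D E X) \<cdot> assoc C A (D \<otimes> E) X"
proof (rule iso_cancel_right[where f = "assoc C A D E \<boxtimes> ide C X"])
  have "((ide C D \<boxtimes> assoc C A E X) \<cdot> assoc C D (A \<otimes> E) X \<cdot> (lcomm C A D E \<boxtimes> ide C X)) \<cdot>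
      (assoc C A D E \<boxtimes> ide C X)
    = ((ide C D \<boxtimes> assoc C A E X) \<cdot> assoc C D (A \<otimes> E) X \<cdot> (assoc C D A E \<boxtimes> ide C X)) \<cdot>
      ((symm C A D \<boxtimes> ide C E) \<boxtimes> ide C X)"
    by (simp add: fuse lcomm_def)
  also have "\<dots> = assoc C D A (E \<otimes> X) \<cdot> assoc C (D \<otimes> A) E X \<cdot> ((symm C A D \<boxtimes> ide C E) \<boxtimes> ide C X)"
    by (subst pentagon) simp_all
  also have "\<dots> = assoc C D A (E \<otimes> X) \<cdot> (symm C A D \<boxtimes> ide C (E \<otimes> X)) \<cdot> assoc C (A \<otimes> D) E X"
    using assoc_nat[of "symm C A D" "ide C E" "ide C X"] by simp
  also have "\<dots> = lcomm C A D (E \<otimes> X) \<cdot> assoc C A D (E \<otimes> X) \<cdot> assoc C (A \<otimes> D) E X"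
    by (simp add: lcomm_def)
  also have "\<dots> = (lcomm C A D (E \<otimes> X) \<cdot> (ide C A \<boxtimes> assoc C D E X) \<cdot> assoc C A (D \<otimes> E) X) \<cdot>
      (assoc C A D E \<boxtimes> ide C X)"
    by (simp add: pentagon[symmetric])
  finally show "((ide C D \<boxtimes> assoc C A E X) \<cdot> assoc C D (A \<otimes> E) X \<cdot> (lcomm C A D E \<boxtimes> ide C X)) \<cdot>
      (assoc C A D E \<boxtimes> ide C X) = \<dots>" .
qed simp_all

lemma lcomm_lcomm [simp]:
  assumes [simp]: "A \<in> obj C" "B \<in> obj C" "D \<in> obj C"
  shows "lcomm C B A D \<cdot> lcomm C A B D = ide C (A \<otimes> (B \<otimes> D))"
  by (simp add: lcomm_def fuse)

lemma lcomm_lcomm_reassoc [simp]: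
  "A \<in> obj C \<Longrightarrow> B \<in> obj C \<Longrightarrow> D \<in> obj C \<Longrightarrow> k \<in> arr C \<Longrightarrow> tgt C k = A \<otimes> (B \<otimes> D) \<Longrightarrow>
    lcomm C B A D \<cdot> lcomm C A B D \<cdot> k = k"
  by (subst cmp_reassoc[OF lcomm_lcomm]) auto

text \<open>Passing \<open>A\<close> across a product is passing it across the factors one after the
  other. The pentagon for D, E, A, X exposes the symmetry of \<open>A\<close> with the product, the
  hexagon splits it, and \<open>lcomm_assoc_right\<close> collects the associators.\<close>

lemma lcomm_tensor_right:
  assumes [simp]: "A \<in> obj C" "D \<in> obj C" "E \<in> obj C" "X \<in> obj C"
  shows "assoc C D E (A \<otimes> X) \<cdot> lcomm C A (D \<otimes> E) X
    = (ide C D \<boxtimes> lcomm C A E X) \<cdot> lcomm C A D (E \<otimes> X) \<cdot> (ide C A \<boxtimes> assoc C D E X)"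
proof (rule iso_cancel_right[where f = "assoc C A (D \<otimes> E) X"])
  have "(assoc C D E (A \<otimes> X) \<cdot> lcomm C A (D \<otimes> E) X) \<cdot> assoc C A (D \<otimes> E) X
    = (assoc C D E (A \<otimes> X) \<cdot> assoc C (D \<otimes> E) A X) \<cdot> (symm C A (D \<otimes> E) \<boxtimes> ide C X)"
    by (simp add: lcomm_def)
  also have "\<dots> = (ide C D \<boxtimes> assoc C E A X) \<cdot> assoc C D (E \<otimes> A) X \<cdot>
      ((assoc C D E A \<cdot> symm C A (D \<otimes> E)) \<boxtimes> ide C X)"
    by (simp add: pentagon[symmetric] fuse)
  also have "\<dots> = (ide C D \<boxtimes> assoc C E A X) \<cdot> assoc C D (E \<otimes> A) X \<cdot>
      ((ide C D \<boxtimes> symm C A E) \<boxtimes> ide C X) \<cdot> (lcomm C A D E \<boxtimes> ide C X)"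
    by (simp add: lcomm_hexagon fuse)
  also have "\<dots> = (ide C D \<boxtimes> assoc C E A X) \<cdot> (ide C D \<boxtimes> (symm C A E \<boxtimes> ide C X)) \<cdot>
      assoc C D (A \<otimes> E) X \<cdot> (lcomm C A D E \<boxtimes> ide C X)"
    using cmp_reassoc2[OF assoc_nat[of "ide C D" "symm C A E" "ide C X"]] by simp
  also have "\<dots> = (ide C D \<boxtimes> lcomm C A E X) \<cdot> (ide C D \<boxtimes> assoc C A E X) \<cdot>
      assoc C D (A \<otimes> E) X \<cdot> (lcomm C A D E \<boxtimes> ide C X)"
    by (simp add: lcomm_def fuse)
  also have "\<dots> = ((ide C D \<boxtimes> lcomm C A E X) \<cdot> lcomm C A D (E \<otimes> X) \<cdot> (ide C A \<boxtimes> assoc C D E X)) \<cdot>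
      assoc C A (D \<otimes> E) X"
    by (simp add: lcomm_assoc_right)
  finally show "(assoc C D E (A \<otimes> X) \<cdot> lcomm C A (D \<otimes> E) X) \<cdot> assoc C A (D \<otimes> E) X = \<dots>" .
qed simp_all

text \<open>No new diagram is needed: this is \<open>lcomm_tensor_right\<close> inverted, since
  swapping the first two arguments of \<open>lcomm\<close> inverts it.\<close>

lemma lcomm_tensor_left:
  assumes [simp]: "A \<in> obj C" "B \<in> obj C" "D \<in> obj C" "E \<in> obj C"
  shows "(ide C D \<boxtimes> assoc C A B E) \<cdot> lcomm C (A \<otimes> B) D E
    = lcomm C A D (B \<otimes> E) \<cdot> (ide C A \<boxtimes> lcomm C B D E) \<cdot> assoc C A B (D \<otimes> E)" (is "?l = _")
proof -
  have "lcomm C A D (B \<otimes> E) \<cdot> (ide C A \<boxtimes> lcomm C B D E) \<cdot> assoc C A B (D \<otimes> E)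
    = lcomm C A D (B \<otimes> E) \<cdot> (ide C A \<boxtimes> lcomm C B D E) \<cdot>
      (assoc C A B (D \<otimes> E) \<cdot> lcomm C D (A \<otimes> B) E) \<cdot> lcomm C (A \<otimes> B) D E"
    by simp
  also have "\<dots> = ?l"
    unfolding lcomm_tensor_right[OF assms(3,1,2,4)] by (simp add: fuse)
  finally show ?thesis by simp
qed

lemma interchange_eq:
  assumes "A \<in> obj C" "B \<in> obj C" "D \<in> obj C" "E \<in> obj C"
  shows "interchange C A B D E =
    inv_arr C (assoc C A D (B \<otimes> E)) \<cdot> (ide C A \<boxtimes> lcomm C B D E) \<cdot> assoc C A B (D \<otimes> E)"
  using assms by (simp add: interchange_def lcomm_def fuse)

lemma interchange_sel [simp]:
  assumes "A \<in> obj C" "B \<in> obj C" "D \<in> obj C" "E \<in> obj C"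
  shows "interchange C A B D E \<in> arr C" "src C (interchange C A B D E) = (A \<otimes> B) \<otimes> (D \<otimes> E)"
    "tgt C (interchange C A B D E) = (A \<otimes> D) \<otimes> (B \<otimes> E)"
  using assms by (auto simp: interchange_eq)

lemma interchange_nat:
  assumes [simp]: "f \<in> arr C" "g \<in> arr C" "h \<in> arr C" "k \<in> arr C"
  shows "interchange C (tgt C f) (tgt C g) (tgt C h) (tgt C k) \<cdot> ((f \<boxtimes> g) \<boxtimes> (h \<boxtimes> k))
    = ((f \<boxtimes> h) \<boxtimes> (g \<boxtimes> k)) \<cdot> interchange C (src C f) (src C g) (src C h) (src C k)" (is "?l = _")
proof -
  have "?l = inv_arr C (assoc C (tgt C f) (tgt C h) (tgt C g \<otimes> tgt C k)) \<cdot>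
      (ide C (tgt C f) \<boxtimes> lcomm C (tgt C g) (tgt C h) (tgt C k)) \<cdot>
      (f \<boxtimes> (g \<boxtimes> (h \<boxtimes> k))) \<cdot> assoc C (src C f) (src C g) (src C h \<otimes> src C k)"
    using assoc_nat[of f g "h \<boxtimes> k"] by (simp add: interchange_eq)
  also have "\<dots> = inv_arr C (assoc C (tgt C f) (tgt C h) (tgt C g \<otimes> tgt C k)) \<cdot>
      (f \<boxtimes> (h \<boxtimes> (g \<boxtimes> k))) \<cdot> (ide C (src C f) \<boxtimes> lcomm C (src C g) (src C h) (src C k)) \<cdot>
      assoc C (src C f) (src C g) (src C h \<otimes> src C k)"
    by (simp add: fuse lcomm_nat)
  also have "\<dots> = ((f \<boxtimes> h) \<boxtimes> (g \<boxtimes> k)) \<cdot> interchange C (src C f) (src C g) (src C h) (src C k)"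
    using cmp_reassoc2[OF inv_assoc_nat[of f h "g \<boxtimes> k"]] by (simp add: interchange_eq)
  finally show ?thesis .
qed

text \<open>This is the coherence fact behind the symmetry of the tensor product of two symmetric
  pairings, needed for \<tau>. After cancelling an associator it reduces to the rules for
  \<open>lcomm\<close>.\<close>

lemma interchange_symm:
  assumes [simp]: "A \<in> obj C" "B \<in> obj C" "D \<in> obj C" "E \<in> obj C"
  shows "interchange C D E A B \<cdot> symm C (A \<otimes> B) (D \<otimes> E)
    = (symm C A D \<boxtimes> symm C B E) \<cdot> interchange C A B D E"
proof (rule iso_cancel_left[where f = "assoc C D A (E \<otimes> B)"])
  have "assoc C D A (E \<otimes> B) \<cdot> interchange C D E A B \<cdot> symm C (A \<otimes> B) (D \<otimes> E)
    = (ide C D \<boxtimes> lcomm C E A B) \<cdot> assoc C D E (A \<otimes> B) \<cdot> symm C (A \<otimes> B) (D \<otimes> E)"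
    by (simp add: interchange_eq)
  \<comment> \<open>\<open>lcomm_hexagon\<close> lets the pair A B cross D first and E second. The
    second crossing meets \<open>lcomm C E A B\<close>, and \<open>lcomm_symm_left\<close> reduces
    the two to a crossing of B and E alone.\<close>
  also have "\<dots> = (ide C D \<boxtimes> (ide C A \<boxtimes> symm C B E)) \<cdot> (ide C D \<boxtimes> assoc C A B E) \<cdot>
      lcomm C (A \<otimes> B) D E"
    by (simp add: lcomm_hexagon lcomm_symm_left fuse)
  also have "\<dots> = lcomm C A D (E \<otimes> B) \<cdot> (ide C A \<boxtimes> (ide C D \<boxtimes> symm C B E)) \<cdot>
      (ide C A \<boxtimes> lcomm C B D E) \<cdot> assoc C A B (D \<otimes> E)"
    using cmp_reassoc2[OF lcomm_nat[of "ide C A" "ide C D" "symm C B E"]]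
    by (simp add: lcomm_tensor_left)
  also have "\<dots> = assoc C D A (E \<otimes> B) \<cdot> (symm C A D \<boxtimes> ide C (E \<otimes> B)) \<cdot> 
      (ide C (A \<otimes> D) \<boxtimes> symm C B E) \<cdot> interchange C A B D E"
    using cmp_reassoc2[OF inv_assoc_nat[of "ide C A" "ide C D" "symm C B E"]]
    by (simp add: lcomm_def interchange_eq)
  also have "\<dots> = assoc C D A (E \<otimes> B) \<cdot> (symm C A D \<boxtimes> symm C B E) \<cdot> interchange C A B D E"
    by (simp add: fuse)
  finally show "assoc C D A (E \<otimes> B) \<cdot> interchange C D E A B \<cdot> symm C (A \<otimes> B) (D \<otimes> E) = \<dots>" .
qed simp_all

end

section \<open>Symmetric monoidal functors and the interchange\<close>

context symmetric_monoidal_functor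
begin

lemma mult_sel [simp]:
  assumes "A \<in> obj C" "B \<in> obj C"
  shows "mult F A B \<in> arr D" "src D (mult F A B) = fob F A \<otimes>\<^bsub>D\<^esub> fob F B"
    "tgt D (mult F A B) = fob F (A \<otimes>\<^bsub>C\<^esub> B)" "is_iso D (mult F A B)"
  using mult.component_sel[of "(A, B)"] mult.component_iso[of "(A, B)"] assms by auto

lemma mult_nat:
  "f \<in> arr C \<Longrightarrow> g \<in> arr C \<Longrightarrow>
    mult F (tgt C f) (tgt C g) \<cdot>\<^bsub>D\<^esub> (far F f \<boxtimes>\<^bsub>D\<^esub> far F g)
    = far F (f \<boxtimes>\<^bsub>C\<^esub> g) \<cdot>\<^bsub>D\<^esub> mult F (src C f) (src C g)"
  using mult.natural[of "(f, g)"] by simp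

lemma inv_mult_nat:
  "f \<in> arr C \<Longrightarrow> g \<in> arr C \<Longrightarrow>
    inv_arr D (mult F (tgt C f) (tgt C g)) \<cdot>\<^bsub>D\<^esub> far F (f \<boxtimes>\<^bsub>C\<^esub> g)
    = (far F f \<boxtimes>\<^bsub>D\<^esub> far F g) \<cdot>\<^bsub>D\<^esub> inv_arr D (mult F (src C f) (src C g))"
  by (rule D.iso_square[OF _ _ mult_nat]) auto

text \<open>\<open>mult_assoc\<close> solved for the inverse associators; both sides are compared
  after precomposition with the associator of \<open>D\<close>.\<close>

lemma mult_assoc_inv:
  assumes [simp]: "A \<in> obj C" "B \<in> obj C" "E \<in> obj C"
  shows "far F (inv_arr C (assoc C A B E)) \<cdot>\<^bsub>D\<^esub> mult F A (B \<otimes>\<^bsub>C\<^esub> E) \<cdot>\<^bsub>D\<^esub>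
      (ide D (fob F A) \<boxtimes>\<^bsub>D\<^esub> mult F B E)
    = mult F (A \<otimes>\<^bsub>C\<^esub> B) E \<cdot>\<^bsub>D\<^esub> (mult F A B \<boxtimes>\<^bsub>D\<^esub> ide D (fob F E)) \<cdot>\<^bsub>D\<^esub>
      inv_arr D (assoc D (fob F A) (fob F B) (fob F E))" (is "?l = ?r")
proof (rule D.iso_cancel_right[where f = "assoc D (fob F A) (fob F B) (fob F E)"])
  have "?l \<cdot>\<^bsub>D\<^esub> assoc D (fob F A) (fob F B) (fob F E)
    = far F (inv_arr C (assoc C A B E)) \<cdot>\<^bsub>D\<^esub> far F (assoc C A B E) \<cdot>\<^bsub>D\<^esub> mult F (A \<otimes>\<^bsub>C\<^esub> B) E \<cdot>\<^bsub>D\<^esub>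
      (mult F A B \<boxtimes>\<^bsub>D\<^esub> ide D (fob F E))"
    by (simp add: mult_assoc)
  also have "\<dots> = ?r \<cdot>\<^bsub>D\<^esub> assoc D (fob F A) (fob F B) (fob F E)"
    by (subst D.cmp_reassoc[OF far_comp[symmetric]]) simp_all
  finally show "?l \<cdot>\<^bsub>D\<^esub> assoc D (fob F A) (fob F B) (fob F E) = \<dots>" .
qed simp_all

text \<open>Each factor of \<open>lcomm\<close> passes through \<open>mult\<close> by its own axiom:
  the inverse associator by \<open>mult_assoc_inv\<close>, the symmetry by naturality and
  \<open>mult_symm\<close>, the associator by \<open>mult_assoc\<close>.\<close>

lemma mult_lcomm:
  assumes [simp]: "A \<in> obj C" "B \<in> obj C" "E \<in> obj C"
  shows "far F (lcomm C A B E) \<cdot>\<^bsub>D\<^esub> mult F A (B \<otimes>\<^bsub>C\<^esub> E) \<cdot>\<^bsub>D\<^esub> (ide D (fob F A) \<boxtimes>\<^bsub>D\<^esub> mult F B E)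
    = mult F B (A \<otimes>\<^bsub>C\<^esub> E) \<cdot>\<^bsub>D\<^esub> (ide D (fob F B) \<boxtimes>\<^bsub>D\<^esub> mult F A E) \<cdot>\<^bsub>D\<^esub>
      lcomm D (fob F A) (fob F B) (fob F E)" (is "?l = _")
proof -
  have "?l = far F (assoc C B A E) \<cdot>\<^bsub>D\<^esub> far F (symm C A B \<boxtimes>\<^bsub>C\<^esub> ide C E) \<cdot>\<^bsub>D\<^esub>
      mult F (A \<otimes>\<^bsub>C\<^esub> B) E \<cdot>\<^bsub>D\<^esub> (mult F A B \<boxtimes>\<^bsub>D\<^esub> ide D (fob F E)) \<cdot>\<^bsub>D\<^esub>
      inv_arr D (assoc D (fob F A) (fob F B) (fob F E))"
    by (simp add: lcomm_def far_comp mult_assoc_inv)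
  also have "\<dots> = far F (assoc C B A E) \<cdot>\<^bsub>D\<^esub> mult F (B \<otimes>\<^bsub>C\<^esub> A) E \<cdot>\<^bsub>D\<^esub> 
      ((far F (symm C A B) \<cdot>\<^bsub>D\<^esub> mult F A B) \<boxtimes>\<^bsub>D\<^esub> ide D (fob F E)) \<cdot>\<^bsub>D\<^esub>
      inv_arr D (assoc D (fob F A) (fob F B) (fob F E))"
    using D.cmp_reassoc2[OF mult_nat[of "symm C A B" "ide C E"], symmetric] by (simp add: D.fuse)
  also have "\<dots> = (far F (assoc C B A E) \<cdot>\<^bsub>D\<^esub> mult F (B \<otimes>\<^bsub>C\<^esub> A) E \<cdot>\<^bsub>D\<^esub> 
      (mult F B A \<boxtimes>\<^bsub>D\<^esub> ide D (fob F E))) \<cdot>\<^bsub>D\<^esub> (symm D (fob F A) (fob F B) \<boxtimes>\<^bsub>D\<^esub> ide D (fob F E)) \<cdot>\<^bsub>D\<^esub>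
      inv_arr D (assoc D (fob F A) (fob F B) (fob F E))"
    by (simp add: mult_symm D.fuse)
  also have "\<dots> = mult F B (A \<otimes>\<^bsub>C\<^esub> E) \<cdot>\<^bsub>D\<^esub> (ide D (fob F B) \<boxtimes>\<^bsub>D\<^esub> mult F A E) \<cdot>\<^bsub>D\<^esub>
      lcomm D (fob F A) (fob F B) (fob F E)"
    by (subst mult_assoc) (simp_all add: lcomm_def)
  finally show ?thesis .
qed

text \<open>The pattern of \<open>mult_lcomm\<close> one level up, with \<open>lcomm\<close> in
  place of the symmetry. The tensor product of the two \<open>mult\<close> arrows is split into one
  factor at a time, so that \<open>mult_assoc\<close> and later \<open>mult_assoc_inv\<close> find
  their left sides.\<close>

lemma mult_interchange:
  assumes [simp]: "A \<in> obj C" "B \<in> obj C" "X \<in> obj C" "Y \<in> obj C"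
  shows "far F (interchange C A B X Y) \<cdot>\<^bsub>D\<^esub> mult F (A \<otimes>\<^bsub>C\<^esub> B) (X \<otimes>\<^bsub>C\<^esub> Y) \<cdot>\<^bsub>D\<^esub>
      (mult F A B \<boxtimes>\<^bsub>D\<^esub> mult F X Y)
    = mult F (A \<otimes>\<^bsub>C\<^esub> X) (B \<otimes>\<^bsub>C\<^esub> Y) \<cdot>\<^bsub>D\<^esub> (mult F A X \<boxtimes>\<^bsub>D\<^esub> mult F B Y) \<cdot>\<^bsub>D\<^esub>
      interchange D (fob F A) (fob F B) (fob F X) (fob F Y)" (is "?l = _")
proof -
  have "?l = far F (inv_arr C (assoc C A X (B \<otimes>\<^bsub>C\<^esub> Y))) \<cdot>\<^bsub>D\<^esub>
      far F (ide C A \<boxtimes>\<^bsub>C\<^esub> lcomm C B X Y) \<cdot>\<^bsub>D\<^esub> (far F (assoc C A B (X \<otimes>\<^bsub>C\<^esub> Y)) \<cdot>\<^bsub>D\<^esub> 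
      mult F (A \<otimes>\<^bsub>C\<^esub> B) (X \<otimes>\<^bsub>C\<^esub> Y) \<cdot>\<^bsub>D\<^esub> (mult F A B \<boxtimes>\<^bsub>D\<^esub> ide D (fob F (X \<otimes>\<^bsub>C\<^esub> Y)))) \<cdot>\<^bsub>D\<^esub>
      (ide D (fob F A \<otimes>\<^bsub>D\<^esub> fob F B) \<boxtimes>\<^bsub>D\<^esub> mult F X Y)"
    by (simp add: C.interchange_eq far_comp D.fuse)
  also have "\<dots> = far F (inv_arr C (assoc C A X (B \<otimes>\<^bsub>C\<^esub> Y))) \<cdot>\<^bsub>D\<^esub>
      far F (ide C A \<boxtimes>\<^bsub>C\<^esub> lcomm C B X Y) \<cdot>\<^bsub>D\<^esub> mult F A (B \<otimes>\<^bsub>C\<^esub> (X \<otimes>\<^bsub>C\<^esub> Y)) \<cdot>\<^bsub>D\<^esub>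
      (ide D (fob F A) \<boxtimes>\<^bsub>D\<^esub> (mult F B (X \<otimes>\<^bsub>C\<^esub> Y) \<cdot>\<^bsub>D\<^esub> (ide D (fob F B) \<boxtimes>\<^bsub>D\<^esub> mult F X Y))) \<cdot>\<^bsub>D\<^esub>
      assoc D (fob F A) (fob F B) (fob F X \<otimes>\<^bsub>D\<^esub> fob F Y)"
    using D.assoc_nat[of "ide D (fob F A)" "ide D (fob F B)" "mult F X Y"]
    by (subst mult_assoc) (simp_all add: D.fuse)
  also have "\<dots> = far F (inv_arr C (assoc C A X (B \<otimes>\<^bsub>C\<^esub> Y))) \<cdot>\<^bsub>D\<^esub> mult F A (X \<otimes>\<^bsub>C\<^esub> (B \<otimes>\<^bsub>C\<^esub> Y)) \<cdot>\<^bsub>D\<^esub>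
      (ide D (fob F A) \<boxtimes>\<^bsub>D\<^esub> (far F (lcomm C B X Y) \<cdot>\<^bsub>D\<^esub> mult F B (X \<otimes>\<^bsub>C\<^esub> Y) \<cdot>\<^bsub>D\<^esub> 
        (ide D (fob F B) \<boxtimes>\<^bsub>D\<^esub> mult F X Y))) \<cdot>\<^bsub>D\<^esub>
      assoc D (fob F A) (fob F B) (fob F X \<otimes>\<^bsub>D\<^esub> fob F Y)"
    using D.cmp_reassoc2[OF mult_nat[of "ide C A" "lcomm C B X Y"], symmetric] by (simp add: D.fuse)
  also have "\<dots> = (far F (inv_arr C (assoc C A X (B \<otimes>\<^bsub>C\<^esub> Y))) \<cdot>\<^bsub>D\<^esub> mult F A (X \<otimes>\<^bsub>C\<^esub> (B \<otimes>\<^bsub>C\<^esub> Y)) \<cdot>\<^bsub>D\<^esub>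
      (ide D (fob F A) \<boxtimes>\<^bsub>D\<^esub> mult F X (B \<otimes>\<^bsub>C\<^esub> Y))) \<cdot>\<^bsub>D\<^esub> 
      (ide D (fob F A) \<boxtimes>\<^bsub>D\<^esub> (ide D (fob F X) \<boxtimes>\<^bsub>D\<^esub> mult F B Y)) \<cdot>\<^bsub>D\<^esub>
      (ide D (fob F A) \<boxtimes>\<^bsub>D\<^esub> lcomm D (fob F B) (fob F X) (fob F Y)) \<cdot>\<^bsub>D\<^esub>
      assoc D (fob F A) (fob F B) (fob F X \<otimes>\<^bsub>D\<^esub> fob F Y)"
    by (simp add: mult_lcomm D.fuse)
  also have "\<dots> = mult F (A \<otimes>\<^bsub>C\<^esub> X) (B \<otimes>\<^bsub>C\<^esub> Y) \<cdot>\<^bsub>D\<^esub> (mult F A X \<boxtimes>\<^bsub>D\<^esub> ide D (fob F (B \<otimes>\<^bsub>C\<^esub> Y))) \<cdot>\<^bsub>D\<^esub>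
      (ide D (fob F A \<otimes>\<^bsub>D\<^esub> fob F X) \<boxtimes>\<^bsub>D\<^esub> mult F B Y) \<cdot>\<^bsub>D\<^esub>
      interchange D (fob F A) (fob F B) (fob F X) (fob F Y)"
    using D.cmp_reassoc2[OF D.inv_assoc_nat[of "ide D (fob F A)" "ide D (fob F X)" "mult F B Y"]]
    by (subst mult_assoc_inv) (simp_all add: D.interchange_eq)
  also have "\<dots> = mult F (A \<otimes>\<^bsub>C\<^esub> X) (B \<otimes>\<^bsub>C\<^esub> Y) \<cdot>\<^bsub>D\<^esub> (mult F A X \<boxtimes>\<^bsub>D\<^esub> mult F B Y) \<cdot>\<^bsub>D\<^esub>
      interchange D (fob F A) (fob F B) (fob F X) (fob F Y)"
    by (simp add: D.fuse)
  finally show ?thesis .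
qed

end

section \<open>Closed structure and dualities\<close>

context symmetric_monoidal_closed
begin

lemma ihom_ide [simp]: "A \<in> obj C \<Longrightarrow> B \<in> obj C \<Longrightarrow> \<lbrace>ide C A, ide C B\<rbrace> = ide C \<lblot>A, B\<rblot>"
  using ihom.far_ide[of "(A, B)"] by simp

lemma ihom_comp:
  assumes "f \<in> arr C" "g \<in> arr C" "f' \<in> arr C" "g' \<in> arr C" "src C f = tgt C f'" "src C g' = tgt C g"
  shows "\<lbrace>f', g'\<rbrace> \<cdot> \<lbrace>f, g\<rbrace> = \<lbrace>f \<cdot> f', g' \<cdot> g\<rbrace>"
  using ihom.far_comp[of "(f, g)" "(f', g')"] assms by simp

lemma ev_sel [simp]:
  assumes "X \<in> obj C" "A \<in> obj C"
  shows "ev C X A \<in> arr C" "src C (ev C X A) = \<lblot>X, A\<rblot> \<otimes> X" "tgt C (ev C X A) = A"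
proof -
  interpret adjunction C C "tensor_with C X" "ihom_from C X" "coev C X" "ev C X"
    using assms(1) by (rule closed_adjunction)
  show "ev C X A \<in> arr C" "src C (ev C X A) = \<lblot>X, A\<rblot> \<otimes> X" "tgt C (ev C X A) = A"
    using counit.component_sel[of A] assms(2) by (simp_all add: tensor_with_def ihom_from_def)
qed

lemma coev_sel [simp]:
  assumes "X \<in> obj C" "A \<in> obj C"
  shows "coev C X A \<in> arr C" "src C (coev C X A) = A" "tgt C (coev C X A) = \<lblot>X, A \<otimes> X\<rblot>"
proof -
  interpret adjunction C C "tensor_with C X" "ihom_from C X" "coev C X" "ev C X"
    using assms(1) by (rule closed_adjunction)
  show "coev C X A \<in> arr C" "src C (coev C X A) = A" "tgt C (coev C X A) = \<lblot>X, A \<otimes> X\<rblot>"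
    using unit.component_sel[of A] assms(2) by (simp_all add: tensor_with_def ihom_from_def)
qed

lemma ev_nat:
  assumes "X \<in> obj C" "g \<in> arr C"
  shows "ev C X (tgt C g) \<cdot> (\<lbrace>ide C X, g\<rbrace> \<boxtimes> ide C X) = g \<cdot> ev C X (src C g)"
proof -
  interpret adjunction C C "tensor_with C X" "ihom_from C X" "coev C X" "ev C X"
    using assms(1) by (rule closed_adjunction)
  show ?thesis using counit.natural[OF assms(2)] by (simp add: tensor_with_def ihom_from_def)
qed

lemma coev_nat:
  assumes "X \<in> obj C" "g \<in> arr C"
  shows "coev C X (tgt C g) \<cdot> g = \<lbrace>ide C X, g \<boxtimes> ide C X\<rbrace> \<cdot> coev C X (src C g)"
proof -
  interpret adjunction C C "tensor_with C X" "ihom_from C X" "coev C X" "ev C X"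
    using assms(1) by (rule closed_adjunction)
  show ?thesis using unit.natural[OF assms(2)] by (simp add: tensor_with_def ihom_from_def)
qed

lemma ev_coev:
  assumes "X \<in> obj C" "A \<in> obj C"
  shows "ev C X (A \<otimes> X) \<cdot> (coev C X A \<boxtimes> ide C X) = ide C (A \<otimes> X)"
    "\<lbrace>ide C X, ev C X A\<rbrace> \<cdot> coev C X \<lblot>X, A\<rblot> = ide C \<lblot>X, A\<rblot>"
proof -
  interpret adjunction C C "tensor_with C X" "ihom_from C X" "coev C X" "ev C X"
    using assms(1) by (rule closed_adjunction)
  show "ev C X (A \<otimes> X) \<cdot> (coev C X A \<boxtimes> ide C X) = ide C (A \<otimes> X)"
    "\<lbrace>ide C X, ev C X A\<rbrace> \<cdot> coev C X \<lblot>X, A\<rblot> = ide C \<lblot>X, A\<rblot>"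
    using triangle_left[OF assms(2)] triangle_right[OF assms(2)]
    by (simp_all add: tensor_with_def ihom_from_def)
qed

lemma adj_transpose_sel [simp]:
  assumes "A \<in> obj C" "X \<in> obj C" "g \<in> arr C" "src C g = A \<otimes> X"
  shows "adj_transpose C A X g \<in> arr C" "src C (adj_transpose C A X g) = A"
    "tgt C (adj_transpose C A X g) = \<lblot>X, tgt C g\<rblot>"
  using assms by (auto simp: adj_transpose_def)

lemma ev_adj_transpose:
  assumes [simp]: "A \<in> obj C" "X \<in> obj C" "g \<in> arr C" "src C g = A \<otimes> X"
  shows "ev C X (tgt C g) \<cdot> (adj_transpose C A X g \<boxtimes> ide C X) = g"
proof -
  have "ev C X (tgt C g) \<cdot> (adj_transpose C A X g \<boxtimes> ide C X)
    = ev C X (tgt C g) \<cdot> (\<lbrace>ide C X, g\<rbrace> \<boxtimes> ide C X) \<cdot> (coev C X A \<boxtimes> ide C X)"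
    by (simp add: adj_transpose_def fuse)
  also have "\<dots> = g"
    by (subst cmp_reassoc2[OF ev_nat]) (simp_all add: ev_coev)
  finally show ?thesis .
qed

lemma adj_transpose_ev:
  assumes [simp]: "f \<in> arr C" "X \<in> obj C" "B \<in> obj C" and tgt: "tgt C f = \<lblot>X, B\<rblot>"
  shows "adj_transpose C (src C f) X (ev C X B \<cdot> (f \<boxtimes> ide C X)) = f"
proof -
  have "adj_transpose C (src C f) X (ev C X B \<cdot> (f \<boxtimes> ide C X))
    = \<lbrace>ide C X, ev C X B\<rbrace> \<cdot> \<lbrace>ide C X, f \<boxtimes> ide C X\<rbrace> \<cdot> coev C X (src C f)"
    by (simp add: adj_transpose_def cmp_reassoc[OF ihom_comp] tgt)
  also have "\<dots> = \<lbrace>ide C X, ev C X B\<rbrace> \<cdot> coev C X (tgt C f) \<cdot> f"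
    by (simp add: coev_nat)
  also have "\<dots> = f"
    unfolding tgt by (subst cmp_reassoc[OF ev_coev(2)]) (simp_all add: tgt)
  finally show ?thesis .
qed

text \<open>Transposition is injective, as \<open>adj_transpose_ev\<close> recovers an arrow from
  its evaluation. It reduces equations between arrows into an internal Hom to equations between
  pairings.\<close>

lemma ev_eqI:
  assumes "ev C X B \<cdot> (f \<boxtimes> ide C X) = ev C X B \<cdot> (g \<boxtimes> ide C X)" "f \<in> arr C" "g \<in> arr C"
    "X \<in> obj C" "B \<in> obj C" "src C f = src C g" "tgt C f = \<lblot>X, B\<rblot>" "tgt C g = \<lblot>X, B\<rblot>"
  shows "f = g"
  using adj_transpose_ev[of f X B] adj_transpose_ev[of g X B] assms by metis

text \<open>Dinaturality of evaluation. It is \<open>transpose_natural_param\<close> for the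
  evaluation at the target of \<open>u\<close>, whose transpose is an identity, read back through
  \<open>ev_adj_transpose\<close>.\<close>

lemma ev_ihom_left:
  assumes [simp]: "u \<in> arr C" "B \<in> obj C"
  shows "ev C (src C u) B \<cdot> (\<lbrace>u, ide C B\<rbrace> \<boxtimes> ide C (src C u))
    = ev C (tgt C u) B \<cdot> (ide C \<lblot>tgt C u, B\<rblot> \<boxtimes> u)"
proof -
  let ?Y = "tgt C u"
  have "adj_transpose C \<lblot>?Y, B\<rblot> ?Y (ev C ?Y B) = ide C \<lblot>?Y, B\<rblot>"
    by (simp add: adj_transpose_def ev_coev)
  then have "adj_transpose C \<lblot>?Y, B\<rblot> (src C u) (ev C ?Y B \<cdot> (ide C \<lblot>?Y, B\<rblot> \<boxtimes> u)) = \<lbrace>u, ide C B\<rbrace>"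
    using transpose_natural_param[of "\<lblot>?Y, B\<rblot>" u "src C u" ?Y "ev C ?Y B" B] by (simp add: hom_iff)
  then show ?thesis
    using ev_adj_transpose[of "\<lblot>?Y, B\<rblot>" "src C u" "ev C ?Y B \<cdot> (ide C \<lblot>?Y, B\<rblot> \<boxtimes> u)"] by simp
qed

lemma ev_ihom_left_comp:
  assumes "u \<in> arr C" "B \<in> obj C" "k \<in> arr C" "tgt C k = \<lblot>tgt C u, B\<rblot>"
  shows "ev C (src C u) B \<cdot> ((\<lbrace>u, ide C B\<rbrace> \<cdot> k) \<boxtimes> ide C (src C u)) = ev C (tgt C u) B \<cdot> (k \<boxtimes> u)"
proof -
  have "ev C (src C u) B \<cdot> ((\<lbrace>u, ide C B\<rbrace> \<cdot> k) \<boxtimes> ide C (src C u))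
    = ev C (src C u) B \<cdot> (\<lbrace>u, ide C B\<rbrace> \<boxtimes> ide C (src C u)) \<cdot> (k \<boxtimes> ide C (src C u))"
    using assms by (simp add: fuse)
  also have "\<dots> = ev C (tgt C u) B \<cdot> (k \<boxtimes> u)"
    using assms by (subst cmp_reassoc2[OF ev_ihom_left]) (simp_all add: fuse)
  finally show ?thesis .
qed

lemma evr_sel [simp]:
  assumes "A \<in> obj C" "K \<in> obj C"
  shows "evr C A K \<in> arr C" "src C (evr C A K) = A \<otimes> \<lblot>A, K\<rblot>" "tgt C (evr C A K) = K"
  using assms by (auto simp: evr_def)

lemma evr_symm:
  assumes "A \<in> obj C" "K \<in> obj C"
  shows "evr C A K \<cdot> symm C \<lblot>A, K\<rblot> A = ev C A K"
  using assms by (simp add: evr_def)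

lemma evr_tensor:
  assumes "A \<in> obj C" "K \<in> obj C" "f \<in> arr C" "g \<in> arr C" "tgt C f = A" "tgt C g = \<lblot>A, K\<rblot>"
  shows "evr C A K \<cdot> (f \<boxtimes> g) = ev C A K \<cdot> (g \<boxtimes> f) \<cdot> symm C (src C f) (src C g)"
  using assms symm_nat[of f g] by (simp add: evr_def)

lemma evr_ihom:
  assumes [simp]: "f \<in> arr C" "K \<in> obj C"
  shows "evr C (src C f) K \<cdot> (ide C (src C f) \<boxtimes> \<lbrace>f, ide C K\<rbrace>)
    = evr C (tgt C f) K \<cdot> (f \<boxtimes> ide C \<lblot>tgt C f, K\<rblot>)"
  using cmp_reassoc2[OF ev_ihom_left[of f K]] by (simp add: evr_tensor)

lemma bidual_sel [simp]:
  assumes "A \<in> obj C" "K \<in> obj C"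
  shows "bidual C K A \<in> arr C" "src C (bidual C K A) = A" "tgt C (bidual C K A) = \<lblot>\<lblot>A, K\<rblot>, K\<rblot>"
  using assms by (auto simp: bidual_def)

lemma ev_bidual:
  assumes "A \<in> obj C" "K \<in> obj C"
  shows "ev C \<lblot>A, K\<rblot> K \<cdot> (bidual C K A \<boxtimes> ide C \<lblot>A, K\<rblot>) = evr C A K"
  using ev_adj_transpose[of A "\<lblot>A, K\<rblot>" "evr C A K"] assms by (simp add: bidual_def)

text \<open>For \<open>u\<close> from Z to [A,K], the dual of \<open>u\<close> after the biduality
  map is the arrow from A to [Z,K] obtained by swapping the arguments of \<open>u\<close>. Such a
  composite forms one side of every duality square.\<close>

lemma ev_ihom_bidual:
  assumes "u \<in> arr C" "A \<in> obj C" "K \<in> obj C" "tgt C u = \<lblot>A, K\<rblot>"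
  shows "ev C (src C u) K \<cdot> ((\<lbrace>u, ide C K\<rbrace> \<cdot> bidual C K A) \<boxtimes> ide C (src C u))
    = evr C A K \<cdot> (ide C A \<boxtimes> u)"
proof -
  have "ev C (src C u) K \<cdot> ((\<lbrace>u, ide C K\<rbrace> \<cdot> bidual C K A) \<boxtimes> ide C (src C u))
    = ev C \<lblot>A, K\<rblot> K \<cdot> (bidual C K A \<boxtimes> ide C \<lblot>A, K\<rblot>) \<cdot> (ide C A \<boxtimes> u)"
    using assms ev_ihom_left_comp[of u K "bidual C K A"] by (simp add: fuse)
  also have "\<dots> = evr C A K \<cdot> (ide C A \<boxtimes> u)"
    using assms by (subst cmp_reassoc[OF ev_bidual]) simp_all
  finally show ?thesis .
qed

lemma dual_fun_sel [simp]:
  "fob (dual_fun C K) A = \<lblot>A, K\<rblot>" "far (dual_fun C K) f = \<lbrace>f, ide C K\<rbrace>"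
  by (simp_all add: dual_fun_def)

lemma is_functor_dual_fun:
  assumes "K \<in> obj C"
  shows "is_functor C (op_cat C) (dual_fun C K)"
  using assms by (intro is_functorI) (auto simp: ihom_comp category_axioms category_op)

text \<open>Both claims are checked after evaluation. Naturality of the biduality map becomes
  dinaturality of \<open>evr\<close>; in the triangle identity the arguments are swapped twice,
  which gives back \<open>ev\<close>.\<close>

lemma category_with_duality_dual_cat_of:
  assumes [simp]: "K \<in> obj C"
  shows "category_with_duality (dual_cat_of C K)"
proof -
  have D: "is_functor C (op_cat C) (dual_fun C K)"
    by (simp add: is_functor_dual_fun)
  have "nat_trans C C id_fun (dual_fun C K \<circ>\<^sub>F dual_fun C K) (bidual C K)"
  proof (rule nat_transI)
    show "is_functor C C (dual_fun C K \<circ>\<^sub>F dual_fun C K)"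
      using is_functor_comp[OF D is_functor_op_left[OF D category_axioms]] .
    fix f assume [simp]: "f \<in> arr C"
    have "ev C \<lblot>tgt C f, K\<rblot> K \<cdot> (bidual C K (tgt C f) \<boxtimes> ide C \<lblot>tgt C f, K\<rblot>) \<cdot> (f \<boxtimes> ide C \<lblot>tgt C f, K\<rblot>)
      = ev C \<lblot>tgt C f, K\<rblot> K \<cdot> ((\<lbrace>\<lbrace>f, ide C K\<rbrace>, ide C K\<rbrace> \<cdot> bidual C K (src C f)) \<boxtimes> ide C \<lblot>tgt C f, K\<rblot>)"
      using ev_ihom_bidual[of "\<lbrace>f, ide C K\<rbrace>" "src C f" K]
      by (subst cmp_reassoc[OF ev_bidual]) (simp_all add: evr_ihom)
    then have "bidual C K (tgt C f) \<cdot> f = \<lbrace>\<lbrace>f, ide C K\<rbrace>, ide C K\<rbrace> \<cdot> bidual C K (src C f)"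
      by - (rule ev_eqI[of "\<lblot>tgt C f, K\<rblot>" K], simp_all add: fuse)
    then show "bidual C K (tgt C f) \<cdot> far id_fun f
      = far (dual_fun C K \<circ>\<^sub>F dual_fun C K) f \<cdot> bidual C K (src C f)"
      by simp
  qed (simp_all add: is_functor_id category_axioms)
  moreover have "\<lbrace>bidual C K A, ide C K\<rbrace> \<cdot> bidual C K \<lblot>A, K\<rblot> = ide C \<lblot>A, K\<rblot>" if [simp]: "A \<in> obj C" for A
  proof (rule ev_eqI)
    have "ev C A K \<cdot> ((\<lbrace>bidual C K A, ide C K\<rbrace> \<cdot> bidual C K \<lblot>A, K\<rblot>) \<boxtimes> ide C A)
      = ev C \<lblot>A, K\<rblot> K \<cdot> (bidual C K A \<boxtimes> ide C \<lblot>A, K\<rblot>) \<cdot> symm C \<lblot>A, K\<rblot> A"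
      using ev_ihom_bidual[of "bidual C K A" "\<lblot>A, K\<rblot>" K] by (simp add: evr_tensor)
    also have "\<dots> = ev C A K \<cdot> (ide C \<lblot>A, K\<rblot> \<boxtimes> ide C A)"
      by (subst cmp_reassoc[OF ev_bidual]) (simp_all add: evr_symm)
    finally show "ev C A K \<cdot> ((\<lbrace>bidual C K A, ide C K\<rbrace> \<cdot> bidual C K \<lblot>A, K\<rblot>) \<boxtimes> ide C A) = \<dots>" .
  qed simp_all
  ultimately show ?thesis
    using D by (simp add: category_with_duality_def dual_cat_of_def)
qed

text \<open>The hypotheses \<open>dinatural\<close> and \<open>symmetric\<close> are the naturality
  square and the duality square of \<open>\<phi>\<close> after evaluation. The source is an
  arbitrary category with duality, so that products are covered, and \<open>p\<close> is a separate
  parameter so that each application can supply its pairing in explicit form.\<close>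

lemma duality_preserving_pairing:
  assumes E: "category_with_duality (E, D, \<omega>)" and T: "is_functor E C T" and L [simp]: "L \<in> obj C"
    and \<phi>: "\<And>A. A \<in> obj E \<Longrightarrow> \<phi> A \<in> hom C (fob T (fob D A)) \<lblot>fob T A, L\<rblot>"
    and p: "\<And>A. A \<in> obj E \<Longrightarrow> ev C (fob T A) L \<cdot> (\<phi> A \<boxtimes> ide C (fob T A)) = p A"
    and dinatural: "\<And>f. f \<in> arr E \<Longrightarrow> p (src E f) \<cdot> (far T (far D f) \<boxtimes> ide C (fob T (src E f)))
      = p (tgt E f) \<cdot> (ide C (fob T (fob D (tgt E f))) \<boxtimes> far T f)"
    and symmetric: "\<And>A. A \<in> obj E \<Longrightarrow> p (fob D A) \<cdot> (far T (\<omega> A) \<boxtimes> ide C (fob T (fob D A)))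
      = p A \<cdot> symm C (fob T A) (fob T (fob D A))"
  shows "duality_preserving (E, D, \<omega>) (dual_cat_of C L) (T, \<phi>)"
proof -
  have DE: "is_functor E (op_cat E) D" and "nat_trans E E id_fun (D \<circ>\<^sub>F D) \<omega>"
    using E by (auto simp: category_with_duality_def)
  interpret D: is_functor E "op_cat E" D by fact
  interpret T: is_functor E C T by fact
  interpret \<omega>: nat_trans E E id_fun "D \<circ>\<^sub>F D" \<omega> by fact
  \<comment> \<open>The interpretation of \<open>D\<close> states sources and targets in
    \<open>op_cat E\<close>; here they are restated in \<open>E\<close>.\<close>
  have D_sel [simp]: "A \<in> obj E \<Longrightarrow> fob D A \<in> obj E" "f \<in> arr E \<Longrightarrow> far D f \<in> arr E"
    "f \<in> arr E \<Longrightarrow> src E (far D f) = fob D (tgt E f)" 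
    "f \<in> arr E \<Longrightarrow> tgt E (far D f) = fob D (src E f)" for A f
    using D.far_sel(1)[of A] D.far_sel(2-4)[of f] by simp_all
  have [simp]: "A \<in> obj E \<Longrightarrow> \<phi> A \<in> arr C" "A \<in> obj E \<Longrightarrow> src C (\<phi> A) = fob T (fob D A)"
    "A \<in> obj E \<Longrightarrow> tgt C (\<phi> A) = \<lblot>fob T A, L\<rblot>" for A
    using \<phi>[of A] by (auto simp: hom_iff)
  have p_reassoc: "ev C (fob T A) L \<cdot> ((\<phi> A \<cdot> k) \<boxtimes> ide C (fob T A)) = p A \<cdot> (k \<boxtimes> ide C (fob T A))"
    if "A \<in> obj E" "k \<in> arr C" "tgt C k = fob T (fob D A)" for A k
    using that by (simp add: p[symmetric] fuse)
  have p_right: "ev C (fob T A) L \<cdot> (\<phi> A \<boxtimes> k) = p A \<cdot> (ide C (fob T (fob D A)) \<boxtimes> k)"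
    if "A \<in> obj E" "k \<in> arr C" "tgt C k = fob T A" for A k
    using that by (simp add: p[symmetric] fuse)
  have "nat_trans (op_cat E) C (T \<circ>\<^sub>F D) (dual_fun C L \<circ>\<^sub>F T) \<phi>"
  proof (rule nat_transI)
    show "is_functor (op_cat E) C (T \<circ>\<^sub>F D)"
      using is_functor_comp[OF is_functor_op_left[OF DE D.C.category_axioms] T] .
    show "is_functor (op_cat E) C (dual_fun C L \<circ>\<^sub>F T)"
      using is_functor_op_left[OF is_functor_comp[OF T is_functor_dual_fun[OF L]] category_axioms] .
    fix f assume "f \<in> arr (op_cat E)"
    then have [simp]: "f \<in> arr E" by simp
    have "ev C (fob T (src E f)) L \<cdot> ((\<phi> (src E f) \<cdot> far T (far D f)) \<boxtimes> ide C (fob T (src E f)))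
      = ev C (fob T (tgt E f)) L \<cdot> (\<phi> (tgt E f) \<boxtimes> far T f)"
      by (simp add: p_reassoc p_right dinatural)
    also have "\<dots> = ev C (fob T (src E f)) L \<cdot>
      ((\<lbrace>far T f, ide C L\<rbrace> \<cdot> \<phi> (tgt E f)) \<boxtimes> ide C (fob T (src E f)))"
      using ev_ihom_left_comp[of "far T f" L "\<phi> (tgt E f)"] by simp
    finally have "\<phi> (src E f) \<cdot> far T (far D f) = \<lbrace>far T f, ide C L\<rbrace> \<cdot> \<phi> (tgt E f)"
      by (rule ev_eqI) simp_all
    then show "\<phi> (tgt (op_cat E) f) \<cdot> far (T \<circ>\<^sub>F D) f
      = far (dual_fun C L \<circ>\<^sub>F T) f \<cdot> \<phi> (src (op_cat E) f)"
      by simp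
  qed simp_all
  moreover have "\<phi> (fob D A) \<cdot> far T (\<omega> A) = \<lbrace>\<phi> A, ide C L\<rbrace> \<cdot> bidual C L (fob T A)"
    if [simp]: "A \<in> obj E" for A
  proof (rule ev_eqI)
    \<comment> \<open>By \<open>symmetric\<close> the left side is the pairing of \<open>A\<close>
      after the symmetry. Written through \<open>\<phi> A\<close> this is \<open>evr\<close> with
      \<open>\<phi> A\<close> in its second slot, which is what \<open>ev_ihom_bidual\<close> gives
      for the right side.\<close>
    have "ev C (fob T (fob D A)) L \<cdot> ((\<phi> (fob D A) \<cdot> far T (\<omega> A)) \<boxtimes> ide C (fob T (fob D A)))
      = evr C (fob T A) L \<cdot> (ide C (fob T A) \<boxtimes> \<phi> A)"
      using cmp_reassoc[OF p] by (simp add: p_reassoc symmetric evr_tensor)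
    also have "\<dots> = ev C (fob T (fob D A)) L \<cdot>
      ((\<lbrace>\<phi> A, ide C L\<rbrace> \<cdot> bidual C L (fob T A)) \<boxtimes> ide C (fob T (fob D A)))"
      using ev_ihom_bidual[of "\<phi> A" "fob T A" L] by simp
    finally show "ev C (fob T (fob D A)) L \<cdot>
      ((\<phi> (fob D A) \<cdot> far T (\<omega> A)) \<boxtimes> ide C (fob T (fob D A))) = \<dots>" .
  qed simp_all
  ultimately show ?thesis
    using E T category_with_duality_dual_cat_of[OF L]
    by (simp add: duality_preserving_def dual_cat_of_def)
qed

end

section \<open>Operations on duality preserving functors\<close>

lemma comp_prod: "(G \<times>\<^sub>F G') \<circ>\<^sub>F (H \<times>\<^sub>F H') = (G \<circ>\<^sub>F H) \<times>\<^sub>F (G' \<circ>\<^sub>F H')"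
  by (auto simp: comp_fun_def prod_fun_def map_prod.comp)

lemma category_with_duality_prod:
  assumes "category_with_duality (C, D, \<omega>)" "category_with_duality (C', D', \<omega>')"
  shows "category_with_duality ((C, D, \<omega>) \<times>\<^sub>D (C', D', \<omega>'))"
proof -
  have D: "is_functor C (op_cat C) D" "nat_trans C C id_fun (D \<circ>\<^sub>F D) \<omega>"
    and D': "is_functor C' (op_cat C') D'" "nat_trans C' C' id_fun (D' \<circ>\<^sub>F D') \<omega>'"
    and tri: "\<forall>A\<in>obj C. far D (\<omega> A) \<cdot>\<^bsub>C\<^esub> \<omega> (fob D A) = ide C (fob D A)"
      "\<forall>A\<in>obj C'. far D' (\<omega>' A) \<cdot>\<^bsub>C'\<^esub> \<omega>' (fob D' A) = ide C' (fob D' A)"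
    using assms by (auto simp: category_with_duality_def)
  interpret \<omega>: nat_trans C C id_fun "D \<circ>\<^sub>F D" \<omega> by fact
  interpret \<omega>': nat_trans C' C' id_fun "D' \<circ>\<^sub>F D'" \<omega>' by fact
  have DD: "is_functor (C \<times>\<^sub>C C') (op_cat (C \<times>\<^sub>C C')) (D \<times>\<^sub>F D')"
    using is_functor_prod[OF D(1) D'(1)] by (simp add: op_cat_prod)
  have cat: "category (C \<times>\<^sub>C C')"
    by (simp add: category_prod \<omega>.F.C.category_axioms \<omega>'.F.C.category_axioms)
  have "nat_trans (C \<times>\<^sub>C C') (C \<times>\<^sub>C C') id_fun ((D \<times>\<^sub>F D') \<circ>\<^sub>F (D \<times>\<^sub>F D')) (\<omega> \<times>\<^sub>T \<omega>')"
  proof (rule nat_transI)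
    show "is_functor (C \<times>\<^sub>C C') (C \<times>\<^sub>C C') ((D \<times>\<^sub>F D') \<circ>\<^sub>F (D \<times>\<^sub>F D'))"
      using is_functor_comp[OF DD is_functor_op_left[OF DD cat]] .
  qed (use cat \<omega>.natural \<omega>'.natural in \<open>auto simp: prod_trans_def is_functor_id\<close>)
  then show ?thesis
    using DD tri by (auto simp: category_with_duality_def dual_cat_prod_def prod_trans_def)
qed

text \<open>Both sides of the duality square reduce to the biduality map, as \<open>D\<close>
  preserves identities.\<close>

lemma duality_preserving_id:
  assumes "category_with_duality X"
  shows "duality_preserving X X (dp_id X)"
proof -
  obtain C D \<omega> where X: "X = (C, D, \<omega>)" by (rule prod_cases3)
  have D: "is_functor C (op_cat C) D" and n: "nat_trans C C id_fun (D \<circ>\<^sub>F D) \<omega>"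
    using assms unfolding X by (auto simp: category_with_duality_def)
  interpret D: is_functor C "op_cat C" D by fact
  interpret \<omega>: nat_trans C C id_fun "D \<circ>\<^sub>F D" \<omega> by fact
  have D_sel [simp]: "A \<in> obj C \<Longrightarrow> fob D A \<in> obj C" "f \<in> arr C \<Longrightarrow> far D f \<in> arr C"
    "f \<in> arr C \<Longrightarrow> src C (far D f) = fob D (tgt C f)"
    "f \<in> arr C \<Longrightarrow> tgt C (far D f) = fob D (src C f)" "A \<in> obj C \<Longrightarrow> far D (ide C A) = ide C (fob D A)" for A f
    using D.far_sel(1,5)[of A] D.far_sel(2-4)[of f] by simp_all
  have "is_functor (op_cat C) C (id_fun \<circ>\<^sub>F D)" "is_functor (op_cat C) C (D \<circ>\<^sub>F id_fun)"
    using is_functor_op_left[OF D] by (simp_all add: id_fun_def comp_fun_def is_functor_def is_functor_axioms_def D.C.category_axioms)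
  then have "nat_trans (op_cat C) C (id_fun \<circ>\<^sub>F D) (D \<circ>\<^sub>F id_fun) (\<lambda>A. ide C (fob D A))"
    by (rule nat_transI) simp_all
  then show ?thesis
    using assms unfolding X by (auto simp: duality_preserving_def dp_id_def is_functor_id D.C.category_axioms)
qed

text \<open>All conditions split into components, because \<open>op_cat_prod\<close> identifies the
  opposite of a product with the product of the opposites.\<close>

lemma duality_preserving_prod:
  assumes "duality_preserving X Y P" "duality_preserving X' Y' P'"
  shows "duality_preserving (X \<times>\<^sub>D X') (Y \<times>\<^sub>D Y') (P \<times>\<^sub>D\<^sub>P P')"
proof -
  obtain C\<^sub>1 D\<^sub>1 \<omega>\<^sub>1 C\<^sub>2 D\<^sub>2 \<omega>\<^sub>2 F \<phi>
    where P: "X = (C\<^sub>1, D\<^sub>1, \<omega>\<^sub>1)" "Y = (C\<^sub>2, D\<^sub>2, \<omega>\<^sub>2)" "P = (F, \<phi>)"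
    by (metis prod_cases3 surj_pair)
  obtain C\<^sub>1' D\<^sub>1' \<omega>\<^sub>1' C\<^sub>2' D\<^sub>2' \<omega>\<^sub>2' F' \<phi>'
    where P': "X' = (C\<^sub>1', D\<^sub>1', \<omega>\<^sub>1')" "Y' = (C\<^sub>2', D\<^sub>2', \<omega>\<^sub>2')" "P' = (F', \<phi>')"
    by (metis prod_cases3 surj_pair)
  have cwd: "category_with_duality (C\<^sub>1, D\<^sub>1, \<omega>\<^sub>1)" "category_with_duality (C\<^sub>2, D\<^sub>2, \<omega>\<^sub>2)"
    "category_with_duality (C\<^sub>1', D\<^sub>1', \<omega>\<^sub>1')" "category_with_duality (C\<^sub>2', D\<^sub>2', \<omega>\<^sub>2')"
    and F: "is_functor C\<^sub>1 C\<^sub>2 F" "nat_trans (op_cat C\<^sub>1) C\<^sub>2 (F \<circ>\<^sub>F D\<^sub>1) (D\<^sub>2 \<circ>\<^sub>F F) \<phi>"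
    and F': "is_functor C\<^sub>1' C\<^sub>2' F'" "nat_trans (op_cat C\<^sub>1') C\<^sub>2' (F' \<circ>\<^sub>F D\<^sub>1') (D\<^sub>2' \<circ>\<^sub>F F') \<phi>'"
    and dual: "\<forall>A\<in>obj C\<^sub>1. \<phi> (fob D\<^sub>1 A) \<cdot>\<^bsub>C\<^sub>2\<^esub> far F (\<omega>\<^sub>1 A) = far D\<^sub>2 (\<phi> A) \<cdot>\<^bsub>C\<^sub>2\<^esub> \<omega>\<^sub>2 (fob F A)"
      "\<forall>A\<in>obj C\<^sub>1'. \<phi>' (fob D\<^sub>1' A) \<cdot>\<^bsub>C\<^sub>2'\<^esub> far F' (\<omega>\<^sub>1' A) = far D\<^sub>2' (\<phi>' A) \<cdot>\<^bsub>C\<^sub>2'\<^esub> \<omega>\<^sub>2' (fob F' A)"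
    using assms unfolding P P' by (auto simp: duality_preserving_def)
  interpret \<phi>: nat_trans "op_cat C\<^sub>1" C\<^sub>2 "F \<circ>\<^sub>F D\<^sub>1" "D\<^sub>2 \<circ>\<^sub>F F" \<phi> by fact
  interpret \<phi>': nat_trans "op_cat C\<^sub>1'" C\<^sub>2' "F' \<circ>\<^sub>F D\<^sub>1'" "D\<^sub>2' \<circ>\<^sub>F F'" \<phi>' by fact
  have "nat_trans (op_cat (C\<^sub>1 \<times>\<^sub>C C\<^sub>1')) (C\<^sub>2 \<times>\<^sub>C C\<^sub>2') ((F \<times>\<^sub>F F') \<circ>\<^sub>F (D\<^sub>1 \<times>\<^sub>F D\<^sub>1'))
    ((D\<^sub>2 \<times>\<^sub>F D\<^sub>2') \<circ>\<^sub>F (F \<times>\<^sub>F F')) (\<phi> \<times>\<^sub>T \<phi>')"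
    unfolding comp_prod op_cat_prod using \<phi>.natural \<phi>'.natural
    by (intro nat_transI is_functor_prod \<phi>.F.is_functor_axioms \<phi>'.F.is_functor_axioms
        \<phi>.G.is_functor_axioms \<phi>'.G.is_functor_axioms) (auto simp: prod_trans_def)
  moreover have "is_functor (C\<^sub>1 \<times>\<^sub>C C\<^sub>1') (C\<^sub>2 \<times>\<^sub>C C\<^sub>2') (F \<times>\<^sub>F F')"
    using F(1) F'(1) by (rule is_functor_prod)
  moreover note category_with_duality_prod[OF cwd(1,3)] category_with_duality_prod[OF cwd(2,4)]
  ultimately show ?thesis
    unfolding P P' duality_preserving_def dual_cat_prod_def dp_prod_def using dual by (auto simp: prod_trans_def)
qed

text \<open>The duality square is pasted from three pieces: \<open>F'\<close> applied to the square
  of \<open>\<phi>\<close>, naturality of \<open>\<phi>'\<close> at the arrow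
  \<open>\<phi> A\<close>, and the square of \<open>\<phi>'\<close> at \<open>fob F A\<close>. The
  first component of \<open>Z\<close> supplies the category in which \<open>dp_comp\<close>
  composes.\<close>

lemma duality_preserving_comp:
  assumes "duality_preserving X Y P" "duality_preserving Y Z P'"
  shows "duality_preserving X Z (dp_comp (fst Z) P' P)"
proof -
  obtain C\<^sub>1 D\<^sub>1 \<omega>\<^sub>1 C\<^sub>2 D\<^sub>2 \<omega>\<^sub>2 C\<^sub>3 D\<^sub>3 \<omega>\<^sub>3
    where "X = (C\<^sub>1, D\<^sub>1, \<omega>\<^sub>1)" "Y = (C\<^sub>2, D\<^sub>2, \<omega>\<^sub>2)" "Z = (C\<^sub>3, D\<^sub>3, \<omega>\<^sub>3)"
    by (metis prod_cases3)
  moreover obtain F \<phi> F' \<phi>' where "P = (F, \<phi>)" "P' = (F', \<phi>')" by (cases P, cases P')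
  ultimately have P: "X = (C\<^sub>1, D\<^sub>1, \<omega>\<^sub>1)" "Y = (C\<^sub>2, D\<^sub>2, \<omega>\<^sub>2)" "Z = (C\<^sub>3, D\<^sub>3, \<omega>\<^sub>3)"
    "P = (F, \<phi>)" "P' = (F', \<phi>')" by auto
  have cwd: "category_with_duality (C\<^sub>1, D\<^sub>1, \<omega>\<^sub>1)" "category_with_duality (C\<^sub>2, D\<^sub>2, \<omega>\<^sub>2)"
    "category_with_duality (C\<^sub>3, D\<^sub>3, \<omega>\<^sub>3)"
    and F: "is_functor C\<^sub>1 C\<^sub>2 F" "nat_trans (op_cat C\<^sub>1) C\<^sub>2 (F \<circ>\<^sub>F D\<^sub>1) (D\<^sub>2 \<circ>\<^sub>F F) \<phi>"
    and F': "is_functor C\<^sub>2 C\<^sub>3 F'" "nat_trans (op_cat C\<^sub>2) C\<^sub>3 (F' \<circ>\<^sub>F D\<^sub>2) (D\<^sub>3 \<circ>\<^sub>F F') \<phi>'"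
    and dual: "\<And>A. A\<in>obj C\<^sub>1 \<Longrightarrow> \<phi> (fob D\<^sub>1 A) \<cdot>\<^bsub>C\<^sub>2\<^esub> far F (\<omega>\<^sub>1 A) = far D\<^sub>2 (\<phi> A) \<cdot>\<^bsub>C\<^sub>2\<^esub> \<omega>\<^sub>2 (fob F A)"
      "\<And>A. A\<in>obj C\<^sub>2 \<Longrightarrow> \<phi>' (fob D\<^sub>2 A) \<cdot>\<^bsub>C\<^sub>3\<^esub> far F' (\<omega>\<^sub>2 A) = far D\<^sub>3 (\<phi>' A) \<cdot>\<^bsub>C\<^sub>3\<^esub> \<omega>\<^sub>3 (fob F' A)"
    using assms unfolding P by (auto simp: duality_preserving_def)
  have D: "is_functor C\<^sub>1 (op_cat C\<^sub>1) D\<^sub>1" "is_functor C\<^sub>2 (op_cat C\<^sub>2) D\<^sub>2" "is_functor C\<^sub>3 (op_cat C\<^sub>3) D\<^sub>3"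
    and \<omega>: "nat_trans C\<^sub>1 C\<^sub>1 id_fun (D\<^sub>1 \<circ>\<^sub>F D\<^sub>1) \<omega>\<^sub>1" "nat_trans C\<^sub>2 C\<^sub>2 id_fun (D\<^sub>2 \<circ>\<^sub>F D\<^sub>2) \<omega>\<^sub>2"
      "nat_trans C\<^sub>3 C\<^sub>3 id_fun (D\<^sub>3 \<circ>\<^sub>F D\<^sub>3) \<omega>\<^sub>3"
    using cwd by (auto simp: category_with_duality_def)
  interpret F: is_functor C\<^sub>1 C\<^sub>2 F by fact
  interpret F': is_functor C\<^sub>2 C\<^sub>3 F' by fact
  interpret \<phi>: nat_trans "op_cat C\<^sub>1" C\<^sub>2 "F \<circ>\<^sub>F D\<^sub>1" "D\<^sub>2 \<circ>\<^sub>F F" \<phi> by fact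
  interpret \<phi>': nat_trans "op_cat C\<^sub>2" C\<^sub>3 "F' \<circ>\<^sub>F D\<^sub>2" "D\<^sub>3 \<circ>\<^sub>F F'" \<phi>' by fact
  interpret D\<^sub>1: is_functor C\<^sub>1 "op_cat C\<^sub>1" D\<^sub>1 by fact
  interpret D\<^sub>2: is_functor C\<^sub>2 "op_cat C\<^sub>2" D\<^sub>2 by fact
  interpret D\<^sub>3: is_functor C\<^sub>3 "op_cat C\<^sub>3" D\<^sub>3 by fact
  interpret \<omega>\<^sub>1: nat_trans C\<^sub>1 C\<^sub>1 id_fun "D\<^sub>1 \<circ>\<^sub>F D\<^sub>1" \<omega>\<^sub>1 by fact
  interpret \<omega>\<^sub>2: nat_trans C\<^sub>2 C\<^sub>2 id_fun "D\<^sub>2 \<circ>\<^sub>F D\<^sub>2" \<omega>\<^sub>2 by fact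
  interpret \<omega>\<^sub>3: nat_trans C\<^sub>3 C\<^sub>3 id_fun "D\<^sub>3 \<circ>\<^sub>F D\<^sub>3" \<omega>\<^sub>3 by fact
  have [simp]: "A \<in> obj C\<^sub>1 \<Longrightarrow> fob D\<^sub>1 A \<in> obj C\<^sub>1" "f \<in> arr C\<^sub>1 \<Longrightarrow> far D\<^sub>1 f \<in> arr C\<^sub>1"
    "f \<in> arr C\<^sub>1 \<Longrightarrow> src C\<^sub>1 (far D\<^sub>1 f) = fob D\<^sub>1 (tgt C\<^sub>1 f)"
    "f \<in> arr C\<^sub>1 \<Longrightarrow> tgt C\<^sub>1 (far D\<^sub>1 f) = fob D\<^sub>1 (src C\<^sub>1 f)" for A f
    using D\<^sub>1.far_sel(1)[of A] D\<^sub>1.far_sel(2-4)[of f] by simp_all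
  have [simp]: "A \<in> obj C\<^sub>2 \<Longrightarrow> fob D\<^sub>2 A \<in> obj C\<^sub>2" "f \<in> arr C\<^sub>2 \<Longrightarrow> far D\<^sub>2 f \<in> arr C\<^sub>2"
    "f \<in> arr C\<^sub>2 \<Longrightarrow> src C\<^sub>2 (far D\<^sub>2 f) = fob D\<^sub>2 (tgt C\<^sub>2 f)"
    "f \<in> arr C\<^sub>2 \<Longrightarrow> tgt C\<^sub>2 (far D\<^sub>2 f) = fob D\<^sub>2 (src C\<^sub>2 f)" for A f
    using D\<^sub>2.far_sel(1)[of A] D\<^sub>2.far_sel(2-4)[of f] by simp_all
  have D3_sel [simp]: "A \<in> obj C\<^sub>3 \<Longrightarrow> fob D\<^sub>3 A \<in> obj C\<^sub>3" "f \<in> arr C\<^sub>3 \<Longrightarrow> far D\<^sub>3 f \<in> arr C\<^sub>3"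
    "f \<in> arr C\<^sub>3 \<Longrightarrow> src C\<^sub>3 (far D\<^sub>3 f) = fob D\<^sub>3 (tgt C\<^sub>3 f)"
    "f \<in> arr C\<^sub>3 \<Longrightarrow> tgt C\<^sub>3 (far D\<^sub>3 f) = fob D\<^sub>3 (src C\<^sub>3 f)" for A f
    using D\<^sub>3.far_sel(1)[of A] D\<^sub>3.far_sel(2-4)[of f] by simp_all
  have [simp]: "A \<in> obj C\<^sub>1 \<Longrightarrow> \<phi> A \<in> arr C\<^sub>2" "A \<in> obj C\<^sub>1 \<Longrightarrow> src C\<^sub>2 (\<phi> A) = fob F (fob D\<^sub>1 A)"
    "A \<in> obj C\<^sub>1 \<Longrightarrow> tgt C\<^sub>2 (\<phi> A) = fob D\<^sub>2 (fob F A)" for A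
    using \<phi>.component_sel[of A] by simp_all
  have [simp]: "A \<in> obj C\<^sub>2 \<Longrightarrow> \<phi>' A \<in> arr C\<^sub>3" "A \<in> obj C\<^sub>2 \<Longrightarrow> src C\<^sub>3 (\<phi>' A) = fob F' (fob D\<^sub>2 A)"
    "A \<in> obj C\<^sub>2 \<Longrightarrow> tgt C\<^sub>3 (\<phi>' A) = fob D\<^sub>3 (fob F' A)" for A
    using \<phi>'.component_sel[of A] by simp_all
  have \<phi>_nat: "\<phi> (src C\<^sub>1 f) \<cdot>\<^bsub>C\<^sub>2\<^esub> far F (far D\<^sub>1 f) = far D\<^sub>2 (far F f) \<cdot>\<^bsub>C\<^sub>2\<^esub> \<phi> (tgt C\<^sub>1 f)" if "f \<in> arr C\<^sub>1" for f
    using \<phi>.natural[of f] that by simp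
  have \<phi>'_nat: "\<phi>' (src C\<^sub>2 f) \<cdot>\<^bsub>C\<^sub>3\<^esub> far F' (far D\<^sub>2 f) = far D\<^sub>3 (far F' f) \<cdot>\<^bsub>C\<^sub>3\<^esub> \<phi>' (tgt C\<^sub>2 f)" if "f \<in> arr C\<^sub>2" for f
    using \<phi>'.natural[of f] that by simp
  have "nat_trans (op_cat C\<^sub>1) C\<^sub>3 ((F' \<circ>\<^sub>F F) \<circ>\<^sub>F D\<^sub>1) (D\<^sub>3 \<circ>\<^sub>F (F' \<circ>\<^sub>F F))
    (\<lambda>A. \<phi>' (fob F A) \<cdot>\<^bsub>C\<^sub>3\<^esub> far F' (\<phi> A))"
  proof (rule nat_transI)
    show "is_functor (op_cat C\<^sub>1) C\<^sub>3 ((F' \<circ>\<^sub>F F) \<circ>\<^sub>F D\<^sub>1)"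
      using is_functor_comp[OF is_functor_op_left[OF D(1) F.C.category_axioms] is_functor_comp[OF F(1) F'(1)]] .
    show "is_functor (op_cat C\<^sub>1) C\<^sub>3 (D\<^sub>3 \<circ>\<^sub>F (F' \<circ>\<^sub>F F))"
      using is_functor_op_left[OF is_functor_comp[OF is_functor_comp[OF F(1) F'(1)] D(3)] F'.D.category_axioms] .
    fix f assume "f \<in> arr (op_cat C\<^sub>1)"
    then have [simp]: "f \<in> arr C\<^sub>1" by simp
    have "\<phi>' (fob F (src C\<^sub>1 f)) \<cdot>\<^bsub>C\<^sub>3\<^esub> far F' (\<phi> (src C\<^sub>1 f)) \<cdot>\<^bsub>C\<^sub>3\<^esub> far F' (far F (far D\<^sub>1 f))
      = \<phi>' (fob F (src C\<^sub>1 f)) \<cdot>\<^bsub>C\<^sub>3\<^esub> far F' (far D\<^sub>2 (far F f)) \<cdot>\<^bsub>C\<^sub>3\<^esub> far F' (\<phi> (tgt C\<^sub>1 f))"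
      by (simp add: F'.far_comp[symmetric] \<phi>_nat)
    also have "\<dots> = far D\<^sub>3 (far F' (far F f)) \<cdot>\<^bsub>C\<^sub>3\<^esub> \<phi>' (fob F (tgt C\<^sub>1 f)) \<cdot>\<^bsub>C\<^sub>3\<^esub> far F' (\<phi> (tgt C\<^sub>1 f))"
      using F'.D.cmp_reassoc2[OF \<phi>'_nat[of "far F f"]] by simp
    finally show "(\<phi>' (fob F (tgt (op_cat C\<^sub>1) f)) \<cdot>\<^bsub>C\<^sub>3\<^esub> far F' (\<phi> (tgt (op_cat C\<^sub>1) f))) \<cdot>\<^bsub>C\<^sub>3\<^esub>
        far ((F' \<circ>\<^sub>F F) \<circ>\<^sub>F D\<^sub>1) f
      = far (D\<^sub>3 \<circ>\<^sub>F (F' \<circ>\<^sub>F F)) f \<cdot>\<^bsub>C\<^sub>3\<^esub>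
        \<phi>' (fob F (src (op_cat C\<^sub>1) f)) \<cdot>\<^bsub>C\<^sub>3\<^esub> far F' (\<phi> (src (op_cat C\<^sub>1) f))"
      by simp
  qed simp_all
  moreover have "(\<phi>' (fob F (fob D\<^sub>1 A)) \<cdot>\<^bsub>C\<^sub>3\<^esub> far F' (\<phi> (fob D\<^sub>1 A))) \<cdot>\<^bsub>C\<^sub>3\<^esub> far F' (far F (\<omega>\<^sub>1 A))
    = far D\<^sub>3 (\<phi>' (fob F A) \<cdot>\<^bsub>C\<^sub>3\<^esub> far F' (\<phi> A)) \<cdot>\<^bsub>C\<^sub>3\<^esub> \<omega>\<^sub>3 (fob F' (fob F A))"
    if [simp]: "A \<in> obj C\<^sub>1" for A
  proof -
    have "(\<phi>' (fob F (fob D\<^sub>1 A)) \<cdot>\<^bsub>C\<^sub>3\<^esub> far F' (\<phi> (fob D\<^sub>1 A))) \<cdot>\<^bsub>C\<^sub>3\<^esub> far F' (far F (\<omega>\<^sub>1 A))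
      = \<phi>' (fob F (fob D\<^sub>1 A)) \<cdot>\<^bsub>C\<^sub>3\<^esub> far F' (far D\<^sub>2 (\<phi> A)) \<cdot>\<^bsub>C\<^sub>3\<^esub> far F' (\<omega>\<^sub>2 (fob F A))"
      by (simp add: F'.far_comp[symmetric] dual)
    also have "\<dots> = far D\<^sub>3 (far F' (\<phi> A)) \<cdot>\<^bsub>C\<^sub>3\<^esub> \<phi>' (fob D\<^sub>2 (fob F A)) \<cdot>\<^bsub>C\<^sub>3\<^esub> far F' (\<omega>\<^sub>2 (fob F A))"
      using F'.D.cmp_reassoc2[OF \<phi>'_nat[of "\<phi> A"]] by simp
    also have "\<dots> = far D\<^sub>3 (far F' (\<phi> A)) \<cdot>\<^bsub>C\<^sub>3\<^esub> far D\<^sub>3 (\<phi>' (fob F A)) \<cdot>\<^bsub>C\<^sub>3\<^esub> \<omega>\<^sub>3 (fob F' (fob F A))"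
      by (simp add: dual)
    \<comment> \<open>The order of the factors agrees because the last duality functor is
      contravariant.\<close>
    also have "\<dots> = far D\<^sub>3 (\<phi>' (fob F A) \<cdot>\<^bsub>C\<^sub>3\<^esub> far F' (\<phi> A)) \<cdot>\<^bsub>C\<^sub>3\<^esub> \<omega>\<^sub>3 (fob F' (fob F A))"
      using D\<^sub>3.far_comp[of "far F' (\<phi> A)" "\<phi>' (fob F A)"] by simp
    finally show ?thesis .
  qed
  ultimately show ?thesis
    using cwd is_functor_comp[OF F(1) F'(1)] by (simp add: P dp_comp_def duality_preserving_def)
qed

section \<open>The tensor product as a duality preserving functor\<close>

context symmetric_monoidal_closed
begin

text \<open>The composites defining \<tau>, \<beta> and \<mu> have this shape: two arrows applied
  inside the internal Hom after a coevaluation. Hence each of them is a transpose, and its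
  evaluation can be read off.\<close>

lemma ihom_ihom_coev:
  assumes "X \<in> obj C" "A \<in> obj C" "f \<in> arr C" "g \<in> arr C" "src C f = A \<otimes> X" "src C g = tgt C f"
  shows "\<lbrace>ide C X, g\<rbrace> \<cdot> \<lbrace>ide C X, f\<rbrace> \<cdot> coev C X A = adj_transpose C A X (g \<cdot> f)"
  using assms by (simp add: adj_transpose_def cmp_reassoc[OF ihom_comp])

lemma tau_eq:
  assumes "K \<in> obj C" "M \<in> obj C" "A \<in> obj C" "B \<in> obj C"
  shows "tau C K M A B = adj_transpose C (\<lblot>A, K\<rblot> \<otimes> \<lblot>B, M\<rblot>) (A \<otimes> B)
    ((ev C A K \<boxtimes> ev C B M) \<cdot> interchange C \<lblot>A, K\<rblot> \<lblot>B, M\<rblot> A B)"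
  using assms by (simp add: tau_def ihom_ihom_coev)

lemma tau_sel [simp]:
  assumes "K \<in> obj C" "M \<in> obj C" "A \<in> obj C" "B \<in> obj C"
  shows "tau C K M A B \<in> arr C" "src C (tau C K M A B) = \<lblot>A, K\<rblot> \<otimes> \<lblot>B, M\<rblot>"
    "tgt C (tau C K M A B) = \<lblot>A \<otimes> B, K \<otimes> M\<rblot>"
  using assms by (simp_all add: tau_eq)

lemma ev_tau:
  assumes "K \<in> obj C" "M \<in> obj C" "A \<in> obj C" "B \<in> obj C"
  shows "ev C (A \<otimes> B) (K \<otimes> M) \<cdot> (tau C K M A B \<boxtimes> ide C (A \<otimes> B))
    = (ev C A K \<boxtimes> ev C B M) \<cdot> interchange C \<lblot>A, K\<rblot> \<lblot>B, M\<rblot> A B"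
  using assms ev_adj_transpose[of "\<lblot>A, K\<rblot> \<otimes> \<lblot>B, M\<rblot>" "A \<otimes> B"
    "(ev C A K \<boxtimes> ev C B M) \<cdot> interchange C \<lblot>A, K\<rblot> \<lblot>B, M\<rblot> A B"] by (simp add: tau_eq)

text \<open>The pairing of \<tau> is the tensor product of two evaluations after the interchange.
  Naturality of the interchange separates the two factors, where dinaturality is that of evaluation;
  the symmetry condition is \<open>interchange_symm\<close>.\<close>

lemma duality_preserving_dp_tensor:
  assumes [simp]: "K \<in> obj C" "M \<in> obj C"
  shows "duality_preserving (dual_cat_of C K \<times>\<^sub>D dual_cat_of C M) (dual_cat_of C (K \<otimes> M)) (dp_tensor C K M)"
proof -
  have cwd: "category_with_duality (C, dual_fun C K, bidual C K)"
    "category_with_duality (C, dual_fun C M, bidual C M)"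
    using category_with_duality_dual_cat_of[of K] category_with_duality_dual_cat_of[of M]
    by (simp_all add: dual_cat_of_def)
  show ?thesis
    unfolding dp_tensor_def dual_cat_of_def[of C K] dual_cat_of_def[of C M] dual_cat_prod_def prod.case
  proof (rule duality_preserving_pairing)
    show "category_with_duality (C \<times>\<^sub>C C, dual_fun C K \<times>\<^sub>F dual_fun C M, bidual C K \<times>\<^sub>T bidual C M)"
      using category_with_duality_prod[OF cwd] by (simp add: dual_cat_prod_def)
    show "ev C (fob (tensor C) X) (K \<otimes> M) \<cdot> ((case X of (A, B) \<Rightarrow> tau C K M A B) \<boxtimes> ide C (fob (tensor C) X))
      = (case X of (A, B) \<Rightarrow> (ev C A K \<boxtimes> ev C B M) \<cdot> interchange C \<lblot>A, K\<rblot> \<lblot>B, M\<rblot> A B)"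
      if "X \<in> obj (C \<times>\<^sub>C C)" for X
      using that by (auto simp: ev_tau)
    fix h assume "h \<in> arr (C \<times>\<^sub>C C)"
    then obtain f g where h: "h = (f, g)" and [simp]: "f \<in> arr C" "g \<in> arr C" by auto
    \<comment> \<open>Both sides of the dinaturality condition meet at this interchange, with the
      duals taken at the targets of \<open>f\<close> and \<open>g\<close> and the remaining factors
      at their sources.\<close>
    let ?i = "interchange C \<lblot>tgt C f, K\<rblot> \<lblot>tgt C g, M\<rblot> (src C f) (src C g)"
    have "((ev C (src C f) K \<boxtimes> ev C (src C g) M) \<cdot> interchange C \<lblot>src C f, K\<rblot> \<lblot>src C g, M\<rblot> (src C f) (src C g)) \<cdot>
      ((\<lbrace>f, ide C K\<rbrace> \<boxtimes> \<lbrace>g, ide C M\<rbrace>) \<boxtimes> ide C (src C f \<otimes> src C g))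
      = ((ev C (src C f) K \<cdot> (\<lbrace>f, ide C K\<rbrace> \<boxtimes> ide C (src C f))) \<boxtimes>
         (ev C (src C g) M \<cdot> (\<lbrace>g, ide C M\<rbrace> \<boxtimes> ide C (src C g)))) \<cdot> ?i"
      using interchange_nat[of "\<lbrace>f, ide C K\<rbrace>" "\<lbrace>g, ide C M\<rbrace>" "ide C (src C f)" "ide C (src C g)"]
      by (simp add: fuse)
    also have "\<dots> = ((ev C (tgt C f) K \<cdot> (ide C \<lblot>tgt C f, K\<rblot> \<boxtimes> f)) \<boxtimes>
         (ev C (tgt C g) M \<cdot> (ide C \<lblot>tgt C g, M\<rblot> \<boxtimes> g))) \<cdot> ?i"
      by (simp add: ev_ihom_left)
    also have "\<dots> = ((ev C (tgt C f) K \<boxtimes> ev C (tgt C g) M) \<cdot>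
        interchange C \<lblot>tgt C f, K\<rblot> \<lblot>tgt C g, M\<rblot> (tgt C f) (tgt C g)) \<cdot>
        (ide C (\<lblot>tgt C f, K\<rblot> \<otimes> \<lblot>tgt C g, M\<rblot>) \<boxtimes> (f \<boxtimes> g))"
      using interchange_nat[of "ide C \<lblot>tgt C f, K\<rblot>" "ide C \<lblot>tgt C g, M\<rblot>" f g] by (simp add: fuse)
    finally show "(case src (C \<times>\<^sub>C C) h of (A, B) \<Rightarrow> (ev C A K \<boxtimes> ev C B M) \<cdot> interchange C \<lblot>A, K\<rblot> \<lblot>B, M\<rblot> A B) \<cdot>
        (far (tensor C) (far (dual_fun C K \<times>\<^sub>F dual_fun C M) h) \<boxtimes> ide C (fob (tensor C) (src (C \<times>\<^sub>C C) h)))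
      = (case tgt (C \<times>\<^sub>C C) h of (A, B) \<Rightarrow> (ev C A K \<boxtimes> ev C B M) \<cdot> interchange C \<lblot>A, K\<rblot> \<lblot>B, M\<rblot> A B) \<cdot>
        (ide C (fob (tensor C) (fob (dual_fun C K \<times>\<^sub>F dual_fun C M) (tgt (C \<times>\<^sub>C C) h))) \<boxtimes> far (tensor C) h)"
      by (simp add: h)
  next
    fix X assume "X \<in> obj (C \<times>\<^sub>C C)"
    then obtain A B where X: "X = (A, B)" and [simp]: "A \<in> obj C" "B \<in> obj C" by auto
    let ?A = "\<lblot>A, K\<rblot>" and ?B = "\<lblot>B, M\<rblot>"
    have "((ev C ?A K \<boxtimes> ev C ?B M) \<cdot> interchange C \<lblot>?A, K\<rblot> \<lblot>?B, M\<rblot> ?A ?B) \<cdot>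
        ((bidual C K A \<boxtimes> bidual C M B) \<boxtimes> ide C (?A \<otimes> ?B))
      = (ev C ?A K \<boxtimes> ev C ?B M) \<cdot> ((bidual C K A \<boxtimes> ide C ?A) \<boxtimes> (bidual C M B \<boxtimes> ide C ?B)) \<cdot>
        interchange C A B ?A ?B"
      using interchange_nat[of "bidual C K A" "bidual C M B" "ide C ?A" "ide C ?B"] by simp
    also have "\<dots> = (evr C A K \<boxtimes> evr C B M) \<cdot> interchange C A B ?A ?B"
      by (simp add: fuse ev_bidual)
    also have "\<dots> = (ev C A K \<boxtimes> ev C B M) \<cdot> (symm C A ?A \<boxtimes> symm C B ?B) \<cdot> interchange C A B ?A ?B"
      by (simp add: evr_def fuse)
    also have "\<dots> = ((ev C A K \<boxtimes> ev C B M) \<cdot> interchange C ?A ?B A B) \<cdot> symm C (A \<otimes> B) (?A \<otimes> ?B)"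
      by (simp add: interchange_symm)
    finally show "(case fob (dual_fun C K \<times>\<^sub>F dual_fun C M) X of (A, B) \<Rightarrow>
          (ev C A K \<boxtimes> ev C B M) \<cdot> interchange C \<lblot>A, K\<rblot> \<lblot>B, M\<rblot> A B) \<cdot>
        (far (tensor C) ((bidual C K \<times>\<^sub>T bidual C M) X) \<boxtimes>
         ide C (fob (tensor C) (fob (dual_fun C K \<times>\<^sub>F dual_fun C M) X)))
      = (case X of (A, B) \<Rightarrow> (ev C A K \<boxtimes> ev C B M) \<cdot> interchange C \<lblot>A, K\<rblot> \<lblot>B, M\<rblot> A B) \<cdot>
        symm C (fob (tensor C) X) (fob (tensor C) (fob (dual_fun C K \<times>\<^sub>F dual_fun C M) X))"
      by (simp add: X prod_trans_def)
  qed (auto simp: hom_iff tensor.is_functor_axioms)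
qed

end

text \<open>Common form of \<beta>, \<zeta> and a change of dualizing object: the pairing is
  \<open>T\<close> of an evaluation, preceded by a natural and symmetric \<open>m\<close> and
  followed by an arrow \<open>\<kappa>\<close> of dualizing objects. Here \<open>m\<close> is
  respectively \<open>mult F\<close>, \<lambda> and an identity, and \<open>\<kappa>\<close> is an
  identity, \<open>\<epsilon>' K\<close> and \<iota>. The reason it holds is that
  \<open>m_nat\<close> moves an arrow inside \<open>T\<close>, where dinaturality of
  \<open>ev\<close> or the definition of the biduality map applies.\<close>

lemma duality_preserving_lax:
  assumes "symmetric_monoidal_closed C" "symmetric_monoidal_closed D" and T: "is_functor C D T"
    and m: "\<And>A B. A \<in> obj C \<Longrightarrow> B \<in> obj C \<Longrightarrow>
      m A B \<in> hom D (fob T A \<otimes>\<^bsub>D\<^esub> fob T B) (fob T (A \<otimes>\<^bsub>C\<^esub> B))"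
    and m_nat: "\<And>f g. f \<in> arr C \<Longrightarrow> g \<in> arr C \<Longrightarrow>
      m (tgt C f) (tgt C g) \<cdot>\<^bsub>D\<^esub> (far T f \<boxtimes>\<^bsub>D\<^esub> far T g) = far T (f \<boxtimes>\<^bsub>C\<^esub> g) \<cdot>\<^bsub>D\<^esub> m (src C f) (src C g)"
    and m_symm: "\<And>A B. A \<in> obj C \<Longrightarrow> B \<in> obj C \<Longrightarrow>
      far T (symm C A B) \<cdot>\<^bsub>D\<^esub> m A B = m B A \<cdot>\<^bsub>D\<^esub> symm D (fob T A) (fob T B)"
    and K [simp]: "K \<in> obj C" and \<kappa>: "\<kappa> \<in> hom D (fob T K) L"
    and \<phi>: "\<And>A. A \<in> obj C \<Longrightarrow> \<phi> A \<in> hom D (fob T \<lblot>A, K\<rblot>\<^bsub>C\<^esub>) \<lblot>fob T A, L\<rblot>\<^bsub>D\<^esub>"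
    and ev_\<phi>: "\<And>A. A \<in> obj C \<Longrightarrow> ev D (fob T A) L \<cdot>\<^bsub>D\<^esub> (\<phi> A \<boxtimes>\<^bsub>D\<^esub> ide D (fob T A))
      = \<kappa> \<cdot>\<^bsub>D\<^esub> far T (ev C A K) \<cdot>\<^bsub>D\<^esub> m \<lblot>A, K\<rblot>\<^bsub>C\<^esub> A"
  shows "duality_preserving (dual_cat_of C K) (dual_cat_of D L) (T, \<phi>)"
proof -
  interpret C: symmetric_monoidal_closed C by fact
  interpret D: symmetric_monoidal_closed D by fact
  interpret T: is_functor C D T by fact
  have [simp]: "A \<in> obj C \<Longrightarrow> B \<in> obj C \<Longrightarrow> m A B \<in> arr D"
    "A \<in> obj C \<Longrightarrow> B \<in> obj C \<Longrightarrow> src D (m A B) = fob T A \<otimes>\<^bsub>D\<^esub> fob T B"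
    "A \<in> obj C \<Longrightarrow> B \<in> obj C \<Longrightarrow> tgt D (m A B) = fob T (A \<otimes>\<^bsub>C\<^esub> B)" for A B
    using m[of A B] by (auto simp: hom_iff)
  have [simp]: "\<kappa> \<in> arr D" "src D \<kappa> = fob T K" "tgt D \<kappa> = L" using \<kappa> by (auto simp: hom_iff)
  have L [simp]: "L \<in> obj D" using D.tgt_obj[of \<kappa>] by simp
  show ?thesis
    unfolding dual_cat_of_def[of C K]
  proof (rule D.duality_preserving_pairing[OF _ T L])
    show "category_with_duality (C, dual_fun C K, bidual C K)"
      using C.category_with_duality_dual_cat_of[OF K] by (simp add: dual_cat_of_def)
    fix f assume [simp]: "f \<in> arr C"
    have "(\<kappa> \<cdot>\<^bsub>D\<^esub> far T (ev C (src C f) K) \<cdot>\<^bsub>D\<^esub> m \<lblot>src C f, K\<rblot>\<^bsub>C\<^esub> (src C f)) \<cdot>\<^bsub>D\<^esub>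
        (far T \<lbrace>f, ide C K\<rbrace>\<^bsub>C\<^esub> \<boxtimes>\<^bsub>D\<^esub> ide D (fob T (src C f)))
      = \<kappa> \<cdot>\<^bsub>D\<^esub> far T (ev C (src C f) K \<cdot>\<^bsub>C\<^esub> (\<lbrace>f, ide C K\<rbrace>\<^bsub>C\<^esub> \<boxtimes>\<^bsub>C\<^esub> ide C (src C f))) \<cdot>\<^bsub>D\<^esub>
        m \<lblot>tgt C f, K\<rblot>\<^bsub>C\<^esub> (src C f)"
      using m_nat[of "\<lbrace>f, ide C K\<rbrace>\<^bsub>C\<^esub>" "ide C (src C f)"] by (simp add: T.far_comp)
    also have "\<dots> = \<kappa> \<cdot>\<^bsub>D\<^esub> far T (ev C (tgt C f) K) \<cdot>\<^bsub>D\<^esub>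
        far T (ide C \<lblot>tgt C f, K\<rblot>\<^bsub>C\<^esub> \<boxtimes>\<^bsub>C\<^esub> f) \<cdot>\<^bsub>D\<^esub> m \<lblot>tgt C f, K\<rblot>\<^bsub>C\<^esub> (src C f)"
      by (simp add: C.ev_ihom_left T.far_comp)
    also have "\<dots> = (\<kappa> \<cdot>\<^bsub>D\<^esub> far T (ev C (tgt C f) K) \<cdot>\<^bsub>D\<^esub> m \<lblot>tgt C f, K\<rblot>\<^bsub>C\<^esub> (tgt C f)) \<cdot>\<^bsub>D\<^esub>
        (ide D (fob T \<lblot>tgt C f, K\<rblot>\<^bsub>C\<^esub>) \<boxtimes>\<^bsub>D\<^esub> far T f)"
      using m_nat[of "ide C \<lblot>tgt C f, K\<rblot>\<^bsub>C\<^esub>" f] by simp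
    finally show "(\<kappa> \<cdot>\<^bsub>D\<^esub> far T (ev C (src C f) K) \<cdot>\<^bsub>D\<^esub> m \<lblot>src C f, K\<rblot>\<^bsub>C\<^esub> (src C f)) \<cdot>\<^bsub>D\<^esub>
        (far T (far (dual_fun C K) f) \<boxtimes>\<^bsub>D\<^esub> ide D (fob T (src C f)))
      = (\<kappa> \<cdot>\<^bsub>D\<^esub> far T (ev C (tgt C f) K) \<cdot>\<^bsub>D\<^esub> m \<lblot>tgt C f, K\<rblot>\<^bsub>C\<^esub> (tgt C f)) \<cdot>\<^bsub>D\<^esub>
        (ide D (fob T (fob (dual_fun C K) (tgt C f))) \<boxtimes>\<^bsub>D\<^esub> far T f)"
      by simp
  next
    fix A assume [simp]: "A \<in> obj C"
    let ?A = "\<lblot>A, K\<rblot>\<^bsub>C\<^esub>"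
    have "(\<kappa> \<cdot>\<^bsub>D\<^esub> far T (ev C ?A K) \<cdot>\<^bsub>D\<^esub> m \<lblot>?A, K\<rblot>\<^bsub>C\<^esub> ?A) \<cdot>\<^bsub>D\<^esub> (far T (bidual C K A) \<boxtimes>\<^bsub>D\<^esub> ide D (fob T ?A))
      = \<kappa> \<cdot>\<^bsub>D\<^esub> far T (ev C ?A K \<cdot>\<^bsub>C\<^esub> (bidual C K A \<boxtimes>\<^bsub>C\<^esub> ide C ?A)) \<cdot>\<^bsub>D\<^esub> m A ?A"
      using m_nat[of "bidual C K A" "ide C ?A"] by (simp add: T.far_comp)
    also have "\<dots> = (\<kappa> \<cdot>\<^bsub>D\<^esub> far T (ev C A K) \<cdot>\<^bsub>D\<^esub> m ?A A) \<cdot>\<^bsub>D\<^esub> symm D (fob T A) (fob T ?A)"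
      by (simp add: C.ev_bidual evr_def T.far_comp m_symm)
    finally show "(\<kappa> \<cdot>\<^bsub>D\<^esub> far T (ev C (fob (dual_fun C K) A) K) \<cdot>\<^bsub>D\<^esub>
          m \<lblot>fob (dual_fun C K) A, K\<rblot>\<^bsub>C\<^esub> (fob (dual_fun C K) A)) \<cdot>\<^bsub>D\<^esub>
        (far T (bidual C K A) \<boxtimes>\<^bsub>D\<^esub> ide D (fob T (fob (dual_fun C K) A)))
      = (\<kappa> \<cdot>\<^bsub>D\<^esub> far T (ev C A K) \<cdot>\<^bsub>D\<^esub> m \<lblot>A, K\<rblot>\<^bsub>C\<^esub> A) \<cdot>\<^bsub>D\<^esub>
        symm D (fob T A) (fob T (fob (dual_fun C K) A))"
      by simp
  qed (use \<phi> ev_\<phi> in auto)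
qed

context symmetric_monoidal_closed
begin

lemma ev_ihom_comp:
  assumes "X \<in> obj C" "g \<in> arr C" "k \<in> arr C" "tgt C k = \<lblot>X, src C g\<rblot>"
  shows "ev C X (tgt C g) \<cdot> ((\<lbrace>ide C X, g\<rbrace> \<cdot> k) \<boxtimes> ide C X) = g \<cdot> ev C X (src C g) \<cdot> (k \<boxtimes> ide C X)"
proof -
  have "ev C X (tgt C g) \<cdot> ((\<lbrace>ide C X, g\<rbrace> \<cdot> k) \<boxtimes> ide C X)
    = ev C X (tgt C g) \<cdot> (\<lbrace>ide C X, g\<rbrace> \<boxtimes> ide C X) \<cdot> (k \<boxtimes> ide C X)"
    using assms by (simp add: fuse)
  also have "\<dots> = g \<cdot> ev C X (src C g) \<cdot> (k \<boxtimes> ide C X)"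
    using assms by (subst cmp_reassoc2[OF ev_nat]) simp_all
  finally show ?thesis .
qed

lemma duality_preserving_dp_change:
  assumes [simp]: "K \<in> obj C" "M \<in> obj C" and \<iota>: "\<iota> \<in> hom C K M"
  shows "duality_preserving (dual_cat_of C K) (dual_cat_of C M) (dp_change C \<iota>)"
  unfolding dp_change_def
proof (rule duality_preserving_lax)
  have [simp]: "\<iota> \<in> arr C" "src C \<iota> = K" "tgt C \<iota> = M" using \<iota> by (auto simp: hom_iff)
  \<comment> \<open>The shape of this goal instantiates the rule: \<open>m\<close> is the identity
    of the tensor product and \<open>\<kappa>\<close> is \<open>\<iota>\<close>. This is why the
    trailing identity is written out.\<close>
  show "ev C (fob id_fun A) M \<cdot> (\<lbrace>ide C A, \<iota>\<rbrace> \<boxtimes> ide C (fob id_fun A))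
    = \<iota> \<cdot> far id_fun (ev C A K) \<cdot> ide C (\<lblot>A, K\<rblot> \<otimes> A)" if "A \<in> obj C" for A
    using ev_nat[of A \<iota>] that by simp
  show "\<lbrace>ide C A, \<iota>\<rbrace> \<in> hom C (fob id_fun \<lblot>A, K\<rblot>) \<lblot>fob id_fun A, M\<rblot>" if "A \<in> obj C" for A
    using that by (simp add: hom_iff)
qed (use \<iota> in \<open>auto simp: hom_iff is_functor_id category_axioms symmetric_monoidal_closed_axioms\<close>)

end

section \<open>Adjunctions\<close>

context adjunction
begin

lemma unit_sel [simp]:
  "A \<in> obj C \<Longrightarrow> \<eta> A \<in> arr C" "A \<in> obj C \<Longrightarrow> src C (\<eta> A) = A"
  "A \<in> obj C \<Longrightarrow> tgt C (\<eta> A) = fob R (fob L A)"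
  using unit.component_sel[of A] by simp_all

lemma counit_sel [simp]:
  "B \<in> obj D \<Longrightarrow> \<epsilon> B \<in> arr D" "B \<in> obj D \<Longrightarrow> src D (\<epsilon> B) = fob L (fob R B)"
  "B \<in> obj D \<Longrightarrow> tgt D (\<epsilon> B) = B"
  using counit.component_sel[of B] by simp_all

lemma unit_nat: "f \<in> arr C \<Longrightarrow> \<eta> (tgt C f) \<cdot>\<^bsub>C\<^esub> f = far R (far L f) \<cdot>\<^bsub>C\<^esub> \<eta> (src C f)"
  using unit.natural[of f] by simp

lemma counit_nat: "g \<in> arr D \<Longrightarrow> \<epsilon> (tgt D g) \<cdot>\<^bsub>D\<^esub> far L (far R g) = g \<cdot>\<^bsub>D\<^esub> \<epsilon> (src D g)"
  using counit.natural[of g] by simp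

text \<open>Naturality of the counit at \<open>h\<close>, then the left triangle. The morphisms
  \<lambda>, \<pi> and \<theta> are all of the form \<open>R h\<close> after a unit, so this rule
  computes their transposes.\<close>

lemma counit_transpose:
  assumes [simp]: "A \<in> obj C" "h \<in> arr D" "src D h = fob L A"
  shows "\<epsilon> (tgt D h) \<cdot>\<^bsub>D\<^esub> far L (far R h \<cdot>\<^bsub>C\<^esub> \<eta> A) = h"
  using L.D.cmp_reassoc2[OF counit_nat[of h]] by (simp add: L.far_comp triangle_left)

text \<open>An arrow into \<open>fob R B\<close> is recovered from its transpose by naturality of
  the unit and the right triangle. Identities between arrows into direct images are checked in this
  way over the other category.\<close>

lemma counit_eqI:
  assumes "\<epsilon> B \<cdot>\<^bsub>D\<^esub> far L f = \<epsilon> B \<cdot>\<^bsub>D\<^esub> far L g" "f \<in> arr C" "g \<in> arr C" "B \<in> obj D"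
    "src C f = src C g" "tgt C f = fob R B" "tgt C g = fob R B"
  shows "f = g"
proof -
  have "far R (\<epsilon> B \<cdot>\<^bsub>D\<^esub> far L h) \<cdot>\<^bsub>C\<^esub> \<eta> (src C h) = h"
    if [simp]: "h \<in> arr C" "tgt C h = fob R B" for h
    using L.C.cmp_reassoc[OF triangle_right[OF assms(4)], of h] unit_nat[of h, symmetric] assms(4)
    by (simp add: R.far_comp)
  from this[of f] this[of g] show ?thesis using assms by metis
qed

end

section \<open>Direct images and the projection morphism\<close>

locale direct_image =
  C1: symmetric_monoidal_closed C\<^sub>1 + C2: symmetric_monoidal_closed C\<^sub>2 +
  F: symmetric_monoidal_functor C\<^sub>1 C\<^sub>2 F + FG: adjunction C\<^sub>1 C\<^sub>2 F G \<eta> \<epsilon>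
  for C\<^sub>1 :: "('o, 'a, 'z) smc_category_scheme" and C\<^sub>2 :: "('p, 'b, 'y) smc_category_scheme"
    and F :: "('o, 'a, 'p, 'b, 'x) monoidal_funct_scheme" and G :: "('p, 'b, 'o, 'a) funct"
    and \<eta> :: "'o \<Rightarrow> 'a" and \<epsilon> :: "'p \<Rightarrow> 'b"
begin

abbreviation lam where "lam \<equiv> lam_mor C\<^sub>1 C\<^sub>2 F G \<eta> \<epsilon>"
abbreviation prj where "prj \<equiv> proj_mor C\<^sub>1 C\<^sub>2 F G \<eta> \<epsilon>"

text \<open>Collecting everything under a single \<open>far G\<close> shows \<open>lam\<close> as a
  transpose along the adjunction of \<open>F\<close> and \<open>G\<close>, the form to which
  \<open>counit_transpose\<close> applies.\<close>

lemma lam_eq: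
  assumes "A \<in> obj C\<^sub>2" "B \<in> obj C\<^sub>2"
  shows "lam A B = far G ((\<epsilon> A \<boxtimes>\<^bsub>C\<^sub>2\<^esub> \<epsilon> B) \<cdot>\<^bsub>C\<^sub>2\<^esub> inv_arr C\<^sub>2 (mult F (fob G A) (fob G B))) \<cdot>\<^bsub>C\<^sub>1\<^esub>
    \<eta> (fob G A \<otimes>\<^bsub>C\<^sub>1\<^esub> fob G B)"
  using assms by (simp add: lam_mor_def FG.R.far_comp)

lemma lam_sel [simp]:
  assumes "A \<in> obj C\<^sub>2" "B \<in> obj C\<^sub>2"
  shows "lam A B \<in> arr C\<^sub>1" "src C\<^sub>1 (lam A B) = fob G A \<otimes>\<^bsub>C\<^sub>1\<^esub> fob G B"
    "tgt C\<^sub>1 (lam A B) = fob G (A \<otimes>\<^bsub>C\<^sub>2\<^esub> B)"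
  using assms by (simp_all add: lam_eq)

lemma counit_lam:
  assumes "A \<in> obj C\<^sub>2" "B \<in> obj C\<^sub>2"
  shows "\<epsilon> (A \<otimes>\<^bsub>C\<^sub>2\<^esub> B) \<cdot>\<^bsub>C\<^sub>2\<^esub> far F (lam A B)
    = (\<epsilon> A \<boxtimes>\<^bsub>C\<^sub>2\<^esub> \<epsilon> B) \<cdot>\<^bsub>C\<^sub>2\<^esub> inv_arr C\<^sub>2 (mult F (fob G A) (fob G B))"
  using assms FG.counit_transpose[of "fob G A \<otimes>\<^bsub>C\<^sub>1\<^esub> fob G B"
    "(\<epsilon> A \<boxtimes>\<^bsub>C\<^sub>2\<^esub> \<epsilon> B) \<cdot>\<^bsub>C\<^sub>2\<^esub> inv_arr C\<^sub>2 (mult F (fob G A) (fob G B))"] by (simp add: lam_eq)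

lemma prj_eq:
  assumes "A \<in> obj C\<^sub>2" "B \<in> obj C\<^sub>1"
  shows "prj A B = far G ((\<epsilon> A \<boxtimes>\<^bsub>C\<^sub>2\<^esub> ide C\<^sub>2 (fob F B)) \<cdot>\<^bsub>C\<^sub>2\<^esub> inv_arr C\<^sub>2 (mult F (fob G A) B)) \<cdot>\<^bsub>C\<^sub>1\<^esub>
    \<eta> (fob G A \<otimes>\<^bsub>C\<^sub>1\<^esub> B)"
  using assms by (simp add: proj_mor_def FG.R.far_comp)

lemma prj_sel [simp]:
  assumes "A \<in> obj C\<^sub>2" "B \<in> obj C\<^sub>1"
  shows "prj A B \<in> arr C\<^sub>1" "src C\<^sub>1 (prj A B) = fob G A \<otimes>\<^bsub>C\<^sub>1\<^esub> B"
    "tgt C\<^sub>1 (prj A B) = fob G (A \<otimes>\<^bsub>C\<^sub>2\<^esub> fob F B)"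
  using assms by (simp_all add: prj_eq)

lemma counit_prj:
  assumes "A \<in> obj C\<^sub>2" "B \<in> obj C\<^sub>1"
  shows "\<epsilon> (A \<otimes>\<^bsub>C\<^sub>2\<^esub> fob F B) \<cdot>\<^bsub>C\<^sub>2\<^esub> far F (prj A B)
    = (\<epsilon> A \<boxtimes>\<^bsub>C\<^sub>2\<^esub> ide C\<^sub>2 (fob F B)) \<cdot>\<^bsub>C\<^sub>2\<^esub> inv_arr C\<^sub>2 (mult F (fob G A) B)"
  using assms FG.counit_transpose[of "fob G A \<otimes>\<^bsub>C\<^sub>1\<^esub> B"
    "(\<epsilon> A \<boxtimes>\<^bsub>C\<^sub>2\<^esub> ide C\<^sub>2 (fob F B)) \<cdot>\<^bsub>C\<^sub>2\<^esub> inv_arr C\<^sub>2 (mult F (fob G A) B)"] by (simp add: prj_eq)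

text \<open>After transposition only naturality of inverse \<open>mult\<close> and of the counit is
  involved.\<close>

lemma lam_nat:
  assumes [simp]: "f \<in> arr C\<^sub>2" "g \<in> arr C\<^sub>2"
  shows "lam (tgt C\<^sub>2 f) (tgt C\<^sub>2 g) \<cdot>\<^bsub>C\<^sub>1\<^esub> (far G f \<boxtimes>\<^bsub>C\<^sub>1\<^esub> far G g)
    = far G (f \<boxtimes>\<^bsub>C\<^sub>2\<^esub> g) \<cdot>\<^bsub>C\<^sub>1\<^esub> lam (src C\<^sub>2 f) (src C\<^sub>2 g)" (is "?l = ?r")
proof (rule FG.counit_eqI)
  have "\<epsilon> (tgt C\<^sub>2 f \<otimes>\<^bsub>C\<^sub>2\<^esub> tgt C\<^sub>2 g) \<cdot>\<^bsub>C\<^sub>2\<^esub> far F ?l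
    = (\<epsilon> (tgt C\<^sub>2 f) \<boxtimes>\<^bsub>C\<^sub>2\<^esub> \<epsilon> (tgt C\<^sub>2 g)) \<cdot>\<^bsub>C\<^sub>2\<^esub> inv_arr C\<^sub>2 (mult F (fob G (tgt C\<^sub>2 f)) (fob G (tgt C\<^sub>2 g))) \<cdot>\<^bsub>C\<^sub>2\<^esub>
      far F (far G f \<boxtimes>\<^bsub>C\<^sub>1\<^esub> far G g)"
    by (simp add: F.far_comp C2.cmp_reassoc[OF counit_lam])
  also have "\<dots> = ((f \<cdot>\<^bsub>C\<^sub>2\<^esub> \<epsilon> (src C\<^sub>2 f)) \<boxtimes>\<^bsub>C\<^sub>2\<^esub> (g \<cdot>\<^bsub>C\<^sub>2\<^esub> \<epsilon> (src C\<^sub>2 g))) \<cdot>\<^bsub>C\<^sub>2\<^esub>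
      inv_arr C\<^sub>2 (mult F (fob G (src C\<^sub>2 f)) (fob G (src C\<^sub>2 g)))"
    using F.inv_mult_nat[of "far G f" "far G g"] by (simp add: C2.fuse FG.counit_nat)
  also have "\<dots> = (f \<boxtimes>\<^bsub>C\<^sub>2\<^esub> g) \<cdot>\<^bsub>C\<^sub>2\<^esub> \<epsilon> (src C\<^sub>2 f \<otimes>\<^bsub>C\<^sub>2\<^esub> src C\<^sub>2 g) \<cdot>\<^bsub>C\<^sub>2\<^esub> far F (lam (src C\<^sub>2 f) (src C\<^sub>2 g))"
    by (simp add: counit_lam C2.fuse)
  also have "\<dots> = \<epsilon> (tgt C\<^sub>2 f \<otimes>\<^bsub>C\<^sub>2\<^esub> tgt C\<^sub>2 g) \<cdot>\<^bsub>C\<^sub>2\<^esub> far F ?r"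
    using C2.cmp_reassoc2[OF FG.counit_nat[of "f \<boxtimes>\<^bsub>C\<^sub>2\<^esub> g"]] by (simp add: F.far_comp)
  finally show "\<epsilon> (tgt C\<^sub>2 f \<otimes>\<^bsub>C\<^sub>2\<^esub> tgt C\<^sub>2 g) \<cdot>\<^bsub>C\<^sub>2\<^esub> far F ?l = \<dots>" .
qed simp_all

text \<open>The transposed identity is \<open>mult_symm\<close> for the inverses of
  \<open>mult\<close>, obtained from \<open>iso_square\<close>, together with naturality of the
  symmetry in the two counits.\<close>

lemma lam_symm:
  assumes [simp]: "A \<in> obj C\<^sub>2" "B \<in> obj C\<^sub>2"
  shows "far G (symm C\<^sub>2 A B) \<cdot>\<^bsub>C\<^sub>1\<^esub> lam A B = lam B A \<cdot>\<^bsub>C\<^sub>1\<^esub> symm C\<^sub>1 (fob G A) (fob G B)" (is "?l = ?r")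
proof (rule FG.counit_eqI)
  have "\<epsilon> (B \<otimes>\<^bsub>C\<^sub>2\<^esub> A) \<cdot>\<^bsub>C\<^sub>2\<^esub> far F ?l
    = symm C\<^sub>2 A B \<cdot>\<^bsub>C\<^sub>2\<^esub> \<epsilon> (A \<otimes>\<^bsub>C\<^sub>2\<^esub> B) \<cdot>\<^bsub>C\<^sub>2\<^esub> far F (lam A B)"
    using C2.cmp_reassoc2[OF FG.counit_nat[of "symm C\<^sub>2 A B"]] by (simp add: F.far_comp)
  also have "\<dots> = (\<epsilon> B \<boxtimes>\<^bsub>C\<^sub>2\<^esub> \<epsilon> A) \<cdot>\<^bsub>C\<^sub>2\<^esub> symm C\<^sub>2 (fob F (fob G A)) (fob F (fob G B)) \<cdot>\<^bsub>C\<^sub>2\<^esub>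
      inv_arr C\<^sub>2 (mult F (fob G A) (fob G B))"
    using C2.cmp_reassoc2[OF C2.symm_nat[of "\<epsilon> A" "\<epsilon> B"]] by (simp add: counit_lam)
  also have "\<dots> = (\<epsilon> B \<boxtimes>\<^bsub>C\<^sub>2\<^esub> \<epsilon> A) \<cdot>\<^bsub>C\<^sub>2\<^esub> inv_arr C\<^sub>2 (mult F (fob G B) (fob G A)) \<cdot>\<^bsub>C\<^sub>2\<^esub>
      far F (symm C\<^sub>1 (fob G A) (fob G B))"
    by (subst C2.iso_square[OF _ _ F.mult_symm[symmetric]]) simp_all
  also have "\<dots> = \<epsilon> (B \<otimes>\<^bsub>C\<^sub>2\<^esub> A) \<cdot>\<^bsub>C\<^sub>2\<^esub> far F ?r"
    by (simp add: F.far_comp C2.cmp_reassoc[OF counit_lam])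
  finally show "\<epsilon> (B \<otimes>\<^bsub>C\<^sub>2\<^esub> A) \<cdot>\<^bsub>C\<^sub>2\<^esub> far F ?l = \<dots>" .
qed simp_all

lemma prj_nat:
  assumes [simp]: "f \<in> arr C\<^sub>2" "g \<in> arr C\<^sub>1"
  shows "prj (tgt C\<^sub>2 f) (tgt C\<^sub>1 g) \<cdot>\<^bsub>C\<^sub>1\<^esub> (far G f \<boxtimes>\<^bsub>C\<^sub>1\<^esub> g)
    = far G (f \<boxtimes>\<^bsub>C\<^sub>2\<^esub> far F g) \<cdot>\<^bsub>C\<^sub>1\<^esub> prj (src C\<^sub>2 f) (src C\<^sub>1 g)" (is "?l = ?r")
proof (rule FG.counit_eqI)
  let ?e = "\<epsilon> (tgt C\<^sub>2 f \<otimes>\<^bsub>C\<^sub>2\<^esub> fob F (tgt C\<^sub>1 g))"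
  have "?e \<cdot>\<^bsub>C\<^sub>2\<^esub> far F ?l
    = (\<epsilon> (tgt C\<^sub>2 f) \<boxtimes>\<^bsub>C\<^sub>2\<^esub> ide C\<^sub>2 (fob F (tgt C\<^sub>1 g))) \<cdot>\<^bsub>C\<^sub>2\<^esub> inv_arr C\<^sub>2 (mult F (fob G (tgt C\<^sub>2 f)) (tgt C\<^sub>1 g)) \<cdot>\<^bsub>C\<^sub>2\<^esub>
      far F (far G f \<boxtimes>\<^bsub>C\<^sub>1\<^esub> g)"
    by (simp add: F.far_comp C2.cmp_reassoc[OF counit_prj])
  also have "\<dots> = ((f \<cdot>\<^bsub>C\<^sub>2\<^esub> \<epsilon> (src C\<^sub>2 f)) \<boxtimes>\<^bsub>C\<^sub>2\<^esub> far F g) \<cdot>\<^bsub>C\<^sub>2\<^esub> inv_arr C\<^sub>2 (mult F (fob G (src C\<^sub>2 f)) (src C\<^sub>1 g))"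
    using F.inv_mult_nat[of "far G f" g] by (simp add: C2.fuse FG.counit_nat)
  also have "\<dots> = (f \<boxtimes>\<^bsub>C\<^sub>2\<^esub> far F g) \<cdot>\<^bsub>C\<^sub>2\<^esub> \<epsilon> (src C\<^sub>2 f \<otimes>\<^bsub>C\<^sub>2\<^esub> fob F (src C\<^sub>1 g)) \<cdot>\<^bsub>C\<^sub>2\<^esub>
      far F (prj (src C\<^sub>2 f) (src C\<^sub>1 g))"
    by (simp add: counit_prj C2.fuse)
  also have "\<dots> = ?e \<cdot>\<^bsub>C\<^sub>2\<^esub> far F ?r"
    using C2.cmp_reassoc2[OF FG.counit_nat[of "f \<boxtimes>\<^bsub>C\<^sub>2\<^esub> far F g"]] by (simp add: F.far_comp)
  finally show "?e \<cdot>\<^bsub>C\<^sub>2\<^esub> far F ?l = \<dots>" .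
qed simp_all

text \<open>Transposing replaces each \<lambda> and \<pi> by counits after an inverse
  \<open>mult\<close>. Naturality of the interchange collects the counits on the left. What is left
  is \<open>mult_interchange\<close> with its four \<open>mult\<close> arrows at the objects
  \<open>fob G X\<close>, \<open>fob G A\<close>, Y, B inverted or moved across.\<close>

lemma prj_interchange:
  assumes [simp]: "X \<in> obj C\<^sub>2" "A \<in> obj C\<^sub>2" "Y \<in> obj C\<^sub>1" "B \<in> obj C\<^sub>1"
  shows "far G (ide C\<^sub>2 (X \<otimes>\<^bsub>C\<^sub>2\<^esub> A) \<boxtimes>\<^bsub>C\<^sub>2\<^esub> mult F Y B) \<cdot>\<^bsub>C\<^sub>1\<^esub>
      far G (interchange C\<^sub>2 X (fob F Y) A (fob F B)) \<cdot>\<^bsub>C\<^sub>1\<^esub>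
      lam (X \<otimes>\<^bsub>C\<^sub>2\<^esub> fob F Y) (A \<otimes>\<^bsub>C\<^sub>2\<^esub> fob F B) \<cdot>\<^bsub>C\<^sub>1\<^esub> (prj X Y \<boxtimes>\<^bsub>C\<^sub>1\<^esub> prj A B)
    = prj (X \<otimes>\<^bsub>C\<^sub>2\<^esub> A) (Y \<otimes>\<^bsub>C\<^sub>1\<^esub> B) \<cdot>\<^bsub>C\<^sub>1\<^esub> (lam X A \<boxtimes>\<^bsub>C\<^sub>1\<^esub> ide C\<^sub>1 (Y \<otimes>\<^bsub>C\<^sub>1\<^esub> B)) \<cdot>\<^bsub>C\<^sub>1\<^esub>
      interchange C\<^sub>1 (fob G X) Y (fob G A) B" (is "?l = ?r")
proof (rule FG.counit_eqI)
  let ?e = "\<epsilon> ((X \<otimes>\<^bsub>C\<^sub>2\<^esub> A) \<otimes>\<^bsub>C\<^sub>2\<^esub> fob F (Y \<otimes>\<^bsub>C\<^sub>1\<^esub> B))"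
  let ?X = "fob G X" and ?A = "fob G A" and ?FX = "fob F (fob G X)" and ?FA = "fob F (fob G A)"
  let ?FY = "fob F Y" and ?FB = "fob F B"
  \<comment> \<open>\<open>?n\<close> is the arrow under \<open>far G\<close> on the left side,
    \<open>?n'\<close> the same arrow with X and A replaced by their images under \<open>G\<close>
    and then \<open>F\<close>, as it reads once the counits have moved past it. \<open>?m\<close>
    and \<open>?k\<close> are the inverses of \<open>mult\<close> coming from the two \<pi> and from
    \<lambda>.\<close>
  let ?n = "(ide C\<^sub>2 (X \<otimes>\<^bsub>C\<^sub>2\<^esub> A) \<boxtimes>\<^bsub>C\<^sub>2\<^esub> mult F Y B) \<cdot>\<^bsub>C\<^sub>2\<^esub> interchange C\<^sub>2 X ?FY A ?FB"
  let ?n' = "(ide C\<^sub>2 (?FX \<otimes>\<^bsub>C\<^sub>2\<^esub> ?FA) \<boxtimes>\<^bsub>C\<^sub>2\<^esub> mult F Y B) \<cdot>\<^bsub>C\<^sub>2\<^esub> interchange C\<^sub>2 ?FX ?FY ?FA ?FB"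
  let ?m = "inv_arr C\<^sub>2 (mult F ?X Y) \<boxtimes>\<^bsub>C\<^sub>2\<^esub> inv_arr C\<^sub>2 (mult F ?A B)"
  let ?k = "inv_arr C\<^sub>2 (mult F (?X \<otimes>\<^bsub>C\<^sub>1\<^esub> Y) (?A \<otimes>\<^bsub>C\<^sub>1\<^esub> B))"
  have "?e \<cdot>\<^bsub>C\<^sub>2\<^esub> far F ?l
    = ?e \<cdot>\<^bsub>C\<^sub>2\<^esub> far F (far G ?n) \<cdot>\<^bsub>C\<^sub>2\<^esub> far F (lam (X \<otimes>\<^bsub>C\<^sub>2\<^esub> ?FY) (A \<otimes>\<^bsub>C\<^sub>2\<^esub> ?FB)) \<cdot>\<^bsub>C\<^sub>2\<^esub> far F (prj X Y \<boxtimes>\<^bsub>C\<^sub>1\<^esub> prj A B)"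
    by (simp add: F.far_comp FG.R.far_comp)
  \<comment> \<open>Naturality of the counit at \<open>?n\<close> frees it from \<open>F\<close> and
    \<open>G\<close> and exposes the transpose of \<lambda>.\<close>
  also have "\<dots> = ?n \<cdot>\<^bsub>C\<^sub>2\<^esub> (\<epsilon> ((X \<otimes>\<^bsub>C\<^sub>2\<^esub> ?FY) \<otimes>\<^bsub>C\<^sub>2\<^esub> (A \<otimes>\<^bsub>C\<^sub>2\<^esub> ?FB)) \<cdot>\<^bsub>C\<^sub>2\<^esub>
      far F (lam (X \<otimes>\<^bsub>C\<^sub>2\<^esub> ?FY) (A \<otimes>\<^bsub>C\<^sub>2\<^esub> ?FB))) \<cdot>\<^bsub>C\<^sub>2\<^esub> far F (prj X Y \<boxtimes>\<^bsub>C\<^sub>1\<^esub> prj A B)"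
    using C2.cmp_reassoc2[OF FG.counit_nat[of ?n]] by simp
  also have "\<dots> = ?n \<cdot>\<^bsub>C\<^sub>2\<^esub> (\<epsilon> (X \<otimes>\<^bsub>C\<^sub>2\<^esub> ?FY) \<boxtimes>\<^bsub>C\<^sub>2\<^esub> \<epsilon> (A \<otimes>\<^bsub>C\<^sub>2\<^esub> ?FB)) \<cdot>\<^bsub>C\<^sub>2\<^esub>
      (far F (prj X Y) \<boxtimes>\<^bsub>C\<^sub>2\<^esub> far F (prj A B)) \<cdot>\<^bsub>C\<^sub>2\<^esub> ?k"
    using F.inv_mult_nat[of "prj X Y" "prj A B"] by (simp add: counit_lam)
  also have "\<dots> = ?n \<cdot>\<^bsub>C\<^sub>2\<^esub> ((\<epsilon> X \<boxtimes>\<^bsub>C\<^sub>2\<^esub> ide C\<^sub>2 ?FY) \<boxtimes>\<^bsub>C\<^sub>2\<^esub> (\<epsilon> A \<boxtimes>\<^bsub>C\<^sub>2\<^esub> ide C\<^sub>2 ?FB)) \<cdot>\<^bsub>C\<^sub>2\<^esub> ?m \<cdot>\<^bsub>C\<^sub>2\<^esub> ?k"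
    by (simp add: C2.fuse counit_prj)
  also have "\<dots> = (ide C\<^sub>2 (X \<otimes>\<^bsub>C\<^sub>2\<^esub> A) \<boxtimes>\<^bsub>C\<^sub>2\<^esub> mult F Y B) \<cdot>\<^bsub>C\<^sub>2\<^esub>
      ((\<epsilon> X \<boxtimes>\<^bsub>C\<^sub>2\<^esub> \<epsilon> A) \<boxtimes>\<^bsub>C\<^sub>2\<^esub> ide C\<^sub>2 (?FY \<otimes>\<^bsub>C\<^sub>2\<^esub> ?FB)) \<cdot>\<^bsub>C\<^sub>2\<^esub> interchange C\<^sub>2 ?FX ?FY ?FA ?FB \<cdot>\<^bsub>C\<^sub>2\<^esub> ?m \<cdot>\<^bsub>C\<^sub>2\<^esub> ?k"
    using C2.cmp_reassoc2[OF C2.interchange_nat[of "\<epsilon> X" "ide C\<^sub>2 ?FY" "\<epsilon> A" "ide C\<^sub>2 ?FB"]] by simp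
  also have "\<dots> = ((\<epsilon> X \<boxtimes>\<^bsub>C\<^sub>2\<^esub> \<epsilon> A) \<boxtimes>\<^bsub>C\<^sub>2\<^esub> ide C\<^sub>2 (fob F (Y \<otimes>\<^bsub>C\<^sub>1\<^esub> B))) \<cdot>\<^bsub>C\<^sub>2\<^esub> ?n' \<cdot>\<^bsub>C\<^sub>2\<^esub> ?m \<cdot>\<^bsub>C\<^sub>2\<^esub> ?k"
    by (simp add: C2.fuse)
  also have "?n' \<cdot>\<^bsub>C\<^sub>2\<^esub> ?m \<cdot>\<^bsub>C\<^sub>2\<^esub> ?k = (inv_arr C\<^sub>2 (mult F ?X ?A) \<boxtimes>\<^bsub>C\<^sub>2\<^esub> ide C\<^sub>2 (fob F (Y \<otimes>\<^bsub>C\<^sub>1\<^esub> B))) \<cdot>\<^bsub>C\<^sub>2\<^esub>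
      inv_arr C\<^sub>2 (mult F (?X \<otimes>\<^bsub>C\<^sub>1\<^esub> ?A) (Y \<otimes>\<^bsub>C\<^sub>1\<^esub> B)) \<cdot>\<^bsub>C\<^sub>2\<^esub> far F (interchange C\<^sub>1 ?X Y ?A B)" (is "_ = ?s")
  proof -
    \<comment> \<open>An identity is inserted as the two layers of \<open>mult\<close> followed by
      their inverses \<open>?m\<close> and \<open>?k\<close>; this creates the left side of
      \<open>mult_interchange\<close>.\<close>
    have "?s = ?s \<cdot>\<^bsub>C\<^sub>2\<^esub> mult F (?X \<otimes>\<^bsub>C\<^sub>1\<^esub> Y) (?A \<otimes>\<^bsub>C\<^sub>1\<^esub> B) \<cdot>\<^bsub>C\<^sub>2\<^esub> (mult F ?X Y \<boxtimes>\<^bsub>C\<^sub>2\<^esub> mult F ?A B) \<cdot>\<^bsub>C\<^sub>2\<^esub> ?m \<cdot>\<^bsub>C\<^sub>2\<^esub> ?k"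
      by (simp add: C2.fuse)
    also have "\<dots> = (inv_arr C\<^sub>2 (mult F ?X ?A) \<boxtimes>\<^bsub>C\<^sub>2\<^esub> ide C\<^sub>2 (fob F (Y \<otimes>\<^bsub>C\<^sub>1\<^esub> B))) \<cdot>\<^bsub>C\<^sub>2\<^esub>
      inv_arr C\<^sub>2 (mult F (?X \<otimes>\<^bsub>C\<^sub>1\<^esub> ?A) (Y \<otimes>\<^bsub>C\<^sub>1\<^esub> B)) \<cdot>\<^bsub>C\<^sub>2\<^esub> (far F (interchange C\<^sub>1 ?X Y ?A B) \<cdot>\<^bsub>C\<^sub>2\<^esub>
      mult F (?X \<otimes>\<^bsub>C\<^sub>1\<^esub> Y) (?A \<otimes>\<^bsub>C\<^sub>1\<^esub> B) \<cdot>\<^bsub>C\<^sub>2\<^esub> (mult F ?X Y \<boxtimes>\<^bsub>C\<^sub>2\<^esub> mult F ?A B)) \<cdot>\<^bsub>C\<^sub>2\<^esub> ?m \<cdot>\<^bsub>C\<^sub>2\<^esub> ?k"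
      by simp
    also have "\<dots> = ?n' \<cdot>\<^bsub>C\<^sub>2\<^esub> ?m \<cdot>\<^bsub>C\<^sub>2\<^esub> ?k"
      by (subst F.mult_interchange) (simp_all add: C2.fuse)
    finally show ?thesis by simp
  qed
  \<comment> \<open>From here the right side is assembled: the transposes of \<lambda> and then of
    \<pi> are folded back, with naturality of inverse \<open>mult\<close> moving
    \<open>lam X A\<close> between them.\<close>
  also have "((\<epsilon> X \<boxtimes>\<^bsub>C\<^sub>2\<^esub> \<epsilon> A) \<boxtimes>\<^bsub>C\<^sub>2\<^esub> ide C\<^sub>2 (fob F (Y \<otimes>\<^bsub>C\<^sub>1\<^esub> B))) \<cdot>\<^bsub>C\<^sub>2\<^esub> \<dots>
    = ((\<epsilon> (X \<otimes>\<^bsub>C\<^sub>2\<^esub> A) \<cdot>\<^bsub>C\<^sub>2\<^esub> far F (lam X A)) \<boxtimes>\<^bsub>C\<^sub>2\<^esub> ide C\<^sub>2 (fob F (Y \<otimes>\<^bsub>C\<^sub>1\<^esub> B))) \<cdot>\<^bsub>C\<^sub>2\<^esub>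
      inv_arr C\<^sub>2 (mult F (?X \<otimes>\<^bsub>C\<^sub>1\<^esub> ?A) (Y \<otimes>\<^bsub>C\<^sub>1\<^esub> B)) \<cdot>\<^bsub>C\<^sub>2\<^esub> far F (interchange C\<^sub>1 ?X Y ?A B)"
    by (simp add: C2.fuse counit_lam)
  also have "\<dots> = (\<epsilon> (X \<otimes>\<^bsub>C\<^sub>2\<^esub> A) \<boxtimes>\<^bsub>C\<^sub>2\<^esub> ide C\<^sub>2 (fob F (Y \<otimes>\<^bsub>C\<^sub>1\<^esub> B))) \<cdot>\<^bsub>C\<^sub>2\<^esub>
      inv_arr C\<^sub>2 (mult F (fob G (X \<otimes>\<^bsub>C\<^sub>2\<^esub> A)) (Y \<otimes>\<^bsub>C\<^sub>1\<^esub> B)) \<cdot>\<^bsub>C\<^sub>2\<^esub>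
      far F (lam X A \<boxtimes>\<^bsub>C\<^sub>1\<^esub> ide C\<^sub>1 (Y \<otimes>\<^bsub>C\<^sub>1\<^esub> B)) \<cdot>\<^bsub>C\<^sub>2\<^esub> far F (interchange C\<^sub>1 ?X Y ?A B)"
    using C2.cmp_reassoc2[OF F.inv_mult_nat[of "lam X A" "ide C\<^sub>1 (Y \<otimes>\<^bsub>C\<^sub>1\<^esub> B)"]] by (simp add: C2.fuse)
  also have "\<dots> = ?e \<cdot>\<^bsub>C\<^sub>2\<^esub> far F ?r"
    by (simp add: F.far_comp C2.cmp_reassoc[OF counit_prj])
  finally show "?e \<cdot>\<^bsub>C\<^sub>2\<^esub> far F ?l = ?e \<cdot>\<^bsub>C\<^sub>2\<^esub> far F ?r" .
qed simp_all

section \<open>The pull-back as a duality preserving functor\<close>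

lemma beta_eq:
  assumes "K \<in> obj C\<^sub>1" "A \<in> obj C\<^sub>1"
  shows "beta C\<^sub>1 C\<^sub>2 F K A = adj_transpose C\<^sub>2 (fob F \<lblot>A, K\<rblot>\<^bsub>C\<^sub>1\<^esub>) (fob F A)
    (far F (ev C\<^sub>1 A K) \<cdot>\<^bsub>C\<^sub>2\<^esub> mult F \<lblot>A, K\<rblot>\<^bsub>C\<^sub>1\<^esub> A)"
  using assms by (simp add: beta_def C2.ihom_ihom_coev)

lemma beta_sel [simp]:
  assumes "K \<in> obj C\<^sub>1" "A \<in> obj C\<^sub>1"
  shows "beta C\<^sub>1 C\<^sub>2 F K A \<in> arr C\<^sub>2" "src C\<^sub>2 (beta C\<^sub>1 C\<^sub>2 F K A) = fob F \<lblot>A, K\<rblot>\<^bsub>C\<^sub>1\<^esub>"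
    "tgt C\<^sub>2 (beta C\<^sub>1 C\<^sub>2 F K A) = \<lblot>fob F A, fob F K\<rblot>\<^bsub>C\<^sub>2\<^esub>"
  using assms by (simp_all add: beta_eq)

lemma ev_beta:
  assumes "K \<in> obj C\<^sub>1" "A \<in> obj C\<^sub>1"
  shows "ev C\<^sub>2 (fob F A) (fob F K) \<cdot>\<^bsub>C\<^sub>2\<^esub> (beta C\<^sub>1 C\<^sub>2 F K A \<boxtimes>\<^bsub>C\<^sub>2\<^esub> ide C\<^sub>2 (fob F A))
    = far F (ev C\<^sub>1 A K) \<cdot>\<^bsub>C\<^sub>2\<^esub> mult F \<lblot>A, K\<rblot>\<^bsub>C\<^sub>1\<^esub> A"
  using assms C2.ev_adj_transpose[of "fob F \<lblot>A, K\<rblot>\<^bsub>C\<^sub>1\<^esub>" "fob F A"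
      "far F (ev C\<^sub>1 A K) \<cdot>\<^bsub>C\<^sub>2\<^esub> mult F \<lblot>A, K\<rblot>\<^bsub>C\<^sub>1\<^esub> A"]
  by (simp add: beta_eq)

lemma truncate_sel [simp]: "fob (funct.truncate F) = fob F" "far (funct.truncate F) = far F"
  by (simp_all add: funct.truncate_def)

lemma duality_preserving_dp_pull:
  assumes [simp]: "K \<in> obj C\<^sub>1"
  shows "duality_preserving (dual_cat_of C\<^sub>1 K) (dual_cat_of C\<^sub>2 (fob F K)) (dp_pull C\<^sub>1 C\<^sub>2 F K)"
  unfolding dp_pull_def
proof (rule duality_preserving_lax)
  show "is_functor C\<^sub>1 C\<^sub>2 (funct.truncate F)"
    by (intro is_functorI) (auto simp: F.far_comp C1.category_axioms C2.category_axioms)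
  \<comment> \<open>The identity of \<open>fob F K\<close> is written out because it instantiates
    \<open>\<kappa>\<close>, while \<open>mult F\<close> instantiates \<open>m\<close>.\<close>
  show "ev C\<^sub>2 (fob (funct.truncate F) A) (fob F K) \<cdot>\<^bsub>C\<^sub>2\<^esub>
      (beta C\<^sub>1 C\<^sub>2 F K A \<boxtimes>\<^bsub>C\<^sub>2\<^esub> ide C\<^sub>2 (fob (funct.truncate F) A))
    = ide C\<^sub>2 (fob F K) \<cdot>\<^bsub>C\<^sub>2\<^esub> far (funct.truncate F) (ev C\<^sub>1 A K) \<cdot>\<^bsub>C\<^sub>2\<^esub> mult F \<lblot>A, K\<rblot>\<^bsub>C\<^sub>1\<^esub> A"
    if "A \<in> obj C\<^sub>1" for A
    using that by (simp add: ev_beta)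
qed (auto simp: hom_iff F.mult_nat F.mult_symm C1.symmetric_monoidal_closed_axioms
  C2.symmetric_monoidal_closed_axioms)

end

section \<open>The right adjoint of the direct image: \<zeta>, \<theta> and the comparison of
  dualities\<close>

locale twisted_inverse_image = direct_image C\<^sub>1 C\<^sub>2 F G \<eta> \<epsilon> + GH: adjunction C\<^sub>2 C\<^sub>1 G H \<eta>' \<epsilon>'
  for C\<^sub>1 :: "('o, 'a, 'z) smc_category_scheme" and C\<^sub>2 :: "('p, 'b, 'y) smc_category_scheme"
    and F :: "('o, 'a, 'p, 'b, 'x) monoidal_funct_scheme" and G :: "('p, 'b, 'o, 'a) funct"
    and \<eta> :: "'o \<Rightarrow> 'a" and \<epsilon> :: "'p \<Rightarrow> 'b"
    and H :: "('o, 'a, 'p, 'b) funct" and \<eta>' :: "'p \<Rightarrow> 'b" and \<epsilon>' :: "'o \<Rightarrow> 'a" +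
  assumes prj_iso [simp]: "A \<in> obj C\<^sub>2 \<Longrightarrow> B \<in> obj C\<^sub>1 \<Longrightarrow> is_iso C\<^sub>1 (proj_mor C\<^sub>1 C\<^sub>2 F G \<eta> \<epsilon> A B)"
begin

abbreviation zet where "zet \<equiv> zeta C\<^sub>1 C\<^sub>2 F G H \<eta> \<epsilon> \<epsilon>'"
abbreviation tht where "tht \<equiv> theta C\<^sub>1 C\<^sub>2 F G H \<eta> \<epsilon> \<eta>' \<epsilon>'"

lemma zeta_eq:
  assumes "K \<in> obj C\<^sub>1" "A \<in> obj C\<^sub>2"
  shows "zet K A = adj_transpose C\<^sub>1 (fob G \<lblot>A, fob H K\<rblot>\<^bsub>C\<^sub>2\<^esub>) (fob G A)
    (\<epsilon>' K \<cdot>\<^bsub>C\<^sub>1\<^esub> far G (ev C\<^sub>2 A (fob H K)) \<cdot>\<^bsub>C\<^sub>1\<^esub> lam \<lblot>A, fob H K\<rblot>\<^bsub>C\<^sub>2\<^esub> A)"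
  using assms by (simp add: zeta_def mu_mor_def C1.ihom_ihom_coev adj_transpose_def
      C1.cmp_reassoc[OF C1.ihom_comp])

lemma zeta_sel [simp]:
  assumes "K \<in> obj C\<^sub>1" "A \<in> obj C\<^sub>2"
  shows "zet K A \<in> arr C\<^sub>1" "src C\<^sub>1 (zet K A) = fob G \<lblot>A, fob H K\<rblot>\<^bsub>C\<^sub>2\<^esub>"
    "tgt C\<^sub>1 (zet K A) = \<lblot>fob G A, K\<rblot>\<^bsub>C\<^sub>1\<^esub>"
  using assms by (simp_all add: zeta_eq)

lemma ev_zeta:
  assumes "K \<in> obj C\<^sub>1" "A \<in> obj C\<^sub>2"
  shows "ev C\<^sub>1 (fob G A) K \<cdot>\<^bsub>C\<^sub>1\<^esub> (zet K A \<boxtimes>\<^bsub>C\<^sub>1\<^esub> ide C\<^sub>1 (fob G A))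
    = \<epsilon>' K \<cdot>\<^bsub>C\<^sub>1\<^esub> far G (ev C\<^sub>2 A (fob H K)) \<cdot>\<^bsub>C\<^sub>1\<^esub> lam \<lblot>A, fob H K\<rblot>\<^bsub>C\<^sub>2\<^esub> A"
  using assms C1.ev_adj_transpose[of "fob G \<lblot>A, fob H K\<rblot>\<^bsub>C\<^sub>2\<^esub>" "fob G A"
      "\<epsilon>' K \<cdot>\<^bsub>C\<^sub>1\<^esub> far G (ev C\<^sub>2 A (fob H K)) \<cdot>\<^bsub>C\<^sub>1\<^esub> lam \<lblot>A, fob H K\<rblot>\<^bsub>C\<^sub>2\<^esub> A"]
  by (simp add: zeta_eq)

lemma duality_preserving_dp_push:
  assumes [simp]: "K \<in> obj C\<^sub>1"
  shows "duality_preserving (dual_cat_of C\<^sub>2 (fob H K)) (dual_cat_of C\<^sub>1 K)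
    (dp_push C\<^sub>1 C\<^sub>2 F G H \<eta> \<epsilon> \<epsilon>' K)"
  unfolding dp_push_def
  by (rule duality_preserving_lax[where m = lam and \<kappa> = "\<epsilon>' K"])
    (auto simp: hom_iff ev_zeta lam_nat lam_symm FG.R.is_functor_axioms C1.symmetric_monoidal_closed_axioms
      C2.symmetric_monoidal_closed_axioms)

lemma theta_eq:
  assumes "A \<in> obj C\<^sub>1" "B \<in> obj C\<^sub>1"
  shows "tht A B = far H ((\<epsilon>' A \<boxtimes>\<^bsub>C\<^sub>1\<^esub> ide C\<^sub>1 B) \<cdot>\<^bsub>C\<^sub>1\<^esub> inv_arr C\<^sub>1 (prj (fob H A) B)) \<cdot>\<^bsub>C\<^sub>2\<^esub>
    \<eta>' (fob H A \<otimes>\<^bsub>C\<^sub>2\<^esub> fob F B)"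
  using assms by (simp add: theta_def GH.R.far_comp)

lemma theta_sel [simp]:
  assumes "A \<in> obj C\<^sub>1" "B \<in> obj C\<^sub>1"
  shows "tht A B \<in> arr C\<^sub>2" "src C\<^sub>2 (tht A B) = fob H A \<otimes>\<^bsub>C\<^sub>2\<^esub> fob F B"
    "tgt C\<^sub>2 (tht A B) = fob H (A \<otimes>\<^bsub>C\<^sub>1\<^esub> B)"
  using assms by (simp_all add: theta_eq)

lemma counit_theta:
  assumes "A \<in> obj C\<^sub>1" "B \<in> obj C\<^sub>1"
  shows "\<epsilon>' (A \<otimes>\<^bsub>C\<^sub>1\<^esub> B) \<cdot>\<^bsub>C\<^sub>1\<^esub> far G (tht A B)
    = (\<epsilon>' A \<boxtimes>\<^bsub>C\<^sub>1\<^esub> ide C\<^sub>1 B) \<cdot>\<^bsub>C\<^sub>1\<^esub> inv_arr C\<^sub>1 (prj (fob H A) B)"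
  using assms GH.counit_transpose[of "fob H A \<otimes>\<^bsub>C\<^sub>2\<^esub> fob F B"
    "(\<epsilon>' A \<boxtimes>\<^bsub>C\<^sub>1\<^esub> ide C\<^sub>1 B) \<cdot>\<^bsub>C\<^sub>1\<^esub> inv_arr C\<^sub>1 (prj (fob H A) B)"] by (simp add: theta_eq)

text \<open>This is the morphism condition for \<pi> at \<open>(A, B)\<close> with all composites
  unfolded. Both sides are evaluated at the tensor product of \<open>fob G A\<close> and B and
  brought to the same pairing: the interchange, then \<lambda> and the evaluation on A followed by
  \<open>\<epsilon>' K\<close> in one slot, and the evaluation on B in the other.\<close>

lemma prj_duality:
  assumes [simp]: "K \<in> obj C\<^sub>1" "M \<in> obj C\<^sub>1" "A \<in> obj C\<^sub>2" "B \<in> obj C\<^sub>1"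
  shows "tau C\<^sub>1 K M (fob G A) B \<cdot>\<^bsub>C\<^sub>1\<^esub> (zet K A \<boxtimes>\<^bsub>C\<^sub>1\<^esub> ide C\<^sub>1 \<lblot>B, M\<rblot>\<^bsub>C\<^sub>1\<^esub>)
    = \<lbrace>prj A B, ide C\<^sub>1 (K \<otimes>\<^bsub>C\<^sub>1\<^esub> M)\<rbrace>\<^bsub>C\<^sub>1\<^esub> \<cdot>\<^bsub>C\<^sub>1\<^esub>
      (zet (K \<otimes>\<^bsub>C\<^sub>1\<^esub> M) (A \<otimes>\<^bsub>C\<^sub>2\<^esub> fob F B) \<cdot>\<^bsub>C\<^sub>1\<^esub>
        far G (\<lbrace>ide C\<^sub>2 (A \<otimes>\<^bsub>C\<^sub>2\<^esub> fob F B), tht K M\<rbrace>\<^bsub>C\<^sub>2\<^esub> \<cdot>\<^bsub>C\<^sub>2\<^esub>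
          tau C\<^sub>2 (fob H K) (fob F M) A (fob F B) \<cdot>\<^bsub>C\<^sub>2\<^esub>
          (ide C\<^sub>2 \<lblot>A, fob H K\<rblot>\<^bsub>C\<^sub>2\<^esub> \<boxtimes>\<^bsub>C\<^sub>2\<^esub> beta C\<^sub>1 C\<^sub>2 F M B))) \<cdot>\<^bsub>C\<^sub>1\<^esub>
      prj \<lblot>A, fob H K\<rblot>\<^bsub>C\<^sub>2\<^esub> \<lblot>B, M\<rblot>\<^bsub>C\<^sub>1\<^esub>"
    (is "?l = \<lbrace>_, _\<rbrace>\<^bsub>_\<^esub> \<cdot>\<^bsub>_\<^esub> (?z \<cdot>\<^bsub>_\<^esub> far G ?q) \<cdot>\<^bsub>_\<^esub> ?p")
proof (rule C1.ev_eqI)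
  let ?X = "\<lblot>A, fob H K\<rblot>\<^bsub>C\<^sub>2\<^esub>" and ?Y = "\<lblot>B, M\<rblot>\<^bsub>C\<^sub>1\<^esub>" and ?T = "A \<otimes>\<^bsub>C\<^sub>2\<^esub> fob F B"
  let ?GX = "fob G ?X" and ?GA = "fob G A" and ?L = "K \<otimes>\<^bsub>C\<^sub>1\<^esub> M"
  let ?e = "ev C\<^sub>2 A (fob H K)"
  let ?i = "interchange C\<^sub>2 ?X (fob F ?Y) A (fob F B)" and ?j = "interchange C\<^sub>1 ?GX ?Y ?GA B"
  let ?r = "far G ((?e \<boxtimes>\<^bsub>C\<^sub>2\<^esub> (far F (ev C\<^sub>1 B M) \<cdot>\<^bsub>C\<^sub>2\<^esub> mult F ?Y B)) \<cdot>\<^bsub>C\<^sub>2\<^esub> ?i)"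
  have lhs: "ev C\<^sub>1 (?GA \<otimes>\<^bsub>C\<^sub>1\<^esub> B) ?L \<cdot>\<^bsub>C\<^sub>1\<^esub> (?l \<boxtimes>\<^bsub>C\<^sub>1\<^esub> ide C\<^sub>1 (?GA \<otimes>\<^bsub>C\<^sub>1\<^esub> B))
    = ((\<epsilon>' K \<cdot>\<^bsub>C\<^sub>1\<^esub> far G ?e \<cdot>\<^bsub>C\<^sub>1\<^esub> lam ?X A) \<boxtimes>\<^bsub>C\<^sub>1\<^esub> ev C\<^sub>1 B M) \<cdot>\<^bsub>C\<^sub>1\<^esub> ?j"
  proof -
    have "ev C\<^sub>1 (?GA \<otimes>\<^bsub>C\<^sub>1\<^esub> B) ?L \<cdot>\<^bsub>C\<^sub>1\<^esub> (?l \<boxtimes>\<^bsub>C\<^sub>1\<^esub> ide C\<^sub>1 (?GA \<otimes>\<^bsub>C\<^sub>1\<^esub> B))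
      = ev C\<^sub>1 (?GA \<otimes>\<^bsub>C\<^sub>1\<^esub> B) ?L \<cdot>\<^bsub>C\<^sub>1\<^esub> (tau C\<^sub>1 K M ?GA B \<boxtimes>\<^bsub>C\<^sub>1\<^esub> ide C\<^sub>1 (?GA \<otimes>\<^bsub>C\<^sub>1\<^esub> B)) \<cdot>\<^bsub>C\<^sub>1\<^esub>
        ((zet K A \<boxtimes>\<^bsub>C\<^sub>1\<^esub> ide C\<^sub>1 ?Y) \<boxtimes>\<^bsub>C\<^sub>1\<^esub> (ide C\<^sub>1 ?GA \<boxtimes>\<^bsub>C\<^sub>1\<^esub> ide C\<^sub>1 B))"
      by (simp add: C1.fuse)
    also have "\<dots> = (ev C\<^sub>1 ?GA K \<boxtimes>\<^bsub>C\<^sub>1\<^esub> ev C\<^sub>1 B M) \<cdot>\<^bsub>C\<^sub>1\<^esub> interchange C\<^sub>1 \<lblot>?GA, K\<rblot>\<^bsub>C\<^sub>1\<^esub> ?Y ?GA B \<cdot>\<^bsub>C\<^sub>1\<^esub>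
        ((zet K A \<boxtimes>\<^bsub>C\<^sub>1\<^esub> ide C\<^sub>1 ?Y) \<boxtimes>\<^bsub>C\<^sub>1\<^esub> (ide C\<^sub>1 ?GA \<boxtimes>\<^bsub>C\<^sub>1\<^esub> ide C\<^sub>1 B))"
      by (subst C1.cmp_reassoc[OF C1.ev_tau]) simp_all
    also have "\<dots> = ((\<epsilon>' K \<cdot>\<^bsub>C\<^sub>1\<^esub> far G ?e \<cdot>\<^bsub>C\<^sub>1\<^esub> lam ?X A) \<boxtimes>\<^bsub>C\<^sub>1\<^esub> ev C\<^sub>1 B M) \<cdot>\<^bsub>C\<^sub>1\<^esub> ?j"
      using C1.interchange_nat[of "zet K A" "ide C\<^sub>1 ?Y" "ide C\<^sub>1 ?GA" "ide C\<^sub>1 B"]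
      by (simp add: C1.fuse ev_zeta)
    finally show ?thesis .
  qed
  \<comment> \<open>The pairing, before direct image, of everything that stands under
    \<open>far G\<close>: \<theta> after the tensor product of the two evaluations, the second one
    being that of \<beta>.\<close>
  have q: "ev C\<^sub>2 ?T (fob H ?L) \<cdot>\<^bsub>C\<^sub>2\<^esub> (?q \<boxtimes>\<^bsub>C\<^sub>2\<^esub> ide C\<^sub>2 ?T)
    = tht K M \<cdot>\<^bsub>C\<^sub>2\<^esub> (?e \<boxtimes>\<^bsub>C\<^sub>2\<^esub> (far F (ev C\<^sub>1 B M) \<cdot>\<^bsub>C\<^sub>2\<^esub> mult F ?Y B)) \<cdot>\<^bsub>C\<^sub>2\<^esub> ?i"
  proof -
    have "ev C\<^sub>2 ?T (fob H ?L) \<cdot>\<^bsub>C\<^sub>2\<^esub> (?q \<boxtimes>\<^bsub>C\<^sub>2\<^esub> ide C\<^sub>2 ?T)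
      = tht K M \<cdot>\<^bsub>C\<^sub>2\<^esub> ev C\<^sub>2 ?T (fob H K \<otimes>\<^bsub>C\<^sub>2\<^esub> fob F M) \<cdot>\<^bsub>C\<^sub>2\<^esub>
        (tau C\<^sub>2 (fob H K) (fob F M) A (fob F B) \<boxtimes>\<^bsub>C\<^sub>2\<^esub> ide C\<^sub>2 ?T) \<cdot>\<^bsub>C\<^sub>2\<^esub>
        ((ide C\<^sub>2 ?X \<boxtimes>\<^bsub>C\<^sub>2\<^esub> beta C\<^sub>1 C\<^sub>2 F M B) \<boxtimes>\<^bsub>C\<^sub>2\<^esub> ide C\<^sub>2 ?T)"
      using C2.ev_ihom_comp[of ?T "tht K M" "tau C\<^sub>2 (fob H K) (fob F M) A (fob F B) \<cdot>\<^bsub>C\<^sub>2\<^esub>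
          (ide C\<^sub>2 ?X \<boxtimes>\<^bsub>C\<^sub>2\<^esub> beta C\<^sub>1 C\<^sub>2 F M B)"] by (simp add: C2.fuse)
    also have "\<dots> = tht K M \<cdot>\<^bsub>C\<^sub>2\<^esub> (?e \<boxtimes>\<^bsub>C\<^sub>2\<^esub> ev C\<^sub>2 (fob F B) (fob F M)) \<cdot>\<^bsub>C\<^sub>2\<^esub>
        interchange C\<^sub>2 ?X \<lblot>fob F B, fob F M\<rblot>\<^bsub>C\<^sub>2\<^esub> A (fob F B) \<cdot>\<^bsub>C\<^sub>2\<^esub>
        ((ide C\<^sub>2 ?X \<boxtimes>\<^bsub>C\<^sub>2\<^esub> beta C\<^sub>1 C\<^sub>2 F M B) \<boxtimes>\<^bsub>C\<^sub>2\<^esub> ide C\<^sub>2 ?T)"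
      by (subst C2.cmp_reassoc[OF C2.ev_tau]) simp_all
    also have "\<dots> = tht K M \<cdot>\<^bsub>C\<^sub>2\<^esub> (?e \<boxtimes>\<^bsub>C\<^sub>2\<^esub> (far F (ev C\<^sub>1 B M) \<cdot>\<^bsub>C\<^sub>2\<^esub> mult F ?Y B)) \<cdot>\<^bsub>C\<^sub>2\<^esub> ?i"
      using C2.interchange_nat[of "ide C\<^sub>2 ?X" "beta C\<^sub>1 C\<^sub>2 F M B" "ide C\<^sub>2 A" "ide C\<^sub>2 (fob F B)"]
      by (simp add: C2.fuse ev_beta)
    finally show ?thesis .
  qed
  \<comment> \<open>The outer \<open>prj A B\<close> acts contravariantly, so evaluation moves it to
    the second argument. The identity that remains there is written as \<open>far G\<close> of an
    identity, which makes \<open>lam_nat\<close> applicable to it and \<open>?q\<close>.\<close>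
  have "ev C\<^sub>1 (?GA \<otimes>\<^bsub>C\<^sub>1\<^esub> B) ?L \<cdot>\<^bsub>C\<^sub>1\<^esub>
      ((\<lbrace>prj A B, ide C\<^sub>1 ?L\<rbrace>\<^bsub>C\<^sub>1\<^esub> \<cdot>\<^bsub>C\<^sub>1\<^esub> (?z \<cdot>\<^bsub>C\<^sub>1\<^esub> far G ?q) \<cdot>\<^bsub>C\<^sub>1\<^esub> ?p) \<boxtimes>\<^bsub>C\<^sub>1\<^esub> ide C\<^sub>1 (?GA \<otimes>\<^bsub>C\<^sub>1\<^esub> B))
    = ev C\<^sub>1 (fob G ?T) ?L \<cdot>\<^bsub>C\<^sub>1\<^esub> (?z \<boxtimes>\<^bsub>C\<^sub>1\<^esub> ide C\<^sub>1 (fob G ?T)) \<cdot>\<^bsub>C\<^sub>1\<^esub>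
      (far G ?q \<boxtimes>\<^bsub>C\<^sub>1\<^esub> far G (ide C\<^sub>2 ?T)) \<cdot>\<^bsub>C\<^sub>1\<^esub> (?p \<boxtimes>\<^bsub>C\<^sub>1\<^esub> prj A B)"
    using C1.ev_ihom_left_comp[of "prj A B" ?L "(?z \<cdot>\<^bsub>C\<^sub>1\<^esub> far G ?q) \<cdot>\<^bsub>C\<^sub>1\<^esub> ?p"] by (simp add: C1.fuse)
  also have "\<dots> = \<epsilon>' ?L \<cdot>\<^bsub>C\<^sub>1\<^esub> far G (ev C\<^sub>2 ?T (fob H ?L)) \<cdot>\<^bsub>C\<^sub>1\<^esub> lam \<lblot>?T, fob H ?L\<rblot>\<^bsub>C\<^sub>2\<^esub> ?T \<cdot>\<^bsub>C\<^sub>1\<^esub>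
      (far G ?q \<boxtimes>\<^bsub>C\<^sub>1\<^esub> far G (ide C\<^sub>2 ?T)) \<cdot>\<^bsub>C\<^sub>1\<^esub> (?p \<boxtimes>\<^bsub>C\<^sub>1\<^esub> prj A B)"
    by (subst C1.cmp_reassoc[OF ev_zeta]) simp_all
  also have "\<dots> = \<epsilon>' ?L \<cdot>\<^bsub>C\<^sub>1\<^esub> far G (ev C\<^sub>2 ?T (fob H ?L)) \<cdot>\<^bsub>C\<^sub>1\<^esub> far G (?q \<boxtimes>\<^bsub>C\<^sub>2\<^esub> ide C\<^sub>2 ?T) \<cdot>\<^bsub>C\<^sub>1\<^esub>
      lam (?X \<otimes>\<^bsub>C\<^sub>2\<^esub> fob F ?Y) ?T \<cdot>\<^bsub>C\<^sub>1\<^esub> (?p \<boxtimes>\<^bsub>C\<^sub>1\<^esub> prj A B)"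
    using C1.cmp_reassoc2[OF lam_nat[of ?q "ide C\<^sub>2 ?T"], of "?p \<boxtimes>\<^bsub>C\<^sub>1\<^esub> prj A B"] by simp
  also have "\<dots> = \<epsilon>' ?L \<cdot>\<^bsub>C\<^sub>1\<^esub> far G (ev C\<^sub>2 ?T (fob H ?L) \<cdot>\<^bsub>C\<^sub>2\<^esub> (?q \<boxtimes>\<^bsub>C\<^sub>2\<^esub> ide C\<^sub>2 ?T)) \<cdot>\<^bsub>C\<^sub>1\<^esub>
      lam (?X \<otimes>\<^bsub>C\<^sub>2\<^esub> fob F ?Y) ?T \<cdot>\<^bsub>C\<^sub>1\<^esub> (?p \<boxtimes>\<^bsub>C\<^sub>1\<^esub> prj A B)"
    by (subst FG.R.far_comp) simp_all
  also have "\<dots> = (\<epsilon>' ?L \<cdot>\<^bsub>C\<^sub>1\<^esub> far G (tht K M)) \<cdot>\<^bsub>C\<^sub>1\<^esub> ?r \<cdot>\<^bsub>C\<^sub>1\<^esub>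
      lam (?X \<otimes>\<^bsub>C\<^sub>2\<^esub> fob F ?Y) ?T \<cdot>\<^bsub>C\<^sub>1\<^esub> (?p \<boxtimes>\<^bsub>C\<^sub>1\<^esub> prj A B)"
    unfolding q by (subst FG.R.far_comp) simp_all
  \<comment> \<open>Here \<theta> disappears: the counit \<open>\<epsilon>'\<close> after
    \<open>far G\<close> of it is its transpose, which contains the inverse of \<pi> at
    \<open>fob H K\<close> and M.\<close>
  also have "\<dots> = (\<epsilon>' K \<boxtimes>\<^bsub>C\<^sub>1\<^esub> ide C\<^sub>1 M) \<cdot>\<^bsub>C\<^sub>1\<^esub> inv_arr C\<^sub>1 (prj (fob H K) M) \<cdot>\<^bsub>C\<^sub>1\<^esub>
      far G (?e \<boxtimes>\<^bsub>C\<^sub>2\<^esub> far F (ev C\<^sub>1 B M)) \<cdot>\<^bsub>C\<^sub>1\<^esub> far G (ide C\<^sub>2 (?X \<otimes>\<^bsub>C\<^sub>2\<^esub> A) \<boxtimes>\<^bsub>C\<^sub>2\<^esub> mult F ?Y B) \<cdot>\<^bsub>C\<^sub>1\<^esub>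
      far G ?i \<cdot>\<^bsub>C\<^sub>1\<^esub> lam (?X \<otimes>\<^bsub>C\<^sub>2\<^esub> fob F ?Y) ?T \<cdot>\<^bsub>C\<^sub>1\<^esub> (?p \<boxtimes>\<^bsub>C\<^sub>1\<^esub> prj A B)"
  proof -
    have "?r = far G (?e \<boxtimes>\<^bsub>C\<^sub>2\<^esub> far F (ev C\<^sub>1 B M)) \<cdot>\<^bsub>C\<^sub>1\<^esub>
        far G (ide C\<^sub>2 (?X \<otimes>\<^bsub>C\<^sub>2\<^esub> A) \<boxtimes>\<^bsub>C\<^sub>2\<^esub> mult F ?Y B) \<cdot>\<^bsub>C\<^sub>1\<^esub> far G ?i"
      by (simp add: FG.R.far_comp[symmetric] C2.fuse)
    then show ?thesis by (simp add: counit_theta)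
  qed
  also have "\<dots> = (\<epsilon>' K \<boxtimes>\<^bsub>C\<^sub>1\<^esub> ide C\<^sub>1 M) \<cdot>\<^bsub>C\<^sub>1\<^esub> inv_arr C\<^sub>1 (prj (fob H K) M) \<cdot>\<^bsub>C\<^sub>1\<^esub>
      (far G (?e \<boxtimes>\<^bsub>C\<^sub>2\<^esub> far F (ev C\<^sub>1 B M)) \<cdot>\<^bsub>C\<^sub>1\<^esub> prj (?X \<otimes>\<^bsub>C\<^sub>2\<^esub> A) (?Y \<otimes>\<^bsub>C\<^sub>1\<^esub> B)) \<cdot>\<^bsub>C\<^sub>1\<^esub>
      (lam ?X A \<boxtimes>\<^bsub>C\<^sub>1\<^esub> ide C\<^sub>1 (?Y \<otimes>\<^bsub>C\<^sub>1\<^esub> B)) \<cdot>\<^bsub>C\<^sub>1\<^esub> ?j"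
    by (simp add: prj_interchange)
  \<comment> \<open>Naturality of \<pi> in the two evaluations changes its objects to their targets
    \<open>fob H K\<close> and M, where it cancels against the inverse left by \<theta>.\<close>
  also have "\<dots> = (\<epsilon>' K \<boxtimes>\<^bsub>C\<^sub>1\<^esub> ide C\<^sub>1 M) \<cdot>\<^bsub>C\<^sub>1\<^esub> (far G ?e \<boxtimes>\<^bsub>C\<^sub>1\<^esub> ev C\<^sub>1 B M) \<cdot>\<^bsub>C\<^sub>1\<^esub>
      (lam ?X A \<boxtimes>\<^bsub>C\<^sub>1\<^esub> ide C\<^sub>1 (?Y \<otimes>\<^bsub>C\<^sub>1\<^esub> B)) \<cdot>\<^bsub>C\<^sub>1\<^esub> ?j"
    using prj_nat[of ?e "ev C\<^sub>1 B M", symmetric] by simp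
  also have "\<dots> = ((\<epsilon>' K \<cdot>\<^bsub>C\<^sub>1\<^esub> far G ?e \<cdot>\<^bsub>C\<^sub>1\<^esub> lam ?X A) \<boxtimes>\<^bsub>C\<^sub>1\<^esub> ev C\<^sub>1 B M) \<cdot>\<^bsub>C\<^sub>1\<^esub> ?j"
    by (simp add: C1.fuse)
  finally show "ev C\<^sub>1 (?GA \<otimes>\<^bsub>C\<^sub>1\<^esub> B) ?L \<cdot>\<^bsub>C\<^sub>1\<^esub> (?l \<boxtimes>\<^bsub>C\<^sub>1\<^esub> ide C\<^sub>1 (?GA \<otimes>\<^bsub>C\<^sub>1\<^esub> B))
    = ev C\<^sub>1 (?GA \<otimes>\<^bsub>C\<^sub>1\<^esub> B) ?L \<cdot>\<^bsub>C\<^sub>1\<^esub>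
      ((\<lbrace>prj A B, ide C\<^sub>1 ?L\<rbrace>\<^bsub>C\<^sub>1\<^esub> \<cdot>\<^bsub>C\<^sub>1\<^esub> (?z \<cdot>\<^bsub>C\<^sub>1\<^esub> far G ?q) \<cdot>\<^bsub>C\<^sub>1\<^esub> ?p) \<boxtimes>\<^bsub>C\<^sub>1\<^esub> ide C\<^sub>1 (?GA \<otimes>\<^bsub>C\<^sub>1\<^esub> B))"
    using lhs by simp
qed simp_all

end

text \<open>Stated with projections, because the composites in the theorem are not literally
  pairs.\<close>

lemma dp_morphismI:
  assumes "duality_preserving X Y P" "duality_preserving X Y Q"
    and "nat_trans (fst X) (fst Y) (fst P) (fst Q) \<rho>"
    and "\<And>A. A \<in> obj (fst X) \<Longrightarrow> snd P A =
      far (fst (snd Y)) (\<rho> A) \<cdot>\<^bsub>fst Y\<^esub> snd Q A \<cdot>\<^bsub>fst Y\<^esub> \<rho> (fob (fst (snd X)) A)"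
  shows "dp_morphism X Y P Q \<rho>"
  using assms by (auto simp: dp_morphism_def split: prod.splits)

theorem theorem5p5p1:
  fixes C\<^sub>1 :: "('o, 'a) smc_category" and C\<^sub>2 :: "('p, 'b) smc_category"
    and F :: "('o, 'a, 'p, 'b) monoidal_funct"
    and G :: "('p, 'b, 'o, 'a) funct" and H :: "('o, 'a, 'p, 'b) funct"
    and \<eta> :: "'o \<Rightarrow> 'a" and \<epsilon> :: "'p \<Rightarrow> 'b" and \<eta>' :: "'p \<Rightarrow> 'b" and \<epsilon>' :: "'o \<Rightarrow> 'a"
    and K M :: 'o
  assumes C1: "symmetric_monoidal_closed C\<^sub>1" and C2: "symmetric_monoidal_closed C\<^sub>2"
    and F: "symmetric_monoidal_functor C\<^sub>1 C\<^sub>2 F"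
    and FG: "adjunction C\<^sub>1 C\<^sub>2 F G \<eta> \<epsilon>"
    and GH: "adjunction C\<^sub>2 C\<^sub>1 G H \<eta>' \<epsilon>'"
    and proj_is_iso: "\<And>A B. A \<in> obj C\<^sub>2 \<Longrightarrow> B \<in> obj C\<^sub>1 \<Longrightarrow> is_iso C\<^sub>1 (proj_mor C\<^sub>1 C\<^sub>2 F G \<eta> \<epsilon> A B)"
    and K: "K \<in> obj C\<^sub>1" and M: "M \<in> obj C\<^sub>1"
  shows "dp_morphism
    (dual_cat_of C\<^sub>2 (fob H K) \<times>\<^sub>D dual_cat_of C\<^sub>1 M)
    (dual_cat_of C\<^sub>1 (K \<otimes>\<^bsub>C\<^sub>1\<^esub> M))
    (dp_comp C\<^sub>1 (dp_tensor C\<^sub>1 K M)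
      (dp_push C\<^sub>1 C\<^sub>2 F G H \<eta> \<epsilon> \<epsilon>' K \<times>\<^sub>D\<^sub>P dp_id (dual_cat_of C\<^sub>1 M)))
    (dp_comp C\<^sub>1 (dp_push C\<^sub>1 C\<^sub>2 F G H \<eta> \<epsilon> \<epsilon>' (K \<otimes>\<^bsub>C\<^sub>1\<^esub> M))
      (dp_comp C\<^sub>2 (dp_change C\<^sub>2 (theta C\<^sub>1 C\<^sub>2 F G H \<eta> \<epsilon> \<eta>' \<epsilon>' K M))
        (dp_comp C\<^sub>2 (dp_tensor C\<^sub>2 (fob H K) (fob F M))
          (dp_id (dual_cat_of C\<^sub>2 (fob H K)) \<times>\<^sub>D\<^sub>P dp_pull C\<^sub>1 C\<^sub>2 F M))))
    (\<lambda>(A, B). proj_mor C\<^sub>1 C\<^sub>2 F G \<eta> \<epsilon> A B)"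
proof -
  interpret C1: symmetric_monoidal_closed C\<^sub>1 by fact
  interpret C2: symmetric_monoidal_closed C\<^sub>2 by fact
  interpret F: symmetric_monoidal_functor C\<^sub>1 C\<^sub>2 F by fact
  interpret FG: adjunction C\<^sub>1 C\<^sub>2 F G \<eta> \<epsilon> by fact
  interpret GH: adjunction C\<^sub>2 C\<^sub>1 G H \<eta>' \<epsilon>' by fact
  interpret twisted_inverse_image C\<^sub>1 C\<^sub>2 F G \<eta> \<epsilon> H \<eta>' \<epsilon>'
    by unfold_locales (rule proj_is_iso)
  note [simp] = K M
  \<comment> \<open>\<open>duality_preserving_comp\<close> composes over \<open>fst Z\<close>; these
    rules turn that into the categories named in the statement.\<close>
  have fst_dual [simp]: "fst (dual_cat_of C\<^sub>1 L) = C\<^sub>1" "fst (dual_cat_of C\<^sub>2 N) = C\<^sub>2" for L N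
    by (simp_all add: dual_cat_of_def)
  let ?X = "dual_cat_of C\<^sub>2 (fob H K) \<times>\<^sub>D dual_cat_of C\<^sub>1 M"
  let ?Y = "dual_cat_of C\<^sub>1 (K \<otimes>\<^bsub>C\<^sub>1\<^esub> M)"
  let ?P = "dp_comp C\<^sub>1 (dp_tensor C\<^sub>1 K M)
      (dp_push C\<^sub>1 C\<^sub>2 F G H \<eta> \<epsilon> \<epsilon>' K \<times>\<^sub>D\<^sub>P dp_id (dual_cat_of C\<^sub>1 M))"
  let ?Q = "dp_comp C\<^sub>2 (dp_tensor C\<^sub>2 (fob H K) (fob F M))
          (dp_id (dual_cat_of C\<^sub>2 (fob H K)) \<times>\<^sub>D\<^sub>P dp_pull C\<^sub>1 C\<^sub>2 F M)"
  let ?R = "dp_comp C\<^sub>2 (dp_change C\<^sub>2 (tht K M)) ?Q"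
  let ?S = "dp_comp C\<^sub>1 (dp_push C\<^sub>1 C\<^sub>2 F G H \<eta> \<epsilon> \<epsilon>' (K \<otimes>\<^bsub>C\<^sub>1\<^esub> M)) ?R"
  have P: "duality_preserving ?X ?Y ?P"
    using duality_preserving_comp[OF duality_preserving_prod[OF duality_preserving_dp_push[of K]
      duality_preserving_id[OF C1.category_with_duality_dual_cat_of[of M]]]
      C1.duality_preserving_dp_tensor[of K M]] by simp
  have "duality_preserving ?X (dual_cat_of C\<^sub>2 (fob H K \<otimes>\<^bsub>C\<^sub>2\<^esub> fob F M)) ?Q"
    using duality_preserving_comp[OF duality_preserving_prod[OF
      duality_preserving_id[OF C2.category_with_duality_dual_cat_of[of "fob H K"]]
      duality_preserving_dp_pull[of M]] C2.duality_preserving_dp_tensor[of "fob H K" "fob F M"]] by simp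
  \<comment> \<open>\<theta> links the two halves: it carries the dualizing object from the tensor
    product of \<open>fob H K\<close> and \<open>fob F M\<close> to \<open>H\<close> of the tensor
    product of K and M, where the push-forward starts.\<close>
  then have "duality_preserving ?X (dual_cat_of C\<^sub>2 (fob H (K \<otimes>\<^bsub>C\<^sub>1\<^esub> M))) ?R"
    using duality_preserving_comp[OF _ C2.duality_preserving_dp_change[of _ _ "tht K M"]]
    by (fastforce simp: hom_iff)
  then have S: "duality_preserving ?X ?Y ?S"
    using duality_preserving_comp[OF _ duality_preserving_dp_push[of "K \<otimes>\<^bsub>C\<^sub>1\<^esub> M"]] by fastforce
  note dp_defs = dual_cat_of_def dual_cat_prod_def dp_comp_def dp_tensor_def dp_push_def dp_prod_def
    dp_id_def dp_pull_def dp_change_def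
  have fst_P: "fst ?P = tensor C\<^sub>1 \<circ>\<^sub>F (G \<times>\<^sub>F id_fun)"
    and fst_S: "fst ?S = G \<circ>\<^sub>F (id_fun \<circ>\<^sub>F (tensor C\<^sub>2 \<circ>\<^sub>F (id_fun \<times>\<^sub>F funct.truncate F)))"
    by (simp_all add: dp_defs)
  have nat: "nat_trans (C\<^sub>2 \<times>\<^sub>C C\<^sub>1) C\<^sub>1 (fst ?P) (fst ?S) (\<lambda>(A, B). prj A B)"
  proof (rule nat_transI)
    show "is_functor (C\<^sub>2 \<times>\<^sub>C C\<^sub>1) C\<^sub>1 (fst ?P)"
      using P by (auto simp: duality_preserving_def dual_cat_of_def dual_cat_prod_def split: prod.splits)
    show "is_functor (C\<^sub>2 \<times>\<^sub>C C\<^sub>1) C\<^sub>1 (fst ?S)"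
      using S by (auto simp: duality_preserving_def dual_cat_of_def dual_cat_prod_def split: prod.splits)
  qed (unfold fst_P fst_S, auto simp: prj_nat)
  \<comment> \<open>The identities supplied by the two occurrences of \<open>dp_id\<close> are those
    of [B,M] and of [A,HK], so unfolding at a pair gives exactly \<open>prj_duality\<close>.\<close>
  have "snd ?P Z = far (dual_fun C\<^sub>1 (K \<otimes>\<^bsub>C\<^sub>1\<^esub> M)) ((\<lambda>(A, B). prj A B) Z) \<cdot>\<^bsub>C\<^sub>1\<^esub> snd ?S Z \<cdot>\<^bsub>C\<^sub>1\<^esub>
      ((\<lambda>(A, B). prj A B) (fob (dual_fun C\<^sub>2 (fob H K) \<times>\<^sub>F dual_fun C\<^sub>1 M) Z))"
    if "Z \<in> obj (C\<^sub>2 \<times>\<^sub>C C\<^sub>1)" for Z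
    using that prj_duality[OF K M] by (auto simp: dp_defs prod_trans_def)
  with P S nat show ?thesis
    by (intro dp_morphismI) (simp_all add: dual_cat_of_def dual_cat_prod_def)
qed

end
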